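(* Let the system $\dot x=f(t,x)$, $f\in C^2(S^1_T\times\mathbb R^n,\mathbb R^n)$, have an exponentially stable periodic orbit $\Omega$ with basin of attraction $A(\Omega)$. Let $\mathcal C\in\mathcal N$ be a compact set in the cylinder $S^1_T\times\mathbb R^n$ with $\Omega\subset\mathcal C\subset A(\Omega)$. Fix $\epsilon_0>0$. Then there is a $K^*\in\mathbb N$ such that the semidefinite optimization problem (Constraints 1–5 in the context) is feasible for all triangulations $\mathcal T^{\mathcal C}_K$ with $K\ge K^*$. Moreover, the constants $C_\nu$ and $D_\nu$ can be chosen to be the same for each simplex, i.e. $C_\nu=C$ and $D_\nu=D$ for all $\nu$.
   Context: ODE. Let $T>0$, $S^1_T$ the circle of circumference $T$; functions on $S^1_T\times\mathbb R^n$ are functions of $(t,x)$ that are $T$-periodic in $t$. Write $\tilde x=(t,x)$, $x_0:=t$, $\tilde f(\tilde x)=(1,f(\tilde x))\in\mathbb R^{n+1}$. $S_\theta(t_0,x_0)=(t_0+\theta\bmod T,x(t_0+\theta))$, where $x$ is the solution with $x(t_0)=x_0$; solutions are assumed to exist for all $\theta\ge0$. A periodic orbit is a set $\Omega=\{(t,\tilde x(t))\}\subset S^1_T\times\mathbb R^n$ with $\tilde x(\cdot)$ a $T$-periodic solution; it is exponentially stable if it is exponentially asymptotically stable, equivalently the maximal real part of its Floquet exponents (those of $\dot y=D_xf(t,\tilde x(t))y$) is negative. $A(\Omega)$ is the set of all $(t_0,x_0)$ with $\operatorname{dist}(S_\theta(t_0,x_0),\Omega)\to0$ as $\theta\to\infty$.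 $D_xf$ is the Jacobian with respect to $x$, $A\preceq B$ means $B-A$ is positive semidefinite, $\operatorname{co}$ is the convex hull. Triangulation. $\mathcal N$ is the set of all compact $\mathcal D\subset S^1_T\times\mathbb R^n$ with connected interior $\mathcal D^\circ$ and $\mathcal D=\overline{\mathcal D^\circ}$. Fix, independently of $K$, $S=\operatorname{diag}(1,s_1,\dots,s_n)$ with $s_i>0$; for $K\in\mathbb N_0$ let $\rho=2^{-K}T$. Let $\tilde e_0,\dots,\tilde e_n$ be the standard basis of $\mathbb R\times\mathbb R^n$ ($\tilde e_0$ in $t$-direction), and for $\mathcal J\subset\{1,\dots,n\}$ let $\mathbf R^{\mathcal J}(\tilde x)=x_0\tilde e_0+\sum_{i=1}^n(-1)^{\chi_{\mathcal J}(i)}x_i\tilde e_i$, where $\chi_{\mathcal J}$ is the characteristic function of $\mathcal J$. $\mathcal T^{\rm basic}_K$ is the set of all $(n+1)$-simplices $\operatorname{co}\big(\rho S\mathbf R^{\mathcal J}(\tilde z+\sum_{i=0}^j\tilde e_{\sigma(i)}):j=-1,0,\dots,n\big)$ with $\tilde z\in\mathbb N_0^{n+1}$, $\mathcal J\subset\{1,\dots,n\}$, $\sigma$ a permutation of $\{0,\dots,n\}$. Each such simplex lies in $[iT,(i+1)T]\times\mathbb R^n$ for some $i\in\mathbb N_0$ and is regarded as a subset of $S^1_T\times\mathbb R^n$ (with time taken in $[0,T]$). $\mathcal T^{\mathcal C}_K:=\{\mathfrak S\in\mathcal T^{\rm basic}_K:\mathfrak S\cap\mathcal C^\circ\ne\varnothing\}$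 (finitely many simplices), denoted $\mathfrak S_\nu=\operatorname{co}(\tilde x_0,\dots,\tilde x_{n+1})$. Constants. $h_\nu=\max_{\tilde x,\tilde y\in\mathfrak S_\nu}\|\tilde x-\tilde y\|_2$, $B_\nu=\max_{\tilde x\in\mathfrak S_\nu,\,i,j\in\{0,\dots,n\}}\big\|\frac{\partial^2f(\tilde x)}{\partial x_i\partial x_j}\big\|_\infty$ and, if $f\in C^3$, $B_{3,\nu}=\max_{\tilde x\in\mathfrak S_\nu,\,i,j,k\in\{0,\dots,n\}}\big\|\frac{\partial^3f(\tilde x)}{\partial x_i\partial x_j\partial x_k}\big\|_\infty$. Semidefinite problem. Variables: $M_{ij}(\tilde x_k)\in\mathbb R$ for $1\le i\le j\le n$ and all vertices $\tilde x_k$ of simplices of $\mathcal T^{\mathcal C}_K$ (with $M_{ji}(\tilde x_k):=M_{ij}(\tilde x_k)$), and $C_\nu,D_\nu\ge0$ for each $\mathfrak S_\nu$. The problem is feasible if there are values of the variables satisfying: 1. $M_{ij}(0,x_k)=M_{ij}(T,x_k)$ for all $1\le i\le j\le n$ and all vertices $(0,x_k)$, $(T,x_k)$. 2. $M(\tilde x_k)\preceq C_\nu I$ for all vertices $\tilde x_k$ of all $\mathfrak S_\nu$. 3. $|(w^\nu_{ij})_l|\le\frac{D_\nu}{n+1}$ for all $l=0,\dots,n$, $1\le i\le j\le n$ and all $\mathfrak S_\nu$, where $w^\nu_{ij}=X_{K,\nu}^{-1}\big(M_{ij}(\tilde x_1)-M_{ij}(\tilde x_0),\dots,M_{ij}(\tilde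 x_{n+1})-M_{ij}(\tilde x_0)\big)^T\in\mathbb R^{n+1}$ and $X_{K,\nu}$ is the matrix with rows $(\tilde x_k-\tilde x_0)^T$, $k=1,\dots,n+1$; set $w^\nu_{ji}=w^\nu_{ij}$. 4. $M(\tilde x_k)\succeq\epsilon_0I$ for all vertices. 5. $M(\tilde x_k)D_xf(\tilde x_k)+D_xf(\tilde x_k)^TM(\tilde x_k)+(w^\nu_{ij}\cdot\tilde f(\tilde x_k))_{i,j=1,\dots,n}+(E_\nu+1)I\preceq0$ for all $\mathfrak S_\nu$ and all its vertices $\tilde x_k$, where $E_\nu=h_\nu nB_\nu[\sqrt{n+1}\,h_\nu D_\nu+2n(n+1)C_\nu]$ if $f\in C^2$, and $E_\nu=h_\nu^2n[\sqrt{n+1}(1+4n)B_\nu D_\nu+2n(n+1)B_{3,\nu}C_\nu]$ if $f\in C^3$. *)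

theory Defs
  imports "HOL-Analysis.Analysis"
begin

text \<open>
  Points of \<open>\<real> \<times> \<real>\<^sup>n\<close> are pairs \<open>(t, x)\<close> with \<open>x :: real ^ 'n\<close> and \<open>n = CARD('n)\<close>. The index
  set \<open>{0, \<dots>, n}\<close> of the \<open>n + 1\<close> coordinates is \<open>'n option\<close>: \<open>None\<close> is the index \<open>0\<close> of the time
  coordinate and \<open>Some i\<close> is the index of the space coordinate \<open>i\<close>.
\<close>

type_synonym 'n point = "real \<times> (real ^ 'n)"

definition unit_vec :: "'n::finite option \<Rightarrow> 'n point" where
  "unit_vec k = (case k of None \<Rightarrow> (1, 0) | Some i \<Rightarrow> (0, axis i 1))"

definition coords :: "'n::finite point \<Rightarrow> real ^ 'n option" where
  "coords p = (\<chi> k. case k of None \<Rightarrow> fst p | Some i \<Rightarrow> snd p $ i)"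


section \<open>The cylinder\<close>

text \<open>
  The circle of circumference \<open>T\<close> is the circle of radius \<open>T / (2 * pi)\<close> in the complex plane, and
  \<open>cyl T\<close> is the projection of \<open>\<real> \<times> \<real>\<^sup>n\<close> onto the cylinder over it. Distances on the cylinder are
  those of the ambient space; they are uniformly equivalent (with constant factors) to those obtained
  from arc length on the circle, so that notions of stability and attraction are the same for both.
\<close>

definition cylinder :: "real \<Rightarrow> (complex \<times> (real ^ 'n::finite)) set" where
  "cylinder T = sphere 0 (T / (2 * pi)) \<times> UNIV"

definition cyl :: "real \<Rightarrow> 'n::finite point \<Rightarrow> complex \<times> (real ^ 'n)" where
  "cyl T p = (complex_of_real (T / (2 * pi)) * cis (2 * pi * fst p / T), snd p)"

abbreviation cyl_interior ::
    "real \<Rightarrow> (complex \<times> (real ^ 'n::finite)) set \<Rightarrow> (complex \<times> (real ^ 'n)) set" where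
  "cyl_interior T D \<equiv> top_of_set (cylinder T) interior_of D"

definition set_class_N :: "real \<Rightarrow> (complex \<times> (real ^ 'n::finite)) set set" where
  "set_class_N T = {D. D \<subseteq> cylinder T \<and> compact D \<and> connected (cyl_interior T D) \<and>
     D = top_of_set (cylinder T) closure_of (cyl_interior T D)}"


section \<open>Derivatives\<close>

definition partial_deriv ::
    "'n::finite option \<Rightarrow> ('n point \<Rightarrow> real ^ 'n) \<Rightarrow> 'n point \<Rightarrow> real ^ 'n" where
  "partial_deriv i f p = frechet_derivative f (at p) (unit_vec i)"

primrec C_k :: "nat \<Rightarrow> ('n::finite point \<Rightarrow> real ^ 'n) \<Rightarrow> bool" where
  "C_k 0 f \<longleftrightarrow> continuous_on UNIV f"
| "C_k (Suc k) f \<longleftrightarrow> f differentiable_on UNIV \<and> (\<forall>i. C_k k (partial_deriv i f))"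

definition Dx :: "('n::finite point \<Rightarrow> real ^ 'n) \<Rightarrow> 'n point \<Rightarrow> real ^ 'n ^ 'n" where
  "Dx f p = jacobian (\<lambda>y. f (fst p, y)) (at (snd p))"


section \<open>Solutions, periodic orbits and basins of attraction\<close>

definition solves_ivp ::
    "('n::finite point \<Rightarrow> real ^ 'n) \<Rightarrow> 'n point \<Rightarrow> (real \<Rightarrow> real ^ 'n) \<Rightarrow> bool" where
  "solves_ivp f p x \<longleftrightarrow> x (fst p) = snd p \<and>
     (\<forall>t\<ge>fst p. (x has_vector_derivative f (t, x t)) (at t within {fst p..}))"

text \<open>
  The flow on \<open>\<real> \<times> \<real>\<^sup>n\<close>; the reduction of time modulo \<open>T\<close> is performed by \<open>cyl T\<close>. A solution is
  determined on \<open>{t\<^sub>0..}\<close> only, hence the description of its value at time \<open>t\<^sub>0 + \<theta>\<close> instead of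
  the function itself.
\<close>

definition flow :: "('n::finite point \<Rightarrow> real ^ 'n) \<Rightarrow> real \<Rightarrow> 'n point \<Rightarrow> 'n point" where
  "flow f \<theta> p = (fst p + \<theta>, THE y. \<exists>x. solves_ivp f p x \<and> y = x (fst p + \<theta>))"

definition periodic_orbit ::
    "real \<Rightarrow> ('n::finite point \<Rightarrow> real ^ 'n) \<Rightarrow> (complex \<times> (real ^ 'n)) set \<Rightarrow> bool" where
  "periodic_orbit T f \<Omega> \<longleftrightarrow> (\<exists>u. (\<forall>t. (u has_vector_derivative f (t, u t)) (at t)) \<and>
     (\<forall>t. u (t + T) = u t) \<and> \<Omega> = range (\<lambda>t. cyl T (t, u t)))"

definition exponentially_stable ::
    "real \<Rightarrow> ('n::finite point \<Rightarrow> real ^ 'n) \<Rightarrow> (complex \<times> (real ^ 'n)) set \<Rightarrow> bool" where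
  "exponentially_stable T f \<Omega> \<longleftrightarrow> (\<exists>\<delta>>0. \<exists>\<mu>>0. \<exists>c>0. \<forall>p. infdist (cyl T p) \<Omega> < \<delta> \<longrightarrow>
     (\<forall>\<theta>\<ge>0. infdist (cyl T (flow f \<theta> p)) \<Omega> \<le> c * exp (- \<mu> * \<theta>) * infdist (cyl T p) \<Omega>))"

definition basin ::
    "real \<Rightarrow> ('n::finite point \<Rightarrow> real ^ 'n) \<Rightarrow> (complex \<times> (real ^ 'n)) set \<Rightarrow> (complex \<times> (real ^ 'n)) set"
  where
  "basin T f \<Omega> =
     {cyl T p | p. ((\<lambda>\<theta>. infdist (cyl T (flow f \<theta> p)) \<Omega>) \<longlongrightarrow> 0) at_top}"


section \<open>The triangulation\<close>

text \<open>
  A simplex is given by the list \<open>\<nu>\<close> of its vertices, in the order \<open>j = -1, 0, \<dots>, n\<close>, so that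
  \<open>\<nu> ! k\<close> is the vertex with number \<open>k = j + 1\<close>; the simplex itself is \<open>convex hull set \<nu>\<close>.
  A permutation \<open>\<sigma>\<close> of \<open>{0, \<dots>, n}\<close> is given by the list of its values \<open>\<sigma> 0, \<dots>, \<sigma> n\<close>.
\<close>

definition reflect :: "'n::finite set \<Rightarrow> 'n point \<Rightarrow> 'n point" where
  "reflect J p = (fst p, \<chi> i. (- 1) ^ of_bool (i \<in> J) * snd p $ i)"

definition stretch :: "real ^ 'n \<Rightarrow> 'n::finite point \<Rightarrow> 'n point" where
  "stretch s p = (fst p, \<chi> i. s $ i * snd p $ i)"

definition grid_vertex ::
    "real \<Rightarrow> real ^ 'n \<Rightarrow> 'n::finite point \<Rightarrow> 'n set \<Rightarrow> 'n option list \<Rightarrow> nat \<Rightarrow> 'n point" where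
  "grid_vertex \<rho> s z J \<sigma> k = \<rho> *\<^sub>R stretch s (reflect J (z + (\<Sum>i<k. unit_vec (\<sigma> ! i))))"

definition basic_triangulation :: "real \<Rightarrow> real ^ 'n \<Rightarrow> nat \<Rightarrow> 'n::finite point list set" where
  "basic_triangulation T s K =
     {map (grid_vertex (T / 2 ^ K) s z J \<sigma>) [0..<CARD('n) + 2] | z J \<sigma>.
        (\<forall>i. coords z $ i \<in> \<nat>) \<and> distinct \<sigma> \<and> set \<sigma> = UNIV}"

text \<open>
  The basic triangulation is invariant under translation by \<open>T\<close> in (nonnegative) time, so each of its
  simplices, regarded as a subset of the cylinder, is represented by exactly one with time in \<open>[0, T]\<close>.
\<close>

definition triangulation ::
    "real \<Rightarrow> real ^ 'n \<Rightarrow> (complex \<times> (real ^ 'n::finite)) set \<Rightarrow> nat \<Rightarrow> 'n point list set" where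
  "triangulation T s \<C> K = {\<nu> \<in> basic_triangulation T s K.
     convex hull set \<nu> \<subseteq> {0..T} \<times> UNIV \<and> cyl T ` (convex hull set \<nu>) \<inter> cyl_interior T \<C> \<noteq> {}}"

definition vertices ::
    "real \<Rightarrow> real ^ 'n \<Rightarrow> (complex \<times> (real ^ 'n::finite)) set \<Rightarrow> nat \<Rightarrow> 'n point set" where
  "vertices T s \<C> K = (\<Union>\<nu>\<in>triangulation T s \<C> K. set \<nu>)"


section \<open>Constants of the simplices\<close>

definition h_const :: "'n::finite point list \<Rightarrow> real" where
  "h_const \<nu> = diameter (convex hull set \<nu>)"

definition B_const :: "('n::finite point \<Rightarrow> real ^ 'n) \<Rightarrow> 'n point list \<Rightarrow> real" where
  "B_const f \<nu> = Sup {infnorm (partial_deriv i (partial_deriv j f) p) | p i j.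
     p \<in> convex hull set \<nu>}"

definition B3_const :: "('n::finite point \<Rightarrow> real ^ 'n) \<Rightarrow> 'n point list \<Rightarrow> real" where
  "B3_const f \<nu> = Sup {infnorm (partial_deriv i (partial_deriv j (partial_deriv k f)) p) | p i j k.
     p \<in> convex hull set \<nu>}"

definition E_C2 ::
    "('n::finite point \<Rightarrow> real ^ 'n) \<Rightarrow> 'n point list \<Rightarrow> real \<Rightarrow> real \<Rightarrow> real" where
  "E_C2 f \<nu> C D = (let n = real CARD('n); h = h_const \<nu> in
     h * n * B_const f \<nu> * (sqrt (n + 1) * h * D + 2 * n * (n + 1) * C))"

definition E_C3 ::
    "('n::finite point \<Rightarrow> real ^ 'n) \<Rightarrow> 'n point list \<Rightarrow> real \<Rightarrow> real \<Rightarrow> real" where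
  "E_C3 f \<nu> C D = (let n = real CARD('n); h = h_const \<nu> in
     h\<^sup>2 * n * (sqrt (n + 1) * (1 + 4 * n) * B_const f \<nu> * D + 2 * n * (n + 1) * B3_const f \<nu> * C))"


section \<open>The semidefinite optimization problem\<close>

definition psd :: "real ^ 'n ^ 'n::finite \<Rightarrow> bool" where
  "psd A \<longleftrightarrow> transpose A = A \<and> (\<forall>x. 0 \<le> x \<bullet> (A *v x))"

definition matrix_le :: "real ^ 'n ^ 'n::finite \<Rightarrow> real ^ 'n ^ 'n \<Rightarrow> bool" (infix \<open>\<preceq>\<close> 50) where
  "A \<preceq> B \<longleftrightarrow> psd (B - A)"

text \<open>
  The rows of \<open>X\<close> belong to the vertices \<open>1, \<dots>, n + 1\<close>, but are indexed by the type \<open>'n option\<close>;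
  \<open>row_vertex\<close> is a bijection between the two index sets. The vector \<open>w_vec\<close> does not depend on which
  bijection is chosen, since a permutation of the rows of \<open>X\<close> permutes the right-hand side as well.
\<close>

definition row_vertex :: "'n::finite option \<Rightarrow> nat" where
  "row_vertex r = Suc (to_nat_on UNIV r)"

definition X_mat :: "'n::finite point list \<Rightarrow> real ^ 'n option ^ 'n option" where
  "X_mat \<nu> = (\<chi> r. coords (\<nu> ! row_vertex r - \<nu> ! 0))"

definition w_vec ::
    "('n::finite point \<Rightarrow> real ^ 'n ^ 'n) \<Rightarrow> 'n point list \<Rightarrow> 'n \<Rightarrow> 'n \<Rightarrow> real ^ 'n option" where
  "w_vec M \<nu> i j =
     matrix_inv (X_mat \<nu>) *v (\<chi> r. M (\<nu> ! row_vertex r) $ i $ j - M (\<nu> ! 0) $ i $ j)"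

text \<open>
  The variables \<open>M\<^sub>i\<^sub>j\<close> with \<open>i \<le> j\<close> are the entries of a symmetric matrix, so bounds imposed for
  \<open>i \<le> j\<close> are stated for all \<open>i, j\<close>. Only the values of \<open>M\<close> at vertices and those of \<open>C\<close> and \<open>D\<close> at
  simplices of the triangulation are relevant. The parameter \<open>E\<close> is one of \<open>E_C2 f\<close> and \<open>E_C3 f\<close>.
\<close>

definition sdp_solution ::
    "real \<Rightarrow> real ^ 'n \<Rightarrow> ('n::finite point \<Rightarrow> real ^ 'n) \<Rightarrow> (complex \<times> (real ^ 'n)) set \<Rightarrow> real \<Rightarrow>
     ('n point list \<Rightarrow> real \<Rightarrow> real \<Rightarrow> real) \<Rightarrow> nat \<Rightarrow>
     ('n point \<Rightarrow> real ^ 'n ^ 'n) \<Rightarrow> ('n point list \<Rightarrow> real) \<Rightarrow> ('n point list \<Rightarrow> real) \<Rightarrow> bool" where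
  "sdp_solution T s f \<C> \<epsilon>\<^sub>0 E K M C D \<longleftrightarrow>
     (\<forall>p\<in>vertices T s \<C> K. transpose (M p) = M p) \<and>
     (\<forall>\<nu>\<in>triangulation T s \<C> K. 0 \<le> C \<nu> \<and> 0 \<le> D \<nu>) \<and>
     (\<forall>x. (0, x) \<in> vertices T s \<C> K \<and> (T, x) \<in> vertices T s \<C> K \<longrightarrow> M (0, x) = M (T, x)) \<and>
     (\<forall>\<nu>\<in>triangulation T s \<C> K. \<forall>p\<in>set \<nu>. M p \<preceq> mat (C \<nu>)) \<and>
     (\<forall>\<nu>\<in>triangulation T s \<C> K. \<forall>i j l. \<bar>w_vec M \<nu> i j $ l\<bar> \<le> D \<nu> / (real CARD('n) + 1)) \<and>
     (\<forall>p\<in>vertices T s \<C> K. mat \<epsilon>\<^sub>0 \<preceq> M p) \<and>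
     (\<forall>\<nu>\<in>triangulation T s \<C> K. \<forall>p\<in>set \<nu>.
        M p ** Dx f p + transpose (Dx f p) ** M p + (\<chi> i j. w_vec M \<nu> i j \<bullet> coords (1, f p)) +
        mat (E \<nu> (C \<nu>) (D \<nu>) + 1) \<preceq> 0)"

definition sdp_feasible ::
    "real \<Rightarrow> real ^ 'n \<Rightarrow> ('n::finite point \<Rightarrow> real ^ 'n) \<Rightarrow> (complex \<times> (real ^ 'n)) set \<Rightarrow> real \<Rightarrow>
     ('n point list \<Rightarrow> real \<Rightarrow> real \<Rightarrow> real) \<Rightarrow> nat \<Rightarrow> bool" where
  "sdp_feasible T s f \<C> \<epsilon>\<^sub>0 E K \<longleftrightarrow> (\<exists>M C D. sdp_solution T s f \<C> \<epsilon>\<^sub>0 E K M C D)"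

end

theory Submission
  imports Defs
begin

text \<open>
  The values of a contraction metric at the vertices solve the semidefinite problem, so the task is
  to find a continuously differentiable metric \<open>M\<close> on a neighbourhood of \<open>\<C>\<close>, periodic in time, for
  which \<open>M D\<^sub>xf + D\<^sub>xf\<^sup>T M\<close> plus the derivative of \<open>M\<close> along the flow is negative definite. It is
  sought in the form \<open>M(t, x) = c exp (\<lambda> V(t, x)) L(t)\<close> with a matrix \<open>L\<close> that depends on time
  only and a scalar function \<open>V\<close>. The derivative of the exponential contributes \<open>\<lambda> V' L\<close>, so two
  ingredients suffice (lemma \<open>contraction_metric\<close>): \<open>L\<close> has to contract near the orbit, and \<open>V\<close> must
  not increase along the flow anywhere and must decrease on the part of \<open>\<C>\<close> away from the orbit,
  where a large \<open>\<lambda>\<close> then outweighs every expansion.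

  The matrix \<open>L\<close> is a Lyapunov matrix of the linearization \<open>y' = A(t) y\<close> at the orbit. The classical
  choice is the integral of \<open>\<Phi>\<^sup>T \<Phi>\<close> with the fundamental matrix \<open>\<Phi>\<close>; here \<open>\<Phi>\<close> is replaced by products
  of Euler steps, which need no theory of linear differential equations. Exponential stability of
  the orbit forces long Euler products to contract, because the differences of nearby nonlinear
  solutions nearly satisfy the Euler recursion (lemma \<open>euler_product_contraction\<close>). The sums of
  \<open>\<Phi>\<^sup>T \<Phi>\<close> over the steps satisfy a discrete Lyapunov equation exactly, and an average over one step
  is continuously differentiable and satisfies the differential inequality (lemma
  \<open>periodic_lyapunov_matrix\<close>). The quadratic form of \<open>L\<close> in \<open>x - u(t)\<close> is a strict Lyapunov function
  \<open>W\<close> of the nonlinear system near the orbit (lemma \<open>orbit_lyapunov_function\<close>).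

  The function \<open>V\<close> is obtained without differentiating the flow. Around the solution that starts at
  a given point of \<open>\<C>\<close> there is a tube which widens so fast that no solution leaves it through its
  side; minus a bump function of the tube, switched on before the starting time and off once the
  solution is near the orbit, does not increase along the flow except where it is switched off
  (lemma \<open>tube_function\<close>). There \<open>W\<close> decreases strictly, and a multiple of \<open>W\<close>, cut off smoothly,
  compensates the increase (lemma \<open>periodic_decreasing_function\<close>). Finitely many such functions
  cover the compact set in question (lemma \<open>compact_lyapunov_function\<close>).

  On the triangulation, consecutive vertices of a simplex differ in one coordinate only. Hence the
  gradients \<open>w\<close> of the interpolated metric consist of difference quotients, which are values of
  partial derivatives of \<open>M\<close> inside the simplex (lemma \<open>w_vec_mean_value\<close>) and converge uniformly to
  those at the vertices. Bounds \<open>C\<close> and \<open>D\<close> for \<open>M\<close> and its gradient on a neighbourhood of \<open>\<C>\<close> serve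
  all simplices at once, and with \<open>C\<close> and \<open>D\<close> fixed the error terms vanish with the mesh size
  (lemma \<open>sdp_solution_fine_mesh\<close>).
\<close>


section \<open>Consequences of smoothness and periodicity\<close>

lemma coords_add: "coords (p + q) = coords p + coords q"
  by (simp add: coords_def vec_eq_iff split: option.split)

lemma coords_scaleR: "coords (c *\<^sub>R p) = c *\<^sub>R coords p"
  by (simp add: coords_def vec_eq_iff split: option.split)

lemma coords_diff: "coords (p - q) = coords p - coords q"
  by (simp add: coords_def vec_eq_iff split: option.split)

lemma coords_unit_vec: "coords (unit_vec k) = axis k 1"
  by (auto simp: coords_def unit_vec_def vec_eq_iff axis_def split: option.split)

lemma sum_option_UNIV: "(\<Sum>k\<in>UNIV. g k) = g None + (\<Sum>i\<in>UNIV. g (Some (i::'n::finite)))"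
proof -
  have "(\<Sum>k\<in>UNIV. g k) = (\<Sum>k\<in>insert None (range Some). g k)"
    by (simp add: UNIV_option_conv)
  also have "\<dots> = g None + (\<Sum>k\<in>range Some. g k)"
    by (subst sum.insert) auto
  also have "(\<Sum>k\<in>range Some. g k) = (\<Sum>i\<in>UNIV. g (Some i))"
    by (subst sum.reindex) auto
  finally show ?thesis .
qed

lemma coords_expansion: "p = (\<Sum>k\<in>UNIV. (coords p $ k) *\<^sub>R unit_vec k)"
  for p :: "'n::finite point"
proof (rule prod_eqI)
  show "fst p = fst (\<Sum>k\<in>UNIV. (coords p $ k) *\<^sub>R unit_vec k)"
    by (simp add: fst_sum sum_option_UNIV unit_vec_def coords_def)
  show "snd p = snd (\<Sum>k\<in>UNIV. (coords p $ k) *\<^sub>R unit_vec k)"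
    by (simp add: snd_sum sum_option_UNIV unit_vec_def coords_def vec_eq_iff axis_def
        if_distrib sum.delta cong: if_cong)
qed

lemma norm_unit_vec: "norm (unit_vec k) = 1"
  by (simp add: unit_vec_def norm_Pair split: option.split)

lemma abs_coords_le: "\<bar>coords p $ k\<bar> \<le> norm p"
proof (cases k)
  case None
  then show ?thesis using norm_fst_le[of "fst p" "snd p"] by (simp add: coords_def)
next
  case (Some i)
  have "\<bar>snd p $ i\<bar> \<le> norm (snd p)" by (rule component_le_norm_cart)
  also have "\<dots> \<le> norm p" by (metis norm_snd_le prod.collapse)
  finally show ?thesis using Some by (simp add: coords_def)
qed

lemma linear_eq_sum_coords:
  assumes "linear D"
  shows "D q = (\<Sum>k\<in>UNIV. (coords q $ k) *\<^sub>R D (unit_vec k))"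
proof -
  have "D q = D (\<Sum>k\<in>UNIV. (coords q $ k) *\<^sub>R unit_vec k)"
    using coords_expansion[of q] by simp
  also have "\<dots> = (\<Sum>k\<in>UNIV. (coords q $ k) *\<^sub>R D (unit_vec k))"
    by (simp add: linear_sum[OF assms] linear_scale[OF assms])
  finally show ?thesis .
qed

lemma periodic_of_int:
  assumes "\<And>t::real. g (t + T) = g t"
  shows "g (t + of_int m * T) = g t"
proof -
  have nat: "g (t + real k * T) = g t" for k :: nat and t
  proof (induction k)
    case (Suc k)
    have "g (t + real (Suc k) * T) = g ((t + real k * T) + T)" by (simp add: algebra_simps)
    then show ?case using assms[of "t + real k * T"] Suc by simp
  qed simp
  show ?thesis
  proof (cases "m \<ge> 0")
    case True
    then show ?thesis using nat[of t "nat m"] by simp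
  next
    case False
    then show ?thesis using nat[of "t + of_int m * T" "nat (- m)"] by simp
  qed
qed

lemma reduce_mod_period:
  fixes t T :: real
  assumes "T > 0"
  obtains m :: int where "t + of_int m * T \<in> {0..T}"
proof
  let ?k = "\<lfloor>t / T\<rfloor>"
  have "of_int ?k * T \<le> t" "t \<le> (of_int ?k + 1) * T"
    using floor_divide_lower[OF assms, of t] floor_divide_upper[OF assms, of t] by auto
  then show "t + of_int (- ?k) * T \<in> {0..T}" by (simp add: algebra_simps)
qed

lemma periodic_bounded:
  fixes g :: "real \<times> 'b::euclidean_space \<Rightarrow> 'c::real_normed_vector"
  assumes "T > 0" and per: "\<And>t x. g (t + T, x) = g (t, x)" and cont: "continuous_on UNIV g"
  obtains B where "B \<ge> 0" "\<And>t x. norm x \<le> R \<Longrightarrow> norm (g (t, x)) \<le> B"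
proof -
  have "compact ({0..T} \<times> (cball 0 R :: 'b set))"
    by (intro compact_Times compact_Icc compact_cball)
  then have "compact (g ` ({0..T} \<times> (cball 0 R :: 'b set)))"
    using cont by (meson compact_continuous_image continuous_on_subset subset_UNIV)
  then obtain B where B: "B > 0" "\<And>y. y \<in> g ` ({0..T} \<times> (cball 0 R :: 'b set)) \<Longrightarrow> norm y \<le> B"
    using compact_imp_bounded bounded_pos by metis
  have "norm (g (t, x)) \<le> B" if "norm x \<le> R" for t x
  proof -
    obtain m :: int where m: "t + of_int m * T \<in> {0..T}" by (rule reduce_mod_period[OF \<open>T > 0\<close>])
    have "g (t + of_int m * T, x) = g (t, x)"
      by (rule periodic_of_int[where g="\<lambda>t. g (t, x)"]) (rule per)
    moreover have "norm (g (t + of_int m * T, x)) \<le> B"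
      using m that by (intro B(2) imageI) auto
    ultimately show ?thesis by simp
  qed
  with B(1) show thesis using that[of B] by auto
qed

lemma has_frechet_derivative:
  assumes "g differentiable_on UNIV"
  shows "(g has_derivative frechet_derivative g (at p)) (at p)"
  using assms by (simp add: differentiable_on_def frechet_derivative_works[symmetric] del: split_paired_All)

lemma partial_deriv_periodic:
  assumes "\<And>t x. g (t + T, x) = g (t, x)" and diff: "g differentiable_on UNIV"
  shows "partial_deriv k g (t + T, x) = partial_deriv k g (t, x)"
proof -
  have d: "(g has_derivative frechet_derivative g (at (t + T, x))) (at ((t, x) + (T, 0)))"
    using has_frechet_derivative[OF diff, of "(t + T, x)"] by simp
  have "((\<lambda>q. g (q + (T, 0))) has_derivative (\<lambda>q. frechet_derivative g (at (t + T, x)) q)) (at (t, x))"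
    by (rule has_derivative_compose[where f="\<lambda>q. q + (T, 0)" and g=g, OF _ d])
      (auto intro!: derivative_eq_intros)
  moreover have "(\<lambda>q. g (q + (T, 0))) = g"
    using assms(1) by (auto simp: fun_eq_iff)
  ultimately have "frechet_derivative g (at (t + T, x)) = frechet_derivative g (at (t, x))"
    by (intro frechet_derivative_at) simp
  then show ?thesis by (simp add: partial_deriv_def)
qed

text \<open>By periodicity, bounds on the partial derivatives over one period hold for all times, so the
  Lipschitz constants are uniform in time.\<close>

lemma periodic_lipschitz:
  fixes g :: "'n::finite point \<Rightarrow> real ^ 'n"
  assumes T: "T > 0" and per: "\<And>t x. g (t + T, x) = g (t, x)" and diff: "g differentiable_on UNIV"
    and cont: "\<And>k. continuous_on UNIV (partial_deriv k g)"
  obtains L where "L > 0"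
    "\<And>t t' x y. norm x \<le> R \<Longrightarrow> norm y \<le> R \<Longrightarrow>
       norm (g (t, x) - g (t', y)) \<le> L * norm ((t, x) - (t', y))"
    "\<And>t x q. norm x \<le> R \<Longrightarrow> norm (frechet_derivative g (at (t, x)) q) \<le> L * norm q"
proof -
  have "\<exists>B. B \<ge> 0 \<and> (\<forall>t x. norm x \<le> R \<longrightarrow> norm (partial_deriv k g (t, x)) \<le> B)" for k
  proof -
    obtain B where "B \<ge> 0" "\<And>t x. norm x \<le> R \<Longrightarrow> norm (partial_deriv k g (t, x)) \<le> B"
      by (rule periodic_bounded[OF T _ cont[of k]]) (use partial_deriv_periodic[OF per diff] in auto)
    then show ?thesis by blast
  qed
  then obtain B where B: "\<And>k. B k \<ge> 0" 
    "\<And>k t x. norm x \<le> R \<Longrightarrow> norm (partial_deriv k g (t, x)) \<le> B k" by metis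
  define L where "L = (\<Sum>k\<in>UNIV. B k) + 1"
  have "L > 0" using B(1) sum_nonneg[of UNIV B] by (simp add: L_def)
  have der: "(g has_derivative frechet_derivative g (at p)) (at p)" for p
    by (rule has_frechet_derivative[OF diff])
  have bd: "norm (frechet_derivative g (at (t, x)) q) \<le> L * norm q" if "norm x \<le> R" for t x q
  proof -
    have "frechet_derivative g (at (t, x)) q = (\<Sum>k\<in>UNIV. (coords q $ k) *\<^sub>R partial_deriv k g (t, x))"
      unfolding partial_deriv_def
      by (rule linear_eq_sum_coords) (use der has_derivative_linear in blast)
    also have "norm \<dots> \<le> (\<Sum>k\<in>UNIV. norm q * B k)"
      by (intro order_trans[OF norm_sum] sum_mono)
        (auto intro!: mult_mono abs_coords_le B(2)[OF that])
    also have "\<dots> = norm q * (\<Sum>k\<in>UNIV. B k)" by (simp add: sum_distrib_left)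
    also have "\<dots> \<le> L * norm q" by (simp add: L_def algebra_simps)
    finally show ?thesis .
  qed
  have "norm (g (t, x) - g (t', y)) \<le> L * norm ((t, x) - (t', y))"
    if "norm x \<le> R" "norm y \<le> R" for t t' x y
  proof (rule differentiable_bound[where S="UNIV \<times> cball 0 R"
        and f'="\<lambda>p. frechet_derivative g (at p)"])
    show "convex (UNIV \<times> (cball 0 R :: (real ^ 'n) set))" by (intro convex_Times) auto
    show "onorm (frechet_derivative g (at p)) \<le> L" if "p \<in> UNIV \<times> cball 0 R" for p
      using bd that by (intro onorm_bound) (auto simp: \<open>L > 0\<close> less_imp_le)
  qed (use that der in \<open>auto intro: has_derivative_at_withinI\<close>)
  then show thesis using that[OF \<open>L > 0\<close>] bd by blast
qed

lemma Dx_eq_partial_deriv: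
  assumes "f differentiable_on UNIV"
  shows "Dx f p $ i $ j = partial_deriv (Some j) f p $ i"
proof -
  have "(f has_derivative frechet_derivative f (at p)) (at (fst p, snd p))"
    using has_frechet_derivative[OF assms, of p] by simp
  then have "((\<lambda>y. f (fst p, y)) has_derivative (\<lambda>y. frechet_derivative f (at p) (0, y))) (at (snd p))"
    by (rule has_derivative_compose[where f="\<lambda>y. (fst p, y)" and g=f, rotated])
      (auto intro!: derivative_eq_intros)
  then have "frechet_derivative (\<lambda>y. f (fst p, y)) (at (snd p)) = (\<lambda>y. frechet_derivative f (at p) (0, y))"
    by (rule frechet_derivative_at[symmetric])
  then show ?thesis
    by (simp add: Dx_def jacobian_def matrix_def partial_deriv_def unit_vec_def)
qed

lemma Dx_mult_eq_frechet_derivative: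
  assumes "f differentiable_on UNIV"
  shows "Dx f p *v v = frechet_derivative f (at p) (0, v)"
proof -
  have "linear (frechet_derivative f (at p))"
    using assms by (intro linear_frechet_derivative) (simp add: differentiable_on_def del: split_paired_All)
  then have "frechet_derivative f (at p) (0, v)
      = (\<Sum>k\<in>UNIV. (coords (0, v) $ k) *\<^sub>R partial_deriv k f p)"
    unfolding partial_deriv_def by (rule linear_eq_sum_coords)
  then show ?thesis
    by (simp add: vec_eq_iff matrix_vector_mult_def Dx_eq_partial_deriv[OF assms] sum_option_UNIV
        coords_def mult.commute)
qed

section \<open>Growth estimates and uniqueness of solutions\<close>

text \<open>Gronwall's estimate in the form used for uniqueness: \<open>exp (- 2 L t) \<parallel>z(t)\<parallel>\<^sup>2\<close> is decreasing, so no
  integral equation is needed.\<close>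

lemma norm_growth_bound:
  fixes z :: "real \<Rightarrow> 'a::real_inner"
  assumes "a \<le> b"
    and der: "\<And>t. a \<le> t \<Longrightarrow> t \<le> b \<Longrightarrow> (z has_vector_derivative z' t) (at t within {a..b})"
    and bd: "\<And>t. a \<le> t \<Longrightarrow> t \<le> b \<Longrightarrow> norm (z' t) \<le> L * norm (z t)"
  shows "norm (z b) \<le> exp (L * (b - a)) * norm (z a)"
proof (cases "a = b")
  case False
  with \<open>a \<le> b\<close> have "a < b" by simp
  define g where "g = (\<lambda>t. exp (- 2 * L * (t - a)) * (z t \<bullet> z t))"
  define g' where "g' = (\<lambda>t. exp (- 2 * L * (t - a)) * (2 * (z t \<bullet> z' t) - 2 * L * (z t \<bullet> z t)))"
  have "(g has_derivative (\<lambda>h. g' t * h)) (at t within {a..b})" if "a \<le> t" "t \<le> b" for t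
    unfolding g_def g'_def
    by (rule derivative_eq_intros der[OF that, unfolded has_vector_derivative_def] refl)+
      (auto simp: fun_eq_iff algebra_simps inner_commute)
  from mvt_simple[OF \<open>a < b\<close> this]
  obtain t where t: "t \<in> {a<..<b}" "g b - g a = g' t * (b - a)" by blast
  have "z t \<bullet> z' t \<le> norm (z t) * norm (z' t)" by (rule norm_cauchy_schwarz)
  also have "\<dots> \<le> norm (z t) * (L * norm (z t))"
    using bd[of t] t by (intro mult_left_mono) auto
  also have "\<dots> = L * (z t \<bullet> z t)" by (simp add: dot_square_norm power2_eq_square)
  finally have "g' t \<le> 0" unfolding g'_def by (intro mult_nonneg_nonpos) auto
  then have "g' t * (b - a) \<le> 0" using \<open>a < b\<close> by (intro mult_nonpos_nonneg) auto
  then have "g b \<le> g a" using t by linarith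
  then have "exp (- 2 * L * (b - a)) * (norm (z b))\<^sup>2 \<le> (norm (z a))\<^sup>2"
    by (simp add: g_def dot_square_norm)
  then have "exp (2 * L * (b - a)) * (exp (- 2 * L * (b - a)) * (norm (z b))\<^sup>2)
      \<le> exp (2 * L * (b - a)) * (norm (z a))\<^sup>2"
    by (intro mult_left_mono) auto
  then have "(norm (z b))\<^sup>2 \<le> exp (2 * L * (b - a)) * (norm (z a))\<^sup>2"
    by (simp add: mult.assoc[symmetric] exp_add[symmetric])
  also have "\<dots> = (exp (L * (b - a)) * norm (z a))\<^sup>2"
    by (simp add: power_mult_distrib exp_double[symmetric] mult.assoc)
  finally show ?thesis by (rule power2_le_imp_le) simp
qed simp

lemma solves_ivp_continuous:
  assumes "solves_ivp f p x"
  shows "continuous_on {fst p..} x"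
  using assms unfolding solves_ivp_def
  by (auto simp: continuous_on_eq_continuous_within intro: has_vector_derivative_continuous)

lemma continuous_bounded_on_Icc:
  fixes x :: "real \<Rightarrow> 'a::real_normed_vector"
  assumes "continuous_on {a..b} x"
  obtains R where "R > 0" "\<And>t. t \<in> {a..b} \<Longrightarrow> norm (x t) \<le> R"
proof -
  have "bounded (x ` {a..b})"
    using assms by (intro compact_imp_bounded compact_continuous_image) auto
  then show thesis using that by (auto simp: bounded_pos)
qed

locale periodic_C2_system =
  fixes T :: real and f :: "'n::finite point \<Rightarrow> real ^ 'n"
  assumes T_pos: "T > 0"
    and f_periodic: "f (t + T, x) = f (t, x)"
    and f_C2: "C_k 2 f"
begin

lemma f_differentiable: "f differentiable_on UNIV"
  using f_C2 by (simp add: numeral_2_eq_2)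

lemma f_has_derivative: "(f has_derivative frechet_derivative f (at p)) (at p)"
  by (rule has_frechet_derivative[OF f_differentiable])

lemma partial_differentiable: "partial_deriv k f differentiable_on UNIV"
  using f_C2 by (simp add: numeral_2_eq_2)

lemma partial_continuous: "continuous_on UNIV (partial_deriv k f)"
  by (rule differentiable_imp_continuous_on[OF partial_differentiable])

lemma second_partial_continuous: "continuous_on UNIV (partial_deriv i (partial_deriv k f))"
  using f_C2 by (simp add: numeral_2_eq_2)

lemma f_continuous: "continuous_on UNIV f"
  by (rule differentiable_imp_continuous_on[OF f_differentiable])

lemma f_periodic_int: "f (t + of_int m * T, x) = f (t, x)"
  by (rule periodic_of_int[where g="\<lambda>t. f (t, x)"]) (rule f_periodic)

lemma Dx_periodic: "Dx f (t + T, x) = Dx f (t, x)"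
  using partial_deriv_periodic[OF f_periodic f_differentiable]
  by (simp add: vec_eq_iff Dx_eq_partial_deriv[OF f_differentiable])

lemma Dx_continuous: "continuous_on UNIV (\<lambda>p. Dx f p $ i $ j)"
  unfolding Dx_eq_partial_deriv[OF f_differentiable]
  by (intro continuous_on_component partial_continuous)

lemma f_lipschitz:
  obtains L where "L > 0"
    "\<And>t t' x y. norm x \<le> R \<Longrightarrow> norm y \<le> R \<Longrightarrow>
       norm (f (t, x) - f (t', y)) \<le> L * norm ((t, x) - (t', y))"
    "\<And>t x v. norm x \<le> R \<Longrightarrow> norm (Dx f (t, x) *v v) \<le> L * norm v"
proof -
  obtain L where L: "L > 0"
    "\<And>t t' x y. norm x \<le> R \<Longrightarrow> norm y \<le> R \<Longrightarrow>
       norm (f (t, x) - f (t', y)) \<le> L * norm ((t, x) - (t', y))"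
    "\<And>t x q. norm x \<le> R \<Longrightarrow> norm (frechet_derivative f (at (t, x)) q) \<le> L * norm q"
    using periodic_lipschitz[OF T_pos f_periodic f_differentiable partial_continuous] by metis
  have bd: "norm (Dx f (t, x) *v v) \<le> L * norm v" if "norm x \<le> R" for t x v
    using L(3)[OF that, of t "(0, v)"]
    by (simp add: Dx_mult_eq_frechet_derivative[OF f_differentiable] norm_Pair)
  show thesis by (rule that[of L]) (assumption | rule L bd)+
qed

lemma Dx_lipschitz:
  obtains L where "L > 0"
    "\<And>t t' x y v. norm x \<le> R \<Longrightarrow> norm y \<le> R \<Longrightarrow>
       norm ((Dx f (t, x) - Dx f (t', y)) *v v) \<le> L * norm ((t, x) - (t', y)) * norm v"
proof -
  have "\<exists>L>0. \<forall>t t' x y. norm x \<le> R \<longrightarrow> norm y \<le> R \<longrightarrow>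
      norm (partial_deriv k f (t, x) - partial_deriv k f (t', y)) \<le> L * norm ((t, x) - (t', y))" for k
    using periodic_lipschitz[OF T_pos partial_deriv_periodic[OF f_periodic f_differentiable]
        partial_differentiable second_partial_continuous] by metis
  then obtain L where L: "\<And>k. L k > 0" "\<And>k t t' x y. norm x \<le> R \<Longrightarrow> norm y \<le> R \<Longrightarrow>
      norm (partial_deriv k f (t, x) - partial_deriv k f (t', y)) \<le> L k * norm ((t, x) - (t', y))"
    by metis
  have "norm ((Dx f (t, x) - Dx f (t', y)) *v v)
      \<le> (\<Sum>j\<in>UNIV. L (Some j)) * norm ((t, x) - (t', y)) * norm v"
    if "norm x \<le> R" "norm y \<le> R" for t t' x y v
  proof -
    have "(Dx f (t, x) - Dx f (t', y)) *v v
        = (\<Sum>j\<in>UNIV. (v $ j) *\<^sub>R (partial_deriv (Some j) f (t, x) - partial_deriv (Some j) f (t', y)))"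
      by (simp add: vec_eq_iff matrix_vector_mult_def Dx_eq_partial_deriv[OF f_differentiable]
          mult.commute)
    also have "norm \<dots> \<le> (\<Sum>j\<in>UNIV. norm v * (L (Some j) * norm ((t, x) - (t', y))))"
      by (intro order_trans[OF norm_sum] sum_mono)
        (auto intro!: mult_mono L(2)[OF that, simplified] component_le_norm_cart)
    also have "\<dots> = (\<Sum>j\<in>UNIV. L (Some j)) * norm ((t, x) - (t', y)) * norm v"
      by (simp add: sum_distrib_right sum_distrib_left algebra_simps)
    finally show ?thesis .
  qed
  moreover have "(\<Sum>j\<in>UNIV. L (Some (j::'n))) > 0"
    by (intro sum_pos) (auto simp: L)
  ultimately show thesis using that by blast
qed

text \<open>The mean value inequality for \<open>s \<mapsto> f (t, x + s z) - s D\<^sub>xf (t, x) z\<close>, whose derivative is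
  \<open>O(\<parallel>z\<parallel>\<^sup>2)\<close> because \<open>D\<^sub>xf\<close> is Lipschitz.\<close>

lemma linearization_error:
  obtains L where "L > 0"
    "\<And>t x z. norm x \<le> R \<Longrightarrow> norm (x + z) \<le> R \<Longrightarrow>
       norm (f (t, x + z) - f (t, x) - Dx f (t, x) *v z) \<le> L * (norm z)\<^sup>2"
proof -
  obtain L where L: "L > 0" "\<And>t t' x y v. norm x \<le> R \<Longrightarrow> norm y \<le> R \<Longrightarrow>
       norm ((Dx f (t, x) - Dx f (t', y)) *v v) \<le> L * norm ((t, x) - (t', y)) * norm v"
    using Dx_lipschitz by metis
  have "norm (f (t, x + z) - f (t, x) - Dx f (t, x) *v z) \<le> L * (norm z)\<^sup>2"
    if R: "norm x \<le> R" "norm (x + z) \<le> R" for t x z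
  proof -
    define g where "g = (\<lambda>s. f (t, x + s *\<^sub>R z) - s *\<^sub>R (Dx f (t, x) *v z))"
    have bd: "norm (x + s *\<^sub>R z) \<le> R" if "s \<in> {0..1}" for s
    proof -
      have "x + s *\<^sub>R z = (1 - s) *\<^sub>R x + s *\<^sub>R (x + z)" by (simp add: algebra_simps)
      also have "norm \<dots> \<le> (1 - s) * norm x + s * norm (x + z)"
        using that by (intro order_trans[OF norm_triangle_ineq]) auto
      also have "\<dots> \<le> R" using that R convex_bound_le[of "norm x" R "norm (x + z)" "1 - s" s] by auto
      finally show ?thesis .
    qed
    have "norm (g 1 - g 0) \<le> L * (norm z)\<^sup>2 * norm (1 - 0 :: real)"
    proof (rule differentiable_bound[where S="{0..1}"
          and f'="\<lambda>s h. h *\<^sub>R ((Dx f (t, x + s *\<^sub>R z) - Dx f (t, x)) *v z)"])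
      fix s :: real assume s: "s \<in> {0..1}"
      have "((\<lambda>s. f (t, x + s *\<^sub>R z)) has_derivative
          (\<lambda>h. frechet_derivative f (at (t, x + s *\<^sub>R z)) (0, h *\<^sub>R z))) (at s)"
        by (rule has_derivative_compose[where f="\<lambda>s. (t, x + s *\<^sub>R z)" and g=f, OF _ f_has_derivative])
          (auto intro!: derivative_eq_intros)
      then have "((\<lambda>s. f (t, x + s *\<^sub>R z)) has_derivative
          (\<lambda>h. h *\<^sub>R (Dx f (t, x + s *\<^sub>R z) *v z))) (at s)"
        by (simp add: Dx_mult_eq_frechet_derivative[OF f_differentiable, symmetric]
            scaleR_matrix_vector_assoc matrix_vector_mult_scaleR)
      then have "(g has_derivative
          (\<lambda>h. h *\<^sub>R (Dx f (t, x + s *\<^sub>R z) *v z) - h *\<^sub>R (Dx f (t, x) *v z))) (at s within {0..1})"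
        unfolding g_def
        by (rule has_derivative_at_withinI[OF has_derivative_diff[OF _
              has_derivative_scaleR_left[OF has_derivative_ident]]])
      then show "(g has_derivative (\<lambda>h. h *\<^sub>R ((Dx f (t, x + s *\<^sub>R z) - Dx f (t, x)) *v z)))
          (at s within {0..1})"
        by (simp add: matrix_vector_mult_diff_rdistrib scaleR_right_diff_distrib)
      have "norm ((Dx f (t, x + s *\<^sub>R z) - Dx f (t, x)) *v z)
          \<le> L * norm ((t, x + s *\<^sub>R z) - (t, x)) * norm z"
        by (rule L(2)[OF bd[OF s] R(1)])
      also have "\<dots> = L * (s * norm z) * norm z" using s by (simp add: norm_Pair)
      also have "\<dots> \<le> L * (1 * norm z) * norm z"
        using s L(1) by (intro mult_right_mono mult_left_mono) auto
      finally have w: "norm ((Dx f (t, x + s *\<^sub>R z) - Dx f (t, x)) *v z) \<le> L * (1 * norm z) * norm z" .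
      have "norm (h *\<^sub>R ((Dx f (t, x + s *\<^sub>R z) - Dx f (t, x)) *v z)) \<le> L * (norm z)\<^sup>2 * norm h"
        for h :: real
      proof -
        have "norm h * norm ((Dx f (t, x + s *\<^sub>R z) - Dx f (t, x)) *v z) \<le> norm h * (L * (1 * norm z) * norm z)"
          by (rule mult_left_mono[OF w]) simp
        then show ?thesis by (simp add: power2_eq_square mult.assoc mult.commute mult.left_commute)
      qed
      then show "onorm (\<lambda>h. h *\<^sub>R ((Dx f (t, x + s *\<^sub>R z) - Dx f (t, x)) *v z)) \<le> L * (norm z)\<^sup>2"
        using L(1) by (intro onorm_bound) auto
    qed auto
    then show ?thesis by (simp add: g_def algebra_simps)
  qed
  with L(1) show thesis using that by blast
qed

lemma solution_unique:
  assumes x: "solves_ivp f p x" and y: "solves_ivp f p y" and t: "fst p \<le> t"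
  shows "x t = y t"
proof -
  have sub: "{fst p..t} \<subseteq> {fst p..}" by auto
  obtain R1 where R1: "R1 > 0" "\<And>s. s \<in> {fst p..t} \<Longrightarrow> norm (x s) \<le> R1"
    by (rule continuous_bounded_on_Icc[OF continuous_on_subset[OF solves_ivp_continuous[OF x] sub]])
      blast
  obtain R2 where R2: "R2 > 0" "\<And>s. s \<in> {fst p..t} \<Longrightarrow> norm (y s) \<le> R2"
    by (rule continuous_bounded_on_Icc[OF continuous_on_subset[OF solves_ivp_continuous[OF y] sub]])
      blast
  obtain L where L: "L > 0" "\<And>t t' x y. norm x \<le> max R1 R2 \<Longrightarrow> norm y \<le> max R1 R2 \<Longrightarrow>
       norm (f (t, x) - f (t', y)) \<le> L * norm ((t, x) - (t', y))"
    using f_lipschitz by metis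
  have "norm (x t - y t) \<le> exp (L * (t - fst p)) * norm (x (fst p) - y (fst p))"
  proof (rule norm_growth_bound[where z="\<lambda>s. x s - y s" and z'="\<lambda>s. f (s, x s) - f (s, y s)", OF t])
    fix s assume s: "fst p \<le> s" "s \<le> t"
    then show "((\<lambda>s. x s - y s) has_vector_derivative f (s, x s) - f (s, y s)) (at s within {fst p..t})"
      using x y unfolding solves_ivp_def
      by (intro has_vector_derivative_diff) (auto intro: has_vector_derivative_within_subset)
    show "norm (f (s, x s) - f (s, y s)) \<le> L * norm (x s - y s)"
      using L(2)[of "x s" "y s" s s] R1(2)[of s] R2(2)[of s] s by (simp add: norm_Pair)
  qed
  then show ?thesis using x y by (simp add: solves_ivp_def)
qed

lemma flow_eq:
  assumes "solves_ivp f p x" "\<theta> \<ge> 0"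
  shows "flow f \<theta> p = (fst p + \<theta>, x (fst p + \<theta>))"
proof -
  have "(THE y. \<exists>x. solves_ivp f p x \<and> y = x (fst p + \<theta>)) = x (fst p + \<theta>)"
    using assms by (intro the_equality) (auto intro!: solution_unique[of p])
  then show ?thesis by (simp add: flow_def)
qed

lemma solves_ivp_shift:
  assumes "solves_ivp f (t0 + of_int m * T, x0) y"
  shows "solves_ivp f (t0, x0) (\<lambda>t. y (t + of_int m * T))"
  unfolding solves_ivp_def
proof (intro conjI allI impI)
  show "y (fst (t0, x0) + of_int m * T) = snd (t0, x0)"
    using assms by (simp add: solves_ivp_def)
  fix t assume t: "t \<ge> fst (t0, x0)"
  have "(y has_vector_derivative f (t + of_int m * T, y (t + of_int m * T)))
      (at (t + of_int m * T) within {t0 + of_int m * T..})"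
    using assms t by (simp add: solves_ivp_def)
  moreover have "{t0 + of_int m * T..} = (\<lambda>t. t + of_int m * T) ` {t0..}"
    by (auto intro!: image_eqI[of _ _ "_ - of_int m * T"])
  ultimately have "(y has_vector_derivative f (t, y (t + of_int m * T)))
      (at (t + of_int m * T) within (\<lambda>t. t + of_int m * T) ` {t0..})"
    by (simp add: f_periodic_int)
  moreover have "((\<lambda>t. t + of_int m * T) has_vector_derivative 1) (at t within {t0..})"
    by (auto intro!: derivative_eq_intros)
  ultimately show "((\<lambda>t. y (t + of_int m * T)) has_vector_derivative f (t, y (t + of_int m * T)))
      (at t within {fst (t0, x0)..})"
    using vector_diff_chain_within[of "\<lambda>t. t + of_int m * T" 1 t "{t0..}" y] by (simp add: o_def)
qed

end

section \<open>Distances on the cylinder\<close>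

lemma abs_sin_lower_bound:
  assumes "\<bar>y\<bar> \<le> pi / 2"
  shows "\<bar>y\<bar> / 3 \<le> \<bar>sin y\<bar>"
proof -
  have "\<bar>sin y - (\<Sum>m<3. sin_coeff m * y ^ m)\<bar> \<le> inverse (fact 3) * \<bar>y\<bar> ^ 3"
    by (rule Maclaurin_sin_bound)
  moreover have "(\<Sum>m<3. sin_coeff m * y ^ m) = y"
    by (simp add: sin_coeff_def numeral_3_eq_3)
  ultimately have 1: "\<bar>sin y - y\<bar> \<le> \<bar>y\<bar> ^ 3 / 6" by (simp add: fact_numeral)
  have "\<bar>y\<bar> < 2" using assms pi_half_less_two by linarith
  then have "\<bar>y\<bar> ^ 2 \<le> 2 ^ 2" by (intro power_mono) auto
  then have "\<bar>y\<bar> * \<bar>y\<bar> ^ 2 \<le> \<bar>y\<bar> * 4" by (intro mult_left_mono) auto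
  then have "\<bar>y\<bar> ^ 3 \<le> 4 * \<bar>y\<bar>" by (simp add: power3_eq_cube power2_eq_square)
  with 1 show ?thesis by linarith
qed

lemma norm_cis_diff: "norm (cis a - cis b) = 2 * \<bar>sin ((a - b) / 2)\<bar>"
proof -
  have "(norm (cis a - cis b))\<^sup>2 = (cos a - cos b)\<^sup>2 + (sin a - sin b)\<^sup>2"
    by (simp add: cmod_power2)
  also have "\<dots> = 2 - 2 * cos (a - b)"
    using sin_cos_squared_add[of a] sin_cos_squared_add[of b]
    by (simp add: cos_diff power2_eq_square algebra_simps)
  also have "cos (a - b) = 1 - 2 * (sin ((a - b) / 2))\<^sup>2"
    using cos_double_sin[of "(a - b) / 2"] by (simp only: mult_2 field_sum_of_halves)
  finally have "(norm (cis a - cis b))\<^sup>2 = (2 * \<bar>sin ((a - b) / 2)\<bar>)\<^sup>2"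
    by (simp add: power_mult_distrib)
  then show ?thesis by (rule power2_eq_imp_eq) auto
qed

text \<open>Points of the cylinder know their time only modulo \<open>T\<close>. The estimate selects the representative
  within half a period; there the sine in the length of the chord is bounded below by a multiple of
  its argument.\<close>

lemma circle_time_distance:
  fixes T :: real
  assumes T: "T > 0"
  obtains m :: int where "\<bar>t - (t' + of_int m * T)\<bar>
    \<le> 3 * norm (complex_of_real (T / (2 * pi)) * cis (2 * pi * t / T)
              - complex_of_real (T / (2 * pi)) * cis (2 * pi * t' / T))"
proof -
  obtain m :: int where m: "(t - t' + T / 2) + of_int m * T \<in> {0..T}"
    by (rule reduce_mod_period[OF T])
  define d where "d = t - (t' + of_int (- m) * T)"
  have d: "\<bar>d\<bar> \<le> T / 2" 
  proof -
    have "- (T / 2) \<le> d" "d \<le> T / 2" using m by (simp_all add: d_def)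
    then show ?thesis by linarith
  qed
  have "\<bar>pi * d / T\<bar> \<le> pi / 2" using d T by (simp add: abs_mult field_simps)
  then have "\<bar>pi * d / T\<bar> / 3 \<le> \<bar>sin (pi * d / T)\<bar>" by (rule abs_sin_lower_bound)
  then have 1: "\<bar>d\<bar> \<le> 3 * (T / (2 * pi) * (2 * \<bar>sin (pi * d / T)\<bar>))"
    using T by (simp add: abs_mult field_simps)
  have "cis (2 * pi * t' / T) = cis (2 * pi * (t' + of_int (- m) * T) / T)"
  proof -
    have "2 * pi * (t' + of_int (- m) * T) / T = 2 * pi * t' / T + 2 * pi * of_int (- m)"
      using T by (simp add: field_simps)
    moreover have "cis (2 * pi * of_int (- m)) = 1" by (rule cis_multiple_2pi) simp
    ultimately show ?thesis by (metis cis_mult mult.right_neutral)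
  qed
  moreover have "(2 * pi * t / T - 2 * pi * (t' + of_int (- m) * T) / T) / 2 = pi * d / T"
    using T by (simp add: d_def field_simps)
  ultimately have "norm (cis (2 * pi * t / T) - cis (2 * pi * t' / T)) = 2 * \<bar>sin (pi * d / T)\<bar>"
    using norm_cis_diff[of "2 * pi * t / T" "2 * pi * (t' + of_int (- m) * T) / T"] by simp
  then have "norm (complex_of_real (T / (2 * pi)) * cis (2 * pi * t / T)
              - complex_of_real (T / (2 * pi)) * cis (2 * pi * t' / T)) = T / (2 * pi) * (2 * \<bar>sin (pi * d / T)\<bar>)"
    using T by (simp add: right_diff_distrib[symmetric] norm_mult del: of_real_divide)
  with 1 show thesis by (intro that[of "- m"]) (simp add: d_def)
qed

lemma continuous_on_cyl: "continuous_on UNIV (cyl T)"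
  unfolding cyl_def cis_conv_exp divide_inverse by (intro continuous_intros)

lemma cyl_eqD:
  assumes "T > 0" "cyl T p = cyl T q"
  obtains m :: int where "q = (fst p + of_int m * T, snd p)"
proof -
  obtain m :: int where m: "\<bar>fst q - (fst p + of_int m * T)\<bar>
    \<le> 3 * norm (complex_of_real (T / (2 * pi)) * cis (2 * pi * fst q / T)
              - complex_of_real (T / (2 * pi)) * cis (2 * pi * fst p / T))"
    by (rule circle_time_distance[OF \<open>T > 0\<close>])
  have "fst q = fst p + of_int m * T" "snd p = snd q"
    using m assms(2) by (auto simp: cyl_def)
  then show thesis by (intro that[of m]) (simp add: prod_eq_iff)
qed

locale periodic_solution = periodic_C2_system T f
  for T :: real and f :: "'n::finite point \<Rightarrow> real ^ 'n" +
  fixes u :: "real \<Rightarrow> real ^ 'n"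
  assumes u_deriv: "(u has_vector_derivative f (t, u t)) (at t)"
    and u_periodic: "u (t + T) = u t"
begin

definition orbit :: "(complex \<times> (real ^ 'n)) set" where
  "orbit = range (\<lambda>t. cyl T (t, u t))"

lemma u_continuous: "continuous_on UNIV u"
  using u_deriv by (intro continuous_at_imp_continuous_on ballI has_vector_derivative_continuous)

lemma u_periodic_int: "u (t + of_int m * T) = u t"
  by (rule periodic_of_int) (rule u_periodic)

lemma u_bounded:
  obtains R where "R > 0" "\<And>t. norm (u t) \<le> R"
proof -
  obtain R where R: "R \<ge> 0" "\<And>t (x::real). norm x \<le> 0 \<Longrightarrow> norm (u (fst (t, x))) \<le> R"
    by (rule periodic_bounded[OF T_pos, where g="\<lambda>p. u (fst p)"])
      (auto simp: u_periodic intro!: continuous_on_compose2[OF u_continuous] continuous_intros)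
  show thesis
  proof (rule that[of "R + 1"])
    show "norm (u t) \<le> R + 1" for t using R(2)[of 0 t] by simp
  qed (use R(1) in simp)
qed

lemma u_lipschitz:
  obtains L where "L > 0" "\<And>t t'. norm (u t - u t') \<le> L * \<bar>t - t'\<bar>"
proof -
  obtain B where B: "B \<ge> 0" "\<And>t (x::real). norm x \<le> 0 \<Longrightarrow> norm (f (fst (t, x), u (fst (t, x)))) \<le> B"
    by (rule periodic_bounded[OF T_pos, where g="\<lambda>p. f (fst p, u (fst p))"])
      (auto simp: u_periodic f_periodic
        intro!: continuous_on_compose2[OF u_continuous] continuous_on_compose2[OF f_continuous] continuous_intros)
  have "norm (u t - u t') \<le> (B + 1) * norm (t - t')" for t t'
  proof (rule differentiable_bound[where S=UNIV and f'="\<lambda>t h. h *\<^sub>R f (t, u t)"])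
    show "(u has_derivative (\<lambda>h. h *\<^sub>R f (t, u t))) (at t within UNIV)" for t
      using u_deriv by (simp add: has_vector_derivative_def)
    show "onorm (\<lambda>h. h *\<^sub>R f (t, u t)) \<le> B + 1" for t
    proof (rule onorm_bound)
      show "norm (h *\<^sub>R f (t, u t)) \<le> (B + 1) * norm h" for h
        using mult_left_mono[of "norm (f (t, u t))" "B + 1" "\<bar>h\<bar>"] B(2)[of 0 t] by (simp add: mult.commute)
    qed (use B in simp)
  qed auto
  then show thesis using B(1) by (intro that[of "B + 1"]) auto
qed

lemma infdist_orbit_le: "infdist (cyl T (t, x)) orbit \<le> norm (x - u t)"
proof -
  have "infdist (cyl T (t, x)) orbit \<le> dist (cyl T (t, x)) (cyl T (t, u t))"
    by (rule infdist_le) (auto simp: orbit_def)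
  also have "\<dots> = norm (x - u t)" by (simp add: cyl_def dist_Pair_Pair dist_norm)
  finally show ?thesis .
qed

text \<open>Stability and attraction are formulated with the distance to the orbit as a set. It controls the
  deviation from the periodic solution at the same time, since moving along the orbit to the closest
  point costs no more than the Lipschitz constant of \<open>u\<close> times the difference in time.\<close>

lemma norm_diff_le_infdist_orbit:
  obtains c where "c > 0" "\<And>t x. norm (x - u t) \<le> c * infdist (cyl T (t, x)) orbit"
proof -
  obtain L where L: "L > 0" "\<And>t t'. norm (u t - u t') \<le> L * \<bar>t - t'\<bar>"
    using u_lipschitz by blast
  have *: "norm (x - u t) \<le> (1 + 3 * L) * dist (cyl T (t, x)) (cyl T (t', u t'))" for t x t'
  proof -
    let ?d = "dist (cyl T (t, x)) (cyl T (t', u t'))"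
    obtain m :: int where m: "\<bar>t - (t' + of_int m * T)\<bar>
      \<le> 3 * norm (complex_of_real (T / (2 * pi)) * cis (2 * pi * t / T)
              - complex_of_real (T / (2 * pi)) * cis (2 * pi * t' / T))"
      by (rule circle_time_distance[OF T_pos])
    have "norm (complex_of_real (T / (2 * pi)) * cis (2 * pi * t / T)
              - complex_of_real (T / (2 * pi)) * cis (2 * pi * t' / T)) \<le> ?d"
      using dist_fst_le[of "cyl T (t, x)" "cyl T (t', u t')"] by (simp add: cyl_def dist_norm)
    with m have 1: "\<bar>t - (t' + of_int m * T)\<bar> \<le> 3 * ?d" by linarith
    have 2: "norm (x - u t') \<le> ?d"
      using dist_snd_le[of "cyl T (t, x)" "cyl T (t', u t')"] by (simp add: cyl_def dist_norm)
    have "norm (u t' - u t) \<le> L * \<bar>t - (t' + of_int m * T)\<bar>"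
      using L(2)[of t "t' + of_int m * T"] by (simp add: u_periodic_int norm_minus_commute)
    also have "\<dots> \<le> L * (3 * ?d)" using 1 L(1) by (intro mult_left_mono) auto
    finally have "norm (u t' - u t) \<le> L * (3 * ?d)" .
    moreover have "norm (x - u t) \<le> norm (x - u t') + norm (u t' - u t)"
      using norm_triangle_ineq[of "x - u t'" "u t' - u t"] by simp
    ultimately show ?thesis using 2 by (simp add: algebra_simps)
  qed
  have "norm (x - u t) / (1 + 3 * L) \<le> infdist (cyl T (t, x)) orbit" for t x
  proof -
    have "norm (x - u t) / (1 + 3 * L) \<le> dist (cyl T (t, x)) a" if "a \<in> orbit" for a
    proof -
      obtain t' where "a = cyl T (t', u t')" using \<open>a \<in> orbit\<close> by (auto simp: orbit_def)
      then show ?thesis using *[of x t t'] L(1) by (simp add: field_simps)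
    qed
    then show ?thesis
      unfolding infdist_def by (auto simp: orbit_def intro!: cINF_greatest)
  qed
  then show thesis using L(1) by (intro that[of "1 + 3 * L"]) (auto simp: field_simps)
qed

end

section \<open>A Lyapunov matrix for a contracting periodic linear system\<close>

lemma matrix_entry_eq_inner: "X $ i $ j = axis i 1 \<bullet> (X *v axis j 1)"
  for X :: "real ^ 'n::finite ^ 'n"
  by (simp add: matrix_vector_mult_basis inner_axis' column_def)

lemma bounded_linear_quadratic_form: "bounded_linear (\<lambda>X. v \<bullet> (X *v w))"
  for v :: "real ^ 'n::finite"
  unfolding linear_conv_bounded_linear[symmetric]
  by (intro linearI)
    (auto simp: matrix_vector_mult_add_rdistrib inner_add_right scaleR_matrix_vector_assoc[symmetric])

lemma continuous_on_matrixI: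
  fixes P :: "'a::topological_space \<Rightarrow> real ^ 'n::finite ^ 'n"
  assumes "\<And>i j. continuous_on S (\<lambda>t. P t $ i $ j)"
  shows "continuous_on S P"
proof -
  have "continuous_on S (\<lambda>t. \<chi> i j. P t $ i $ j)"
    by (intro continuous_on_vec_lambda assms)
  then show ?thesis by simp
qed

lemma one_plus_power_le_exp:
  fixes x :: real
  assumes "0 \<le> x"
  shows "(1 + x) ^ N \<le> exp (real N * x)"
  using power_mono[OF exp_ge_add_one_self, of x N] assms by (simp add: exp_of_nat_mult)

text \<open>The propagator over \<open>j\<close> steps of the explicit Euler scheme of step size \<open>\<eta>\<close> for
  \<open>y' = A(t) y\<close>, started at time \<open>t\<close>.\<close>

primrec euler_product :: "(real \<Rightarrow> real ^ 'n::finite ^ 'n) \<Rightarrow> real \<Rightarrow> nat \<Rightarrow> real \<Rightarrow> real ^ 'n ^ 'n" where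
  "euler_product A \<eta> 0 t = mat 1"
| "euler_product A \<eta> (Suc j) t = euler_product A \<eta> j (t + \<eta>) ** (mat 1 + \<eta> *\<^sub>R A t)"

lemma euler_product_Suc_mult:
  "euler_product A \<eta> (Suc j) t *v v = euler_product A \<eta> j (t + \<eta>) *v (v + \<eta> *\<^sub>R (A t *v v))"
  by (simp add: matrix_vector_mul_assoc[symmetric] matrix_vector_mult_add_rdistrib
      scaleR_matrix_vector_assoc)

lemma euler_product_periodic:
  assumes "\<And>t. A (t + T) = A t"
  shows "euler_product A \<eta> j (t + T) = euler_product A \<eta> j t"
proof (induction j arbitrary: t)
  case (Suc j)
  have "euler_product A \<eta> j (t + T + \<eta>) = euler_product A \<eta> j (t + \<eta>)"
    using Suc[of "t + \<eta>"] by (simp add: algebra_simps)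
  then show ?case by (simp add: assms)
qed simp

locale bounded_linear_system =
  fixes A :: "real \<Rightarrow> real ^ 'n::finite ^ 'n" and L :: real
  assumes L_nonneg: "L \<ge> 0"
    and A_bound: "norm (A t *v v) \<le> L * norm v"
begin

lemma norm_euler_step:
  assumes "\<eta> \<ge> 0"
  shows "norm (v + \<eta> *\<^sub>R (A t *v v)) \<le> (1 + \<eta> * L) * norm v"
proof -
  have "norm (v + \<eta> *\<^sub>R (A t *v v)) \<le> norm v + \<eta> * norm (A t *v v)"
    using norm_triangle_ineq[of v "\<eta> *\<^sub>R (A t *v v)"] assms by simp
  also have "\<dots> \<le> norm v + \<eta> * (L * norm v)"
    using assms A_bound by (intro add_left_mono mult_left_mono) auto
  finally show ?thesis by (simp add: algebra_simps)
qed

lemma norm_euler_product: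
  assumes "\<eta> \<ge> 0"
  shows "norm (euler_product A \<eta> j t *v v) \<le> (1 + \<eta> * L) ^ j * norm v"
proof (induction j arbitrary: t v)
  case (Suc j)
  have "norm (euler_product A \<eta> (Suc j) t *v v) \<le> (1 + \<eta> * L) ^ j * norm (v + \<eta> *\<^sub>R (A t *v v))"
    unfolding euler_product_Suc_mult by (rule Suc)
  also have "\<dots> \<le> (1 + \<eta> * L) ^ j * ((1 + \<eta> * L) * norm v)"
    using assms L_nonneg by (intro mult_left_mono norm_euler_step) auto
  finally show ?case by (simp add: mult.assoc mult.left_commute)
qed simp

lemma euler_product_lipschitz:
  assumes \<eta>: "\<eta> \<ge> 0" and LA: "LA \<ge> 0"
    and lip: "\<And>t t' v. norm ((A t - A t') *v v) \<le> LA * \<bar>t - t'\<bar> * norm v"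
  shows "norm ((euler_product A \<eta> j t - euler_product A \<eta> j t') *v v)
    \<le> real j * \<eta> * LA * (1 + \<eta> * L) ^ j * \<bar>t - t'\<bar> * norm v"
proof (induction j arbitrary: t t' v)
  case (Suc j)
  let ?P = "euler_product A \<eta> j" and ?c = "1 + \<eta> * L"
  define w where "w = v + \<eta> *\<^sub>R (A t *v v)"
  define w' where "w' = v + \<eta> *\<^sub>R (A t' *v v)"
  have c: "?c \<ge> 1" using \<eta> L_nonneg by simp
  have "(euler_product A \<eta> (Suc j) t - euler_product A \<eta> (Suc j) t') *v v
      = ?P (t + \<eta>) *v w - ?P (t' + \<eta>) *v w'"
    by (simp only: matrix_vector_mult_diff_rdistrib euler_product_Suc_mult w_def w'_def)
  also have "\<dots> = (?P (t + \<eta>) - ?P (t' + \<eta>)) *v w + ?P (t' + \<eta>) *v (w - w')"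
    by (simp add: matrix_vector_mult_diff_rdistrib matrix_vector_mult_diff_distrib)
  also have "norm \<dots> \<le> norm ((?P (t + \<eta>) - ?P (t' + \<eta>)) *v w) + norm (?P (t' + \<eta>) *v (w - w'))"
    by (rule norm_triangle_ineq)
  also have "\<dots> \<le> real j * \<eta> * LA * ?c ^ j * \<bar>t - t'\<bar> * norm w + ?c ^ j * norm (w - w')"
    using Suc[of "t + \<eta>" "t' + \<eta>" w] norm_euler_product[OF \<eta>, of j "t' + \<eta>" "w - w'"] by simp
  also have "\<dots> \<le> real j * \<eta> * LA * ?c ^ j * \<bar>t - t'\<bar> * (?c * norm v) + ?c ^ j * (?c * (\<eta> * (LA * \<bar>t - t'\<bar> * norm v)))"
  proof (intro add_mono mult_left_mono)
    show "norm w \<le> ?c * norm v" unfolding w_def by (rule norm_euler_step[OF \<eta>])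
    have "norm (w - w') = \<eta> * norm ((A t - A t') *v v)"
      using \<eta> by (simp add: w_def w'_def matrix_vector_mult_diff_rdistrib scaleR_right_diff_distrib[symmetric])
    also have "\<dots> \<le> \<eta> * (LA * \<bar>t - t'\<bar> * norm v)" using \<eta> by (intro mult_left_mono lip)
    also have "\<dots> \<le> ?c * (\<eta> * (LA * \<bar>t - t'\<bar> * norm v))"
      using mult_right_mono[OF c, of "\<eta> * (LA * \<bar>t - t'\<bar> * norm v)"] \<eta> LA by simp
    finally show "norm (w - w') \<le> ?c * (\<eta> * (LA * \<bar>t - t'\<bar> * norm v))" .
  qed (use \<eta> LA c in \<open>auto intro!: mult_nonneg_nonneg\<close>)
  also have "\<dots> = real (Suc j) * \<eta> * LA * ?c ^ (Suc j) * \<bar>t - t'\<bar> * norm v"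
    by (simp add: algebra_simps)
  finally show ?case .
qed simp

text \<open>A discrete Gronwall estimate: the defect \<open>\<epsilon>\<close> of each step is propagated by the remaining
  product, whose norm is at most \<open>(1 + \<eta> L)\<^sup>N\<close>. The induction splits off the first step because that
  is how the product is built.\<close>

lemma euler_product_defect:
  assumes \<eta>: "\<eta> \<ge> 0" and "\<epsilon> \<ge> 0"
    and "\<And>i. i < N \<Longrightarrow> norm (y (Suc i) - (y i + \<eta> *\<^sub>R (A (t + real i * \<eta>) *v y i))) \<le> \<epsilon>"
  shows "norm (euler_product A \<eta> N t *v y 0 - y N) \<le> real N * \<epsilon> * (1 + \<eta> * L) ^ N"
  using assms(3)
proof (induction N arbitrary: t y)
  case (Suc N)
  let ?P = "euler_product A \<eta> N (t + \<eta>)" and ?c = "1 + \<eta> * L"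
  have c: "?c \<ge> 1" using \<eta> L_nonneg by simp
  have IH: "norm (?P *v y (Suc 0) - y (Suc N)) \<le> real N * \<epsilon> * ?c ^ N"
  proof (rule Suc.IH)
    fix i assume "i < N"
    with Suc.prems[of "Suc i"]
    show "norm (y (Suc (Suc i)) - (y (Suc i) + \<eta> *\<^sub>R (A (t + \<eta> + real i * \<eta>) *v y (Suc i)))) \<le> \<epsilon>"
      by (simp add: algebra_simps)
  qed
  let ?e = "y 0 + \<eta> *\<^sub>R (A t *v y 0) - y (Suc 0)"
  have e: "norm ?e \<le> \<epsilon>" using Suc.prems[of 0] by (simp add: norm_minus_commute)
  have "euler_product A \<eta> (Suc N) t *v y 0 - y (Suc N) = ?P *v ?e + (?P *v y (Suc 0) - y (Suc N))"
    by (simp only: euler_product_Suc_mult matrix_vector_mult_diff_distrib) simp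
  also have "norm \<dots> \<le> norm (?P *v ?e) + norm (?P *v y (Suc 0) - y (Suc N))"
    by (rule norm_triangle_ineq)
  also have "\<dots> \<le> ?c ^ N * \<epsilon> + real N * \<epsilon> * ?c ^ N"
    using c by (intro add_mono order_trans[OF norm_euler_product[OF \<eta>]] mult_left_mono e IH) simp
  also have "\<dots> = (real (Suc N) * \<epsilon>) * ?c ^ N" by (simp add: algebra_simps)
  also have "\<dots> \<le> (real (Suc N) * \<epsilon>) * ?c ^ Suc N"
    using c \<open>\<epsilon> \<ge> 0\<close> by (intro mult_left_mono power_increasing) auto
  finally show ?case .
qed simp

text \<open>Finite Gram sums \<open>\<eta> \<Sum>\<^sub>j \<Phi>\<^sub>j\<^sup>T \<Phi>\<^sub>j\<close> of the Euler products satisfy a discrete Lyapunov equation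
  exactly. Averaging over one step of length \<open>\<eta>\<close> turns the difference quotient in that equation into a derivative; the price is an error of size \<open>O(\<eta>)\<close>,
  because the Gram sums are Lipschitz in time uniformly in the step size.\<close>

lemma periodic_lyapunov_matrix:
  fixes LA \<Theta> T :: real
  assumes per: "\<And>t. A (t + T) = A t"
    and LA: "LA \<ge> 0" and lip: "\<And>t t' v. norm ((A t - A t') *v v) \<le> LA * \<bar>t - t'\<bar> * norm v"
    and \<Theta>: "\<Theta> > 0" and \<eta>0: "\<eta>0 > 0"
    and contr: "\<And>N \<eta> t v. 0 < \<eta> \<Longrightarrow> \<eta> < \<eta>0 \<Longrightarrow> real N * \<eta> = \<Theta> \<Longrightarrow>
      norm (euler_product A \<eta> N t *v v) \<le> norm v / 2"
  obtains M M' \<mu> where "\<mu> > 0" "\<And>t. (M has_vector_derivative M' t) (at t)" "continuous_on UNIV M'"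
    "\<And>t. M (t + T) = M t" "\<And>t. transpose (M t) = M t" "\<And>t v. \<mu> * (norm v)\<^sup>2 \<le> v \<bullet> (M t *v v)"
    "\<And>t v. v \<bullet> (M' t *v v) + 2 * (v \<bullet> (M t *v (A t *v v))) \<le> - (norm v)\<^sup>2 / 2"
proof -
  \<comment> \<open>\<open>E\<close> bounds all products up to time \<open>\<Theta>\<close>, and \<open>C\<close> is a Lipschitz constant in time of the Gram sums.
    Neither depends on the step size, which is chosen afterwards so that \<open>C L \<eta> \<le> 1 / 8\<close>.\<close>
  define E where "E = exp (\<Theta> * L)"
  have E: "E \<ge> 1" using \<Theta> L_nonneg by (simp add: E_def)
  define C where "C = 2 * \<Theta> * (E * (\<Theta> * LA * E))"
  have C: "C \<ge> 0" using \<Theta> E LA by (simp add: C_def)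
  obtain N :: nat where N: "real N > max (\<Theta> / \<eta>0) (8 * C * L * \<Theta>)" using reals_Archimedean2 by blast
  then have N0: "real N > 0" using \<Theta> \<eta>0 by (smt (verit) divide_pos_pos max.strict_boundedE)
  define \<eta> where "\<eta> = \<Theta> / real N"
  have \<eta>: "\<eta> > 0" "\<eta> < \<eta>0" "real N * \<eta> = \<Theta>" "8 * C * L * \<eta> \<le> 1"
    using N N0 \<Theta> \<eta>0 by (auto simp: \<eta>_def field_simps)
  note \<eta>0' = less_imp_le[OF \<eta>(1)]
  let ?Phi = "euler_product A \<eta>"
  have powE: "(1 + \<eta> * L) ^ j \<le> E" if "j \<le> N" for j
  proof -
    have "(1 + \<eta> * L) ^ j \<le> exp (real j * (\<eta> * L))"
      using \<eta> L_nonneg by (intro one_plus_power_le_exp) auto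
    also have "\<dots> \<le> exp (real N * (\<eta> * L))"
      using \<eta> L_nonneg that by (simp add: mult_right_mono)
    also have "\<dots> = E" using \<eta>(3) by (simp add: E_def mult.assoc[symmetric])
    finally show ?thesis .
  qed
  have nPhi: "norm (?Phi j t *v v) \<le> E * norm v" if "j \<le> N" for j t v
    using norm_euler_product[OF \<eta>0', of j t v] powE[OF that]
    by (meson mult_right_mono norm_ge_zero order_trans)
  have lPhi: "norm (?Phi j t *v v - ?Phi j t' *v v) \<le> \<Theta> * LA * E * \<bar>t - t'\<bar> * norm v" if "j \<le> N" for j t t' v
  proof -
    have "norm (?Phi j t *v v - ?Phi j t' *v v) \<le> real j * \<eta> * LA * (1 + \<eta> * L) ^ j * \<bar>t - t'\<bar> * norm v"
      using euler_product_lipschitz[OF \<eta>0' LA lip, of j t t' v] by (simp add: matrix_vector_mult_diff_rdistrib)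
    also have "\<dots> \<le> (real N * \<eta>) * LA * E * \<bar>t - t'\<bar> * norm v"
      using that \<eta> LA L_nonneg powE[OF that] by (intro mult_right_mono mult_mono) auto
    finally show ?thesis using \<eta>(3) by simp
  qed

  define P where "P t = \<eta> *\<^sub>R (\<Sum>j<N. transpose (?Phi j t) ** ?Phi j t)" for t
  have Pq: "v \<bullet> (P t *v w) = \<eta> * (\<Sum>j<N. (?Phi j t *v v) \<bullet> (?Phi j t *v w))" for t v w
  proof -
    interpret q: bounded_linear "\<lambda>X. v \<bullet> (X *v w)" by (rule bounded_linear_quadratic_form)
    have "v \<bullet> ((transpose (?Phi j t) ** ?Phi j t) *v w) = (?Phi j t *v v) \<bullet> (?Phi j t *v w)" for j
      by (simp add: matrix_vector_mul_assoc[symmetric] dot_lmul_matrix inner_commute[of v])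
         (simp add: inner_commute)
    then show ?thesis by (simp add: P_def q.scaleR q.sum)
  qed
  have Pper: "P (t + T) = P t" for t
    by (simp add: P_def euler_product_periodic[where A=A and T=T, OF per])
  have Psym: "v \<bullet> (P t *v w) = w \<bullet> (P t *v v)" for t v w
    by (simp add: Pq inner_commute)
  have Ppos: "\<eta> * (norm v)\<^sup>2 \<le> v \<bullet> (P t *v v)" for t v
  proof -
    have "(?Phi 0 t *v v) \<bullet> (?Phi 0 t *v v) \<le> (\<Sum>j<N. (?Phi j t *v v) \<bullet> (?Phi j t *v v))"
      using N0 by (intro member_le_sum) auto
    then show ?thesis using \<eta>(1) by (simp add: Pq power2_norm_eq_inner)
  qed
  have Plip: "\<bar>v \<bullet> (P t *v w) - v \<bullet> (P t' *v w)\<bar> \<le> C * \<bar>t - t'\<bar> * norm v * norm w" for t t' v w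
  proof -
    have summand: "\<bar>(?Phi j t *v v) \<bullet> (?Phi j t *v w) - (?Phi j t' *v v) \<bullet> (?Phi j t' *v w)\<bar>
        \<le> 2 * (E * (\<Theta> * LA * E)) * \<bar>t - t'\<bar> * norm v * norm w" if "j < N" for j
    proof -
      have eq: "(?Phi j t *v v) \<bullet> (?Phi j t *v w) - (?Phi j t' *v v) \<bullet> (?Phi j t' *v w)
          = (?Phi j t *v v - ?Phi j t' *v v) \<bullet> (?Phi j t *v w) + (?Phi j t' *v v) \<bullet> (?Phi j t *v w - ?Phi j t' *v w)"
        by (simp add: inner_diff_left inner_diff_right)
      have "\<bar>(?Phi j t *v v) \<bullet> (?Phi j t *v w) - (?Phi j t' *v v) \<bullet> (?Phi j t' *v w)\<bar>
          \<le> norm (?Phi j t *v v - ?Phi j t' *v v) * norm (?Phi j t *v w)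
          + norm (?Phi j t' *v v) * norm (?Phi j t *v w - ?Phi j t' *v w)"
        unfolding eq by (intro order_trans[OF abs_triangle_ineq] add_mono Cauchy_Schwarz_ineq2)
      also have "\<dots> \<le> (\<Theta> * LA * E * \<bar>t - t'\<bar> * norm v) * (E * norm w)
          + (E * norm v) * (\<Theta> * LA * E * \<bar>t - t'\<bar> * norm w)"
        using that E \<Theta> LA by (intro add_mono mult_mono lPhi nPhi) auto
      also have "\<dots> = 2 * (E * (\<Theta> * LA * E)) * \<bar>t - t'\<bar> * norm v * norm w" by (simp add: algebra_simps)
      finally show ?thesis .
    qed
    have eq: "v \<bullet> (P t *v w) - v \<bullet> (P t' *v w)
        = \<eta> * (\<Sum>j<N. (?Phi j t *v v) \<bullet> (?Phi j t *v w) - (?Phi j t' *v v) \<bullet> (?Phi j t' *v w))"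
      by (simp add: Pq sum_subtractf right_diff_distrib)
    have "\<bar>v \<bullet> (P t *v w) - v \<bullet> (P t' *v w)\<bar> = \<eta> * \<bar>\<Sum>j<N. (?Phi j t *v v) \<bullet> (?Phi j t *v w) - (?Phi j t' *v v) \<bullet> (?Phi j t' *v w)\<bar>"
      unfolding eq using \<eta>(1) by (simp add: abs_mult)
    also have "\<dots> \<le> \<eta> * (\<Sum>j<N. 2 * (E * (\<Theta> * LA * E)) * \<bar>t - t'\<bar> * norm v * norm w)"
      using \<eta>(1) by (intro mult_left_mono order_trans[OF sum_abs] sum_mono summand) auto
    also have "\<dots> = C * \<bar>t - t'\<bar> * norm v * norm w"
      unfolding C_def \<eta>(3)[symmetric] by (simp add: algebra_simps)
    finally show ?thesis .
  qed
  have Pcont: "continuous_on UNIV P"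
  proof (rule continuous_on_matrixI)
    fix i j
    have "C-lipschitz_on UNIV (\<lambda>t. P t $ i $ j)"
      using Plip[of "axis i 1" _ "axis j 1"] C
      by (intro lipschitz_onI) (auto simp: matrix_entry_eq_inner dist_real_def)
    then show "continuous_on UNIV (\<lambda>t. P t $ i $ j)" by (rule lipschitz_on_continuous_on)
  qed
  \<comment> \<open>The discrete Lyapunov equation: the sum telescopes, and the contraction after \<open>N\<close> steps leaves at
    least three quarters of the first term.\<close>
  have Pstep: "(v + \<eta> *\<^sub>R (A t *v v)) \<bullet> (P (t + \<eta>) *v (v + \<eta> *\<^sub>R (A t *v v)))
      \<le> v \<bullet> (P t *v v) - \<eta> * (3 / 4 * (norm v)\<^sup>2)" for t v
  proof -
    let ?a = "\<lambda>j. (?Phi j t *v v) \<bullet> (?Phi j t *v v)"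
    have "(v + \<eta> *\<^sub>R (A t *v v)) \<bullet> (P (t + \<eta>) *v (v + \<eta> *\<^sub>R (A t *v v))) = \<eta> * (\<Sum>j<N. ?a (Suc j))"
      by (simp only: Pq euler_product_Suc_mult)
    moreover have "(\<Sum>j<N. ?a (Suc j)) = (\<Sum>j<N. ?a j) + ?a N - ?a 0"
      using sum.lessThan_Suc_shift[of ?a N] by (simp del: euler_product.simps)
    moreover have "?a 0 = (norm v)\<^sup>2" by (simp add: power2_norm_eq_inner)
    moreover have "?a N \<le> (norm v)\<^sup>2 / 4"
      using power_mono[OF contr[OF \<eta>(1-3), of t v], of 2]
      by (simp add: power2_norm_eq_inner[symmetric] power_divide)
    ultimately have "(v + \<eta> *\<^sub>R (A t *v v)) \<bullet> (P (t + \<eta>) *v (v + \<eta> *\<^sub>R (A t *v v)))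
        \<le> \<eta> * ((\<Sum>j<N. ?a j) - 3 / 4 * (norm v)\<^sup>2)"
      using \<eta>(1) by (simp del: euler_product.simps)
    then show ?thesis by (simp add: Pq right_diff_distrib)
  qed

  define M where "M t = (1 / \<eta>) *\<^sub>R integral {t..t + \<eta>} P" for t
  define M' where "M' t = (1 / \<eta>) *\<^sub>R (P (t + \<eta>) - P t)" for t
  have Pint: "P integrable_on {a..b}" for a b
    using Pcont by (intro integrable_continuous_real) (auto intro: continuous_on_subset)
  have Mq: "v \<bullet> (M t *v w) = (1 / \<eta>) * integral {t..t + \<eta>} (\<lambda>s. v \<bullet> (P s *v w))" for t v w
  proof -
    interpret q: bounded_linear "\<lambda>X. v \<bullet> (X *v w)" by (rule bounded_linear_quadratic_form)
    show ?thesis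
      using integral_linear[OF Pint q.bounded_linear_axioms, of t "t + \<eta>"]
      by (simp add: M_def q.scaleR o_def)
  qed
  have qcont: "continuous_on S (\<lambda>s. v \<bullet> (P s *v w))" for S v w
    using bounded_linear.continuous_on[OF bounded_linear_quadratic_form continuous_on_subset[OF Pcont]] by simp
  have Mder: "(M has_vector_derivative M' t) (at t)" for t
  proof -
    define a where "a = t - 1"
    define b where "b = t + \<eta> + 2"
    define G where "G s = integral {a..s} P" for s
    have Gder: "(G has_vector_derivative P s) (at s)" if "a < s" "s < b" for s
      using integral_has_vector_derivative[of a b P s] that continuous_on_subset[OF Pcont, of "{a..b}"]
      by (simp add: G_def[abs_def] at_within_Icc_at)
    have "((\<lambda>s. G (s + \<eta>)) has_vector_derivative P (t + \<eta>)) (at t)"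
      using vector_diff_chain_at[of "\<lambda>s. s + \<eta>" 1 t G "P (t + \<eta>)"] Gder[of "t + \<eta>"] \<eta>(1)
      by (simp add: o_def a_def b_def has_vector_derivative_def has_derivative_add_const has_derivative_ident)
    then have "((\<lambda>s. (1 / \<eta>) *\<^sub>R (G (s + \<eta>) - G s)) has_vector_derivative M' t) (at t)"
      unfolding M'_def using \<eta>(1) Gder[of t]
      by (intro bounded_linear.has_vector_derivative[OF bounded_linear_scaleR_right] has_vector_derivative_diff) (auto simp: a_def b_def)
    then show ?thesis
    proof (rule has_vector_derivative_transform_within_open[where S="{a<..<t + 1}"])
      fix s assume "s \<in> {a<..<t + 1}"
      then have "integral {a..s} P + integral {s..s + \<eta>} P = integral {a..s + \<eta>} P"
        using \<eta>(1) Pint by (intro Henstock_Kurzweil_Integration.integral_combine) auto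
      then have "G (s + \<eta>) - G s = integral {s..s + \<eta>} P"
        unfolding G_def by (metis add_diff_cancel_left')
      then show "(1 / \<eta>) *\<^sub>R (G (s + \<eta>) - G s) = M s" by (simp add: M_def)
    qed (auto simp: a_def)
  qed
  have M'cont: "continuous_on UNIV M'"
    unfolding M'_def by (intro continuous_intros continuous_on_compose2[OF Pcont]) auto
  have Mper: "M (t + T) = M t" for t
  proof -
    have "(P has_integral integral {t..t + \<eta>} P) {t..t + \<eta>}"
      using Pint by (simp add: integrable_integral)
    moreover have "P \<circ> ((+) T) = P" using Pper by (auto simp: o_def add.commute)
    ultimately have "(P has_integral integral {t..t + \<eta>} P) {t + T..t + \<eta> + T}"
      using has_integral_shift_Icc_real[of P T "integral {t..t + \<eta>} P" t "t + \<eta>"] by simp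
    then have "integral {t + T..t + T + \<eta>} P = integral {t..t + \<eta>} P"
      by (intro integral_unique) (simp add: algebra_simps)
    then show ?thesis by (simp add: M_def)
  qed
  have Msym: "transpose (M t) = M t" for t
    unfolding vec_eq_iff transpose_def
    by (simp add: matrix_entry_eq_inner Mq Psym[of "axis _ 1" _ "axis _ 1"])
  have Mpos: "\<eta> * (norm v)\<^sup>2 \<le> v \<bullet> (M t *v v)" for t v
  proof -
    have "integral {t..t + \<eta>} (\<lambda>s. \<eta> * (norm v)\<^sup>2) \<le> integral {t..t + \<eta>} (\<lambda>s. v \<bullet> (P s *v v))"
      by (intro integral_le integrable_continuous_real qcont Ppos continuous_intros)
    then show ?thesis using \<eta>(1) by (simp add: Mq field_simps)
  qed
  \<comment> \<open>The average over \<open>[t, t + \<eta>]\<close> is compared with its right end point, since that is the matrix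
    in the discrete Lyapunov equation.\<close>
  have Mdiff: "\<bar>v \<bullet> (M t *v w) - v \<bullet> (P (t + \<eta>) *v w)\<bar> \<le> C * \<eta> * norm v * norm w" for t v w
  proof -
    let ?g = "\<lambda>s. v \<bullet> (P s *v w)"
    have "norm (integral {t..t + \<eta>} (\<lambda>s. ?g s - ?g (t + \<eta>))) \<le> (C * \<eta> * norm v * norm w) * (t + \<eta> - t)"
    proof (rule integral_bound)
      fix s assume "s \<in> {t..t + \<eta>}"
      then have "C * \<bar>s - (t + \<eta>)\<bar> * norm v * norm w \<le> C * \<eta> * norm v * norm w"
        using C by (intro mult_right_mono mult_left_mono) auto
      then show "norm (?g s - ?g (t + \<eta>)) \<le> C * \<eta> * norm v * norm w"
        using Plip[of v s w "t + \<eta>"] by simp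
    qed (use \<eta>(1) in \<open>auto intro!: continuous_intros qcont\<close>)
    moreover have "integral {t..t + \<eta>} (\<lambda>s. ?g s - ?g (t + \<eta>)) = integral {t..t + \<eta>} ?g - \<eta> * ?g (t + \<eta>)"
      using \<eta>(1) by (subst Henstock_Kurzweil_Integration.integral_diff)
        (auto intro!: integrable_continuous_real qcont)
    ultimately have "\<bar>integral {t..t + \<eta>} ?g - \<eta> * ?g (t + \<eta>)\<bar> / \<eta> \<le> C * \<eta> * norm v * norm w"
      using \<eta>(1) by (simp add: field_simps)
    moreover have "v \<bullet> (M t *v w) - ?g (t + \<eta>) = (integral {t..t + \<eta>} ?g - \<eta> * ?g (t + \<eta>)) / \<eta>"
      using \<eta>(1) by (simp add: Mq diff_divide_distrib)
    ultimately show ?thesis using \<eta>(1) by simp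
  qed
  have Mlyap: "v \<bullet> (M' t *v v) + 2 * (v \<bullet> (M t *v (A t *v v))) \<le> - (norm v)\<^sup>2 / 2" for t v
  proof -
    let ?w = "A t *v v" and ?P = "P (t + \<eta>)"
    interpret q: bounded_linear "\<lambda>X. v \<bullet> (X *v v)" by (rule bounded_linear_quadratic_form)
    have e: "(v + \<eta> *\<^sub>R ?w) \<bullet> (?P *v (v + \<eta> *\<^sub>R ?w))
        = v \<bullet> (?P *v v) + \<eta> * (2 * (v \<bullet> (?P *v ?w))) + \<eta> * (\<eta> * (?w \<bullet> (?P *v ?w)))"
      using Psym[of ?w "t + \<eta>" v]
      by (simp add: matrix_vector_right_distrib matrix_vector_mult_scaleR inner_add_left inner_add_right algebra_simps)
    have "0 \<le> \<eta> * (\<eta> * (?w \<bullet> (?P *v ?w)))"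
      using Ppos[of ?w "t + \<eta>"] \<eta>(1) by (intro mult_nonneg_nonneg) (auto intro: order_trans[rotated])
    then have "v \<bullet> (?P *v v) - v \<bullet> (P t *v v) \<le> \<eta> * (- 2 * (v \<bullet> (?P *v ?w)) - 3 / 4 * (norm v)\<^sup>2)"
      using Pstep[of v t, unfolded e] by (simp add: algebra_simps)
    then have "v \<bullet> (M' t *v v) \<le> - 2 * (v \<bullet> (?P *v ?w)) - 3 / 4 * (norm v)\<^sup>2"
      using \<eta>(1) by (simp add: M'_def q.scaleR q.diff field_simps)
    moreover have "v \<bullet> (M t *v ?w) - v \<bullet> (?P *v ?w) \<le> (norm v)\<^sup>2 / 8"
    proof -
      have "v \<bullet> (M t *v ?w) - v \<bullet> (?P *v ?w) \<le> C * \<eta> * norm v * norm ?w"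
        using Mdiff[of v t ?w] by linarith
      also have "\<dots> \<le> C * \<eta> * norm v * (L * norm v)"
        using C \<eta>(1) by (intro mult_left_mono A_bound) auto
      also have "\<dots> = (8 * C * L * \<eta>) * ((norm v)\<^sup>2 / 8)" by (simp add: power2_eq_square)
      also have "\<dots> \<le> 1 * ((norm v)\<^sup>2 / 8)" by (rule mult_right_mono[OF \<eta>(4)]) simp
      finally show ?thesis by simp
    qed
    ultimately show ?thesis by simp
  qed
  show thesis
    by (rule that[OF \<eta>(1) Mder M'cont Mper Msym Mpos Mlyap])
qed

end

section \<open>Contraction of the linearized flow along the orbit\<close>

lemma norm_increment_le:
  fixes g :: "real \<Rightarrow> 'a::real_normed_vector"
  assumes "a \<le> b"
    and der: "\<And>s. a \<le> s \<Longrightarrow> s \<le> b \<Longrightarrow> (g has_vector_derivative g' s) (at s within {a..b})"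
    and bd: "\<And>s. a \<le> s \<Longrightarrow> s \<le> b \<Longrightarrow> norm (g' s) \<le> B"
  shows "norm (g b - g a) \<le> B * (b - a)"
proof -
  have "norm (g b - g a) \<le> B * norm (b - a)"
  proof (rule differentiable_bound[where S="{a..b}" and f'="\<lambda>s h. h *\<^sub>R g' s"])
    fix s assume s: "s \<in> {a..b}"
    then show "(g has_derivative (\<lambda>h. h *\<^sub>R g' s)) (at s within {a..b})"
      using der by (simp add: has_vector_derivative_def)
    show "onorm (\<lambda>h. h *\<^sub>R g' s) \<le> B"
    proof (rule onorm_bound)
      show "norm (h *\<^sub>R g' s) \<le> B * norm h" for h
        using mult_left_mono[OF bd, of s "\<bar>h\<bar>"] s by (simp add: mult.commute)
      show "0 \<le> B" using s by (intro order_trans[OF norm_ge_zero bd[of s]]) auto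
    qed
  qed (use \<open>a \<le> b\<close> in auto)
  then show ?thesis using \<open>a \<le> b\<close> by simp
qed

locale stable_periodic_solution = periodic_solution T f u
  for T :: real and f :: "'n::finite point \<Rightarrow> real ^ 'n" and u +
  assumes solution_exists: "\<exists>x. solves_ivp f p x"
    and orbit_stable: "exponentially_stable T f orbit"
begin

lemma exponential_decay:
  obtains \<delta> c \<mu> where "\<delta> > 0" "c > 0" "\<mu> > 0"
    "\<And>t x0 x \<theta>. norm (x0 - u t) < \<delta> \<Longrightarrow> solves_ivp f (t, x0) x \<Longrightarrow> 0 \<le> \<theta> \<Longrightarrow>
       norm (x (t + \<theta>) - u (t + \<theta>)) \<le> c * exp (- \<mu> * \<theta>) * norm (x0 - u t)"
proof -
  obtain \<delta> \<mu> c where d: "\<delta> > 0" "\<mu> > 0" "c > 0"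
    and st: "\<And>p \<theta>. infdist (cyl T p) orbit < \<delta> \<Longrightarrow> 0 \<le> \<theta> \<Longrightarrow>
      infdist (cyl T (flow f \<theta> p)) orbit \<le> c * exp (- \<mu> * \<theta>) * infdist (cyl T p) orbit"
    using orbit_stable unfolding exponentially_stable_def by metis
  obtain b where b: "b > 0" "\<And>t x. norm (x - u t) \<le> b * infdist (cyl T (t, x)) orbit"
    using norm_diff_le_infdist_orbit by blast
  have "norm (x (t + \<theta>) - u (t + \<theta>)) \<le> (b * c) * exp (- \<mu> * \<theta>) * norm (x0 - u t)"
    if near: "norm (x0 - u t) < \<delta>" and x: "solves_ivp f (t, x0) x" and \<theta>: "0 \<le> \<theta>" for t x0 x \<theta>
  proof -
    have "infdist (cyl T (flow f \<theta> (t, x0))) orbit \<le> c * exp (- \<mu> * \<theta>) * infdist (cyl T (t, x0)) orbit"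
      using st[OF le_less_trans[OF infdist_orbit_le near] \<theta>] .
    also have "\<dots> \<le> c * exp (- \<mu> * \<theta>) * norm (x0 - u t)"
      using d by (intro mult_left_mono infdist_orbit_le) auto
    finally have "b * infdist (cyl T (t + \<theta>, x (t + \<theta>))) orbit \<le> b * (c * exp (- \<mu> * \<theta>) * norm (x0 - u t))"
      using b(1) flow_eq[OF x \<theta>] by simp
    then show ?thesis using b(2)[of "x (t + \<theta>)" "t + \<theta>"] by (simp add: mult.assoc)
  qed
  moreover have "b * c > 0" using b d by simp
  ultimately show thesis using that d by blast
qed

definition linearization :: "real \<Rightarrow> real ^ 'n ^ 'n" where
  "linearization t = Dx f (t, u t)"

lemma linearization_periodic: "linearization (t + T) = linearization t"
  by (simp add: linearization_def u_periodic Dx_periodic)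

lemma linearization_lipschitz:
  obtains L where "L > 0" "\<And>t t' v. norm ((linearization t - linearization t') *v v) \<le> L * \<bar>t - t'\<bar> * norm v"
proof -
  obtain R where R: "R > 0" "\<And>t. norm (u t) \<le> R" using u_bounded by blast
  obtain L1 where L1: "L1 > 0" "\<And>t t'. norm (u t - u t') \<le> L1 * \<bar>t - t'\<bar>" using u_lipschitz by blast
  obtain L2 where L2: "L2 > 0" "\<And>t t' x y v. norm x \<le> R \<Longrightarrow> norm y \<le> R \<Longrightarrow>
       norm ((Dx f (t, x) - Dx f (t', y)) *v v) \<le> L2 * norm ((t, x) - (t', y)) * norm v"
    using Dx_lipschitz by blast
  have "norm ((linearization t - linearization t') *v v) \<le> (L2 * (1 + L1)) * \<bar>t - t'\<bar> * norm v" for t t' v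
  proof -
    have "norm ((t, u t) - (t', u t')) \<le> \<bar>t - t'\<bar> + norm (u t - u t')"
      using norm_Pair_le[of "t - t'" "u t - u t'"] by simp
    also have "\<dots> \<le> (1 + L1) * \<bar>t - t'\<bar>" using L1(2)[of t t'] by (simp add: algebra_simps)
    finally have 1: "norm ((t, u t) - (t', u t')) \<le> (1 + L1) * \<bar>t - t'\<bar>" .
    have "norm ((linearization t - linearization t') *v v) \<le> L2 * norm ((t, u t) - (t', u t')) * norm v"
      unfolding linearization_def by (rule L2(2)[OF R(2) R(2)])
    also have "\<dots> \<le> L2 * ((1 + L1) * \<bar>t - t'\<bar>) * norm v"
      using 1 L2(1) by (intro mult_right_mono mult_left_mono) auto
    finally show ?thesis by (simp add: mult.assoc)
  qed
  moreover have "L2 * (1 + L1) > 0" using L1 L2 by simp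
  ultimately show thesis using that by blast
qed

text \<open>Differences between the periodic solution and a nearby solution decay by stability, and they
  satisfy the linearized equation up to quadratic errors; hence they almost satisfy the Euler
  recursion. By linearity, contraction of one small sphere gives contraction everywhere.\<close>

lemma euler_product_contraction:
  obtains \<Theta> \<eta>0 where "\<Theta> > 0" "\<eta>0 > 0"
    "\<And>N \<eta> t v. 0 < \<eta> \<Longrightarrow> \<eta> < \<eta>0 \<Longrightarrow> real N * \<eta> = \<Theta> \<Longrightarrow>
       norm (euler_product linearization \<eta> N t *v v) \<le> norm v / 2"
proof -
  obtain \<delta> c \<mu> where d: "\<delta> > 0" "c > 0" "\<mu> > 0"
    and decay: "\<And>t x0 x \<theta>. norm (x0 - u t) < \<delta> \<Longrightarrow> solves_ivp f (t, x0) x \<Longrightarrow> 0 \<le> \<theta> \<Longrightarrow>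
       norm (x (t + \<theta>) - u (t + \<theta>)) \<le> c * exp (- \<mu> * \<theta>) * norm (x0 - u t)"
    using exponential_decay by blast
  \<comment> \<open>Large enough for \<open>c exp (- \<mu> \<Theta>) \<le> 1 / 4\<close>, because \<open>4 c \<le> exp (4 c)\<close>.\<close>
  define \<Theta> where "\<Theta> = 4 * c / \<mu>"
  have \<Theta>: "\<Theta> > 0" using d by (simp add: \<Theta>_def)
  have quarter: "c * exp (- \<mu> * \<Theta>) \<le> 1 / 4"
  proof -
    have "4 * c \<le> exp (4 * c)" using exp_ge_add_one_self[of "4 * c"] by linarith
    then show ?thesis using d by (simp add: \<Theta>_def exp_minus field_simps)
  qed
  obtain R where R: "R > 0" "\<And>t. norm (u t) \<le> R" using u_bounded by blast
  obtain L where L: "L > 0"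
    "\<And>t t' x y. norm x \<le> R + 1 \<Longrightarrow> norm y \<le> R + 1 \<Longrightarrow>
       norm (f (t, x) - f (t', y)) \<le> L * norm ((t, x) - (t', y))"
    "\<And>t x v. norm x \<le> R + 1 \<Longrightarrow> norm (Dx f (t, x) *v v) \<le> L * norm v"
    using f_lipschitz[of "R + 1"] by blast
  obtain LA where LA: "LA > 0"
    "\<And>t t' v. norm ((linearization t - linearization t') *v v) \<le> LA * \<bar>t - t'\<bar> * norm v"
    using linearization_lipschitz by blast
  obtain L2 where L2: "L2 > 0"
    "\<And>t x z. norm x \<le> R + 1 \<Longrightarrow> norm (x + z) \<le> R + 1 \<Longrightarrow>
       norm (f (t, x + z) - f (t, x) - Dx f (t, x) *v z) \<le> L2 * (norm z)\<^sup>2"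
    using linearization_error[of "R + 1"] by blast
  interpret lin: bounded_linear_system linearization L
    using L(1) L(3)[OF order_trans[OF R(2)]] by unfold_locales (auto simp: linearization_def)
  define G where "G = \<Theta> * exp (\<Theta> * L)"
  have G: "G > 0" using \<Theta> by (simp add: G_def)
  \<comment> \<open>The radius of the sphere on which contraction is tested: in the range of the stability estimate,
    within the ball where \<open>f\<close> is controlled, and so small that the accumulated quadratic error is at
    most \<open>r / 8\<close>. The bound on the step size does the same for the discretization error.\<close>
  define r where "r = min (\<delta> / 2) (min (1 / c) (1 / (8 * G * L2 * c\<^sup>2)))"
  have r: "r > 0" "r < \<delta>" "c * r \<le> 1" "G * (L2 * c\<^sup>2 * r) \<le> 1 / 8"
  proof -
    show "r > 0" "r < \<delta>" using d G L2(1) by (auto simp: r_def min_less_iff_disj)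
    have "c * r \<le> c * (1 / c)" using d by (intro mult_left_mono) (auto simp: r_def)
    then show "c * r \<le> 1" using d by simp
    have "(G * L2 * c\<^sup>2) * r \<le> (G * L2 * c\<^sup>2) * (1 / (8 * G * L2 * c\<^sup>2))"
      using d G L2(1) by (intro mult_left_mono) (auto simp: r_def)
    then show "G * (L2 * c\<^sup>2 * r) \<le> 1 / 8" using d G L2(1) by (simp add: field_simps)
  qed
  define \<eta>0 where "\<eta>0 = 1 / (8 * G * ((LA + L\<^sup>2) * c))"
  have H: "(LA + L\<^sup>2) * c > 0" using LA(1) L(1) d by (simp add: add_pos_pos)
  have \<eta>0: "\<eta>0 > 0" using G H by (simp add: \<eta>0_def)
  have sphere: "norm (euler_product linearization \<eta> N t *v w) \<le> r / 2"
    if \<eta>: "0 < \<eta>" "\<eta> < \<eta>0" "real N * \<eta> = \<Theta>" and w: "norm w = r" for \<eta> N t w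
  proof -
    obtain x where x: "solves_ivp f (t, u t + w) x" using solution_exists by blast
    define z where "z s = x s - u s" for s
    have z_t: "z t = w" using x by (simp add: z_def solves_ivp_def)
    have z_exp: "norm (z (t + \<theta>)) \<le> c * exp (- \<mu> * \<theta>) * r" if "0 \<le> \<theta>" for \<theta>
      using decay[of "u t + w" t x \<theta>] x w r(2) that by (simp add: z_def)
    have z_bd: "norm (z s) \<le> c * r" if "t \<le> s" for s
    proof -
      have "norm (z s) \<le> c * exp (- \<mu> * (s - t)) * r" using z_exp[of "s - t"] that by simp
      also have "\<dots> \<le> c * 1 * r" using that d r(1) by (intro mult_right_mono mult_left_mono) auto
      finally show ?thesis by simp
    qed
    have x_bd: "norm (x s) \<le> R + 1" "norm (u s) \<le> R + 1" if "t \<le> s" for s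
      using norm_triangle_ineq[of "u s" "z s"] z_bd[OF that] r(3) R(2)[of s] by (auto simp: z_def)
    have z_der: "(z has_vector_derivative (f (s, x s) - f (s, u s))) (at s within {a..b})"
      if "t \<le> a" "a \<le> s" for s a b
      unfolding z_def using x that u_deriv unfolding solves_ivp_def
      by (intro has_vector_derivative_diff)
        (auto intro: has_vector_derivative_at_within has_vector_derivative_within_subset[where S="{t..}"])
    have z'_bd: "norm (f (s, x s) - f (s, u s)) \<le> L * (c * r)" if "t \<le> s" for s
    proof -
      have "norm (f (s, x s) - f (s, u s)) \<le> L * norm (z s)"
        using L(2)[OF x_bd[OF that], of s s] by (simp add: z_def norm_Pair)
      also have "\<dots> \<le> L * (c * r)" using z_bd[OF that] L(1) by (intro mult_left_mono) auto
      finally show ?thesis .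
    qed
    \<comment> \<open>Bound for the defect per unit time: variation of \<open>A\<close> and of \<open>z\<close> within a step, and the
      linearization error.\<close>
    define e where "e = \<eta> * ((LA + L\<^sup>2) * c * r) + L2 * (c * r)\<^sup>2"
    have e: "e \<ge> 0" using \<eta> H r(1) L2(1) by (simp add: e_def)
    have "norm (z (t + real (Suc i) * \<eta>) - (z (t + real i * \<eta>) + \<eta> *\<^sub>R (linearization (t + real i * \<eta>) *v z (t + real i * \<eta>)))) \<le> e * \<eta>" for i
    proof -
      define a where "a = t + real i * \<eta>"
      have a: "t \<le> a" using \<eta> by (simp add: a_def)
      define g where "g s = z s - (s - a) *\<^sub>R (linearization a *v z a)" for s
      have "norm (g (a + \<eta>) - g a) \<le> e * (a + \<eta> - a)"
      proof (rule norm_increment_le)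
        fix s assume s: "a \<le> s" "s \<le> a + \<eta>"
        show "(g has_vector_derivative (f (s, x s) - f (s, u s) - linearization a *v z a)) (at s within {a..a + \<eta>})"
          unfolding g_def
          by (intro has_vector_derivative_diff z_der a s(1))
            (auto intro!: derivative_eq_intros simp: has_vector_derivative_def)
        have "norm (z s - z a) \<le> L * (c * r) * (s - a)"
          by (rule norm_increment_le[OF s(1) z_der z'_bd]) (use a in auto)
        also have "\<dots> \<le> L * (c * r) * \<eta>" using s L(1) d r(1) by (intro mult_left_mono) auto
        finally have dz: "norm (z s - z a) \<le> L * (c * r) * \<eta>" .
        have "norm (linearization a *v (z s - z a)) \<le> L * (L * (c * r) * \<eta>)"
          by (rule order_trans[OF lin.A_bound mult_left_mono[OF dz]]) (use L(1) in simp)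
        moreover have "norm ((linearization s - linearization a) *v z s) \<le> LA * \<eta> * (c * r)"
        proof -
          have "norm ((linearization s - linearization a) *v z s) \<le> LA * \<bar>s - a\<bar> * norm (z s)" by (rule LA(2))
          also have "\<dots> \<le> LA * \<eta> * (c * r)"
            using s a z_bd[of s] LA(1) \<eta> by (intro mult_mono) auto
          finally show ?thesis .
        qed
        moreover have "norm (f (s, x s) - f (s, u s) - linearization s *v z s) \<le> L2 * (c * r)\<^sup>2"
        proof -
          have "norm (f (s, u s + z s) - f (s, u s) - Dx f (s, u s) *v z s) \<le> L2 * (norm (z s))\<^sup>2"
            using x_bd[of s] a s by (intro L2(2)) (auto simp: z_def)
          also have "\<dots> \<le> L2 * (c * r)\<^sup>2"
            using z_bd[of s] a s L2(1) by (intro mult_left_mono power_mono) auto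
          finally show ?thesis by (simp add: linearization_def z_def)
        qed
        moreover have "f (s, x s) - f (s, u s) - linearization a *v z a
          = (f (s, x s) - f (s, u s) - linearization s *v z s)
            + ((linearization s - linearization a) *v z s + linearization a *v (z s - z a))"
          by (simp add: matrix_vector_mult_diff_rdistrib matrix_vector_mult_diff_distrib)
        ultimately have "norm (f (s, x s) - f (s, u s) - linearization a *v z a)
            \<le> L2 * (c * r)\<^sup>2 + (LA * \<eta> * (c * r) + L * (L * (c * r) * \<eta>))"
          by (metis (no_types, lifting) add_mono norm_triangle_mono)
        then show "norm (f (s, x s) - f (s, u s) - linearization a *v z a) \<le> e"
          by (simp add: e_def power2_eq_square algebra_simps)
      qed (use \<eta> in simp)
      moreover have "a + \<eta> = t + real (Suc i) * \<eta>" by (simp add: a_def algebra_simps)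
      ultimately show ?thesis by (simp add: g_def a_def algebra_simps)
    qed
    from lin.euler_product_defect[where y="\<lambda>i. z (t + real i * \<eta>)" and \<epsilon>="e * \<eta>" and \<eta>=\<eta> and N=N and t=t, OF _ _ this]
    have "norm (euler_product linearization \<eta> N t *v w - z (t + \<Theta>)) \<le> real N * (e * \<eta>) * (1 + \<eta> * L) ^ N"
      using \<eta> e by (simp add: z_t)
    also have "\<dots> \<le> (\<Theta> * e) * exp (\<Theta> * L)"
    proof -
      have "(1 + \<eta> * L) ^ N \<le> exp (real N * (\<eta> * L))" using \<eta>(1) L(1) by (intro one_plus_power_le_exp) auto
      also have "real N * (\<eta> * L) = \<Theta> * L" using \<eta>(3) by (simp add: mult.assoc[symmetric])
      finally have "(\<Theta> * e) * (1 + \<eta> * L) ^ N \<le> (\<Theta> * e) * exp (\<Theta> * L)"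
        using \<Theta> e by (intro mult_left_mono) auto
      then show ?thesis unfolding \<eta>(3)[symmetric] by (simp add: mult_ac)
    qed
    also have "\<dots> = (G * ((LA + L\<^sup>2) * c)) * \<eta> * r + (G * (L2 * c\<^sup>2 * r)) * r"
      by (simp add: G_def e_def power2_eq_square algebra_simps)
    also have "\<dots> \<le> (G * ((LA + L\<^sup>2) * c)) * \<eta>0 * r + (1 / 8) * r"
      using \<eta>(2) G H r by (intro add_mono mult_right_mono mult_left_mono) auto
    also have "(G * ((LA + L\<^sup>2) * c)) * \<eta>0 = 1 / 8"
      unfolding \<eta>0_def using G less_imp_neq[OF H] by auto
    also have "1 / 8 * r + 1 / 8 * r = r / 4" by simp
    finally have 1: "norm (euler_product linearization \<eta> N t *v w - z (t + \<Theta>)) \<le> r / 4" .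
    have "norm (z (t + \<Theta>)) \<le> (1 / 4) * r"
      using order_trans[OF z_exp mult_right_mono[OF quarter]] \<Theta> r(1) by simp
    with 1 show ?thesis
      using norm_triangle_ineq[of "euler_product linearization \<eta> N t *v w - z (t + \<Theta>)" "z (t + \<Theta>)"] by simp
  qed
  have "norm (euler_product linearization \<eta> N t *v v) \<le> norm v / 2"
    if \<eta>: "0 < \<eta>" "\<eta> < \<eta>0" "real N * \<eta> = \<Theta>" for \<eta> N t v
  proof (cases "v = 0")
    case False
    then have "norm (euler_product linearization \<eta> N t *v ((r / norm v) *\<^sub>R v)) \<le> r / 2"
      using r(1) by (intro sphere \<eta>) simp
    then show ?thesis using False r(1) by (simp add: matrix_vector_mult_scaleR field_simps)
  qed simp
  then show thesis using that[OF \<Theta> \<eta>0] by blast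
qed

end

section \<open>A strict Lyapunov function near the orbit\<close>

text \<open>The derivative is named because the value \<open>g' p (1, f p)\<close>, the derivative of \<open>g\<close> along the flow,
  is what matters later.\<close>

definition C1_with_derivative ::
    "('a::real_normed_vector \<Rightarrow> 'b::real_normed_vector) \<Rightarrow> ('a \<Rightarrow> 'a \<Rightarrow> 'b) \<Rightarrow> bool" where
  "C1_with_derivative g g' \<longleftrightarrow>
     (\<forall>p. (g has_derivative g' p) (at p)) \<and> (\<forall>q. continuous_on UNIV (\<lambda>p. g' p q))"

lemma C1_with_derivativeI:
  assumes "\<And>p. (g has_derivative g' p) (at p)" "\<And>q. continuous_on UNIV (\<lambda>p. g' p q)"
  shows "C1_with_derivative g g'"
  using assms unfolding C1_with_derivative_def by blast

lemma C1_has_derivative: "C1_with_derivative g g' \<Longrightarrow> (g has_derivative g' p) (at p)"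
  unfolding C1_with_derivative_def by blast

lemma C1_derivative_continuous: "C1_with_derivative g g' \<Longrightarrow> continuous_on UNIV (\<lambda>p. g' p q)"
  unfolding C1_with_derivative_def by blast

lemma C1_continuous: "C1_with_derivative g g' \<Longrightarrow> continuous_on UNIV g"
  by (meson C1_has_derivative continuous_at_imp_continuous_on has_derivative_continuous)

lemma C1_compose_real:
  fixes h :: "real \<Rightarrow> real"
  assumes g: "C1_with_derivative g g'" and h: "\<And>y. (h has_real_derivative h' y) (at y)"
    and h'c: "continuous_on UNIV h'"
  shows "C1_with_derivative (\<lambda>p. h (g p)) (\<lambda>p q. h' (g p) * g' p q)"
proof (rule C1_with_derivativeI)
  show "((\<lambda>p. h (g p)) has_derivative (\<lambda>q. h' (g p) * g' p q)) (at p)" for p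
    using has_derivative_compose[OF C1_has_derivative[OF g] h[unfolded has_field_derivative_def]] .
  show "continuous_on UNIV (\<lambda>p. h' (g p) * g' p q)" for q
    by (intro continuous_on_mult continuous_on_compose2[OF h'c C1_continuous[OF g]]
        C1_derivative_continuous[OF g]) auto
qed

lemma C1_mult:
  fixes g h :: "'a::real_normed_vector \<Rightarrow> real"
  assumes g: "C1_with_derivative g g'" and h: "C1_with_derivative h h'"
  shows "C1_with_derivative (\<lambda>p. g p * h p) (\<lambda>p q. g p * h' p q + g' p q * h p)"
  by (intro C1_with_derivativeI has_derivative_mult C1_has_derivative[OF g] C1_has_derivative[OF h]
      continuous_intros C1_continuous[OF g] C1_continuous[OF h]
      C1_derivative_continuous[OF g] C1_derivative_continuous[OF h])

lemma C1_add:
  assumes g: "C1_with_derivative g g'" and h: "C1_with_derivative h h'"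
  shows "C1_with_derivative (\<lambda>p. g p + h p) (\<lambda>p q. g' p q + h' p q)"
  by (intro C1_with_derivativeI has_derivative_add C1_has_derivative[OF g] C1_has_derivative[OF h]
      continuous_intros C1_derivative_continuous[OF g] C1_derivative_continuous[OF h])

lemma C1_cmult:
  fixes g :: "'a::real_normed_vector \<Rightarrow> real"
  assumes g: "C1_with_derivative g g'"
  shows "C1_with_derivative (\<lambda>p. c * g p) (\<lambda>p q. c * g' p q)"
  by (intro C1_with_derivativeI has_derivative_mult_right C1_has_derivative[OF g]
      continuous_intros C1_derivative_continuous[OF g])

lemma C1_sum:
  assumes "\<And>i. i \<in> I \<Longrightarrow> C1_with_derivative (g i) (g' i)"
  shows "C1_with_derivative (\<lambda>p. \<Sum>i\<in>I. g i p) (\<lambda>p q. \<Sum>i\<in>I. g' i p q)"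
  using assms
  by (intro C1_with_derivativeI has_derivative_sum continuous_on_sum)
    (auto intro: C1_has_derivative C1_derivative_continuous)

lemma C1_of_time:
  fixes h :: "real \<Rightarrow> 'b::real_normed_vector"
  assumes h: "\<And>t. (h has_vector_derivative h' t) (at t)" and h'c: "continuous_on UNIV h'"
  shows "C1_with_derivative (\<lambda>p::'n::finite point. h (fst p)) (\<lambda>p q. fst q *\<^sub>R h' (fst p))"
proof (rule C1_with_derivativeI)
  show "((\<lambda>p. h (fst p)) has_derivative (\<lambda>q. fst q *\<^sub>R h' (fst p))) (at p)" for p :: "'n point"
    by (rule has_derivative_compose[OF has_derivative_fst[OF has_derivative_ident]])
      (use h in \<open>simp add: has_vector_derivative_def\<close>)
  show "continuous_on UNIV (\<lambda>p::'n point. fst q *\<^sub>R h' (fst p))" for q :: "'n point"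
    by (intro continuous_intros continuous_on_compose2[OF h'c]) auto
qed

lemma C1_time_shift:
  fixes g :: "'n::finite point \<Rightarrow> 'b::real_normed_vector"
  assumes g: "C1_with_derivative g g'"
  shows "C1_with_derivative (\<lambda>p. g (p + (c, 0))) (\<lambda>p q. g' (p + (c, 0)) q)"
proof (rule C1_with_derivativeI)
  show "((\<lambda>p. g (p + (c, 0))) has_derivative (\<lambda>q. g' (p + (c, 0)) q)) (at p)" for p
    by (rule has_derivative_compose[where f="\<lambda>p. p + (c, 0)" and g=g, OF _ C1_has_derivative[OF g]])
      (auto intro!: derivative_eq_intros)
  show "continuous_on UNIV (\<lambda>p. g' (p + (c, 0)) q)" for q
    by (intro continuous_on_compose2[OF C1_derivative_continuous[OF g]] continuous_intros) auto
qed

lemma C1_derivative_eq_sum_coords: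
  assumes "C1_with_derivative g g'"
  shows "g' p q = (\<Sum>k\<in>UNIV. (coords q $ k) *\<^sub>R g' p (unit_vec k))"
  by (rule linear_eq_sum_coords) (use C1_has_derivative[OF assms] has_derivative_linear in blast)

lemma continuous_on_coords: "continuous_on S (\<lambda>p. coords (1, g p) $ k)"
  if "continuous_on S g" for g :: "'a::topological_space \<Rightarrow> real ^ 'n::finite"
  using that by (cases k) (auto simp: coords_def intro!: continuous_intros)

lemma bounded_bilinear_matrix_vector: "bounded_bilinear ((*v) :: real ^ 'n::finite ^ 'n \<Rightarrow> _)"
  unfolding bilinear_conv_bounded_bilinear[symmetric] bilinear_def
  by (auto intro!: linearI simp: matrix_vector_right_distrib matrix_vector_mult_add_rdistrib
      matrix_vector_mult_scaleR scaleR_matrix_vector_assoc)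

lemma symmetric_matrix_inner:
  fixes X :: "real ^ 'n::finite ^ 'n"
  assumes "transpose X = X"
  shows "v \<bullet> (X *v w) = w \<bullet> (X *v v)"
  by (metis assms dot_lmul_matrix inner_commute transpose_matrix_vector)

context periodic_C2_system
begin

lemma C1_orbital_derivative_continuous:
  assumes "C1_with_derivative g g'"
  shows "continuous_on UNIV (\<lambda>p. g' p (1, f p))"
  by (subst C1_derivative_eq_sum_coords[OF assms])
    (intro continuous_intros C1_derivative_continuous[OF assms] continuous_on_coords f_continuous)

end

context stable_periodic_solution
begin

text \<open>\<open>W\<close> is the quadratic form of the Lyapunov matrix in the deviation from the orbit. Passing from
  the linearized to the nonlinear flow, and from the linearization at the orbit to the one at a
  nearby point, changes the two inequalities by terms that carry one more factor of the deviation;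
  for small deviations they are absorbed by the margin of the Lyapunov inequality.\<close>

lemma orbit_lyapunov_function:
  obtains M M' \<mu> m \<kappa> r W W' where
    "\<mu> > 0" "m > 0" "\<kappa> > 0" "r > 0"
    "\<And>t. (M has_vector_derivative M' t) (at t)" "continuous_on UNIV M'"
    "\<And>t. M (t + T) = M t" "\<And>t. transpose (M t) = M t" "\<And>t v. \<mu> * (norm v)\<^sup>2 \<le> v \<bullet> (M t *v v)"
    "C1_with_derivative W W'" "\<And>t x. W (t + T, x) = W (t, x)"
    "\<And>t x. \<mu> * (norm (x - u t))\<^sup>2 \<le> W (t, x)" "\<And>t x. W (t, x) \<le> m * (norm (x - u t))\<^sup>2"
    "\<And>p. W p < r \<Longrightarrow> W' p (1, f p) \<le> - \<kappa> * W p"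
    "\<And>p v. W p < r \<Longrightarrow>
       v \<bullet> (M' (fst p) *v v) + 2 * (v \<bullet> (M (fst p) *v (Dx f p *v v))) \<le> - (norm v)\<^sup>2 / 4"
proof -
  obtain R where R: "R > 0" "\<And>t. norm (u t) \<le> R" using u_bounded by blast
  obtain L where L: "L > 0"
    "\<And>t t' x y. norm x \<le> R \<Longrightarrow> norm y \<le> R \<Longrightarrow>
       norm (f (t, x) - f (t', y)) \<le> L * norm ((t, x) - (t', y))"
    "\<And>t x v. norm x \<le> R \<Longrightarrow> norm (Dx f (t, x) *v v) \<le> L * norm v"
    using f_lipschitz[of R] by blast
  obtain LA where LA: "LA > 0"
    "\<And>t t' v. norm ((linearization t - linearization t') *v v) \<le> LA * \<bar>t - t'\<bar> * norm v"
    using linearization_lipschitz by blast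
  interpret lin: bounded_linear_system linearization L
    using L(1) L(3)[OF R(2)] by unfold_locales (auto simp: linearization_def)
  obtain \<Theta> \<eta>0 where contr: "\<Theta> > 0" "\<eta>0 > 0"
    "\<And>N \<eta> t v. 0 < \<eta> \<Longrightarrow> \<eta> < \<eta>0 \<Longrightarrow> real N * \<eta> = \<Theta> \<Longrightarrow>
       norm (euler_product linearization \<eta> N t *v v) \<le> norm v / 2"
    using euler_product_contraction by blast
  obtain M M' \<mu> where \<mu>: "\<mu> > 0" and Mder: "\<And>t. (M has_vector_derivative M' t) (at t)"
    and M'c: "continuous_on UNIV M'" and Mper: "\<And>t. M (t + T) = M t"
    and Msym: "\<And>t. transpose (M t) = M t" and Mpos: "\<And>t v. \<mu> * (norm v)\<^sup>2 \<le> v \<bullet> (M t *v v)"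
    and Mlyap: "\<And>t v. v \<bullet> (M' t *v v) + 2 * (v \<bullet> (M t *v (linearization t *v v))) \<le> - (norm v)\<^sup>2 / 2"
    by (rule lin.periodic_lyapunov_matrix[where T=T and LA=LA and \<Theta>=\<Theta> and ?\<eta>0.0=\<eta>0,
          OF linearization_periodic less_imp_le[OF LA(1)] LA(2) contr(1,2)])
      (erule (2) contr(3), rule that, assumption+)
  interpret mv: bounded_bilinear "(*v) :: real ^ 'n ^ 'n \<Rightarrow> _" by (rule bounded_bilinear_matrix_vector)
  have Mc: "continuous_on UNIV M"
    using Mder by (intro continuous_at_imp_continuous_on ballI has_vector_derivative_continuous)
  obtain m where m: "m > 0" "\<And>t v. norm (M t *v v) \<le> m * norm v"
  proof -
    obtain B where B: "B \<ge> 0" "\<And>t (x::real). norm x \<le> 0 \<Longrightarrow> norm (M (fst (t, x))) \<le> B"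
    proof (rule periodic_bounded[OF T_pos, where g="\<lambda>p. M (fst p)"])
      show "continuous_on UNIV (\<lambda>p :: real \<times> real. M (fst p))"
        by (rule continuous_on_compose2[OF Mc continuous_on_fst[OF continuous_on_id]]) simp
      show "M (fst (t + T, x)) = M (fst (t, x))" for t and x :: real by (simp add: Mper)
    qed (rule that)
    obtain K where K: "K > 0" "\<And>(X :: real ^ 'n ^ 'n) v. norm (X *v v) \<le> norm X * norm v * K"
      using mv.pos_bounded by blast
    have "norm (M t *v v) \<le> (B * K + 1) * norm v" for t v
    proof -
      have "norm (M t *v v) \<le> norm (M t) * norm v * K" by (rule K(2))
      also have "\<dots> \<le> B * norm v * K" using B(2)[of 0 t] K(1) by (intro mult_right_mono) auto
      also have "\<dots> \<le> (B * K + 1) * norm v" by (simp add: algebra_simps)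
      finally show ?thesis .
    qed
    moreover have "B * K + 1 > 0" using B(1) K(1) by (simp add: add_nonneg_pos)
    ultimately show thesis using that by blast
  qed
  obtain L2 where L2: "L2 > 0"
    "\<And>t x z. norm x \<le> R + 1 \<Longrightarrow> norm (x + z) \<le> R + 1 \<Longrightarrow>
       norm (f (t, x + z) - f (t, x) - Dx f (t, x) *v z) \<le> L2 * (norm z)\<^sup>2"
    using linearization_error[of "R + 1"] by blast
  obtain L3 where L3: "L3 > 0" "\<And>t t' x y v. norm x \<le> R + 1 \<Longrightarrow> norm y \<le> R + 1 \<Longrightarrow>
       norm ((Dx f (t, x) - Dx f (t', y)) *v v) \<le> L3 * norm ((t, x) - (t', y)) * norm v"
    using Dx_lipschitz[of "R + 1"] by blast

  define z :: "'n point \<Rightarrow> real ^ 'n" where "z p = snd p - u (fst p)" for p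
  define z' :: "'n point \<Rightarrow> 'n point \<Rightarrow> real ^ 'n" where "z' p q = snd q - fst q *\<^sub>R f (fst p, u (fst p))" for p q
  define W where "W p = z p \<bullet> (M (fst p) *v z p)" for p
  define W' where "W' p q = 2 * (z' p q \<bullet> (M (fst p) *v z p)) + fst q * (z p \<bullet> (M' (fst p) *v z p))" for p q
  have fu_c: "continuous_on UNIV (\<lambda>t. f (t, u t))"
    by (intro continuous_on_compose2[OF f_continuous] continuous_intros u_continuous) auto
  have zder: "(z has_derivative z' p) (at p)" for p
    unfolding z_def[abs_def] z'_def[abs_def]
    by (intro has_derivative_diff has_derivative_snd has_derivative_ident
        C1_has_derivative[OF C1_of_time[OF u_deriv fu_c]])
  have zc: "continuous_on UNIV z"
    using zder by (meson continuous_at_imp_continuous_on has_derivative_continuous)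
  have C1W: "C1_with_derivative W W'"
  proof (rule C1_with_derivativeI)
    show "(W has_derivative W' p) (at p)" for p
    proof -
      have "(W has_derivative (\<lambda>q. z p \<bullet> (M (fst p) *v z' p q + (fst q *\<^sub>R M' (fst p)) *v z p)
          + z' p q \<bullet> (M (fst p) *v z p))) (at p)"
        unfolding W_def[abs_def]
        by (intro has_derivative_inner mv.FDERIV zder C1_has_derivative[OF C1_of_time[OF Mder M'c]])
      moreover have "z p \<bullet> (M (fst p) *v z' p q) = z' p q \<bullet> (M (fst p) *v z p)" for q
        by (rule symmetric_matrix_inner[OF Msym])
      ultimately show ?thesis
        by (simp add: W'_def[abs_def] inner_add_right scaleR_matrix_vector_assoc[symmetric] algebra_simps)
    qed
    show "continuous_on UNIV (\<lambda>p. W' p q)" for q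
      unfolding W'_def z'_def
      by (intro continuous_intros mv.continuous_on zc continuous_on_compose2[OF Mc]
          continuous_on_compose2[OF M'c] continuous_on_compose2[OF fu_c]) auto
  qed
  have Wper: "W (t + T, x) = W (t, x)" for t x by (simp add: W_def z_def Mper u_periodic)
  have Wlow: "\<mu> * (norm (z p))\<^sup>2 \<le> W p" for p unfolding W_def by (rule Mpos)
  have Wupp: "W p \<le> m * (norm (z p))\<^sup>2" for p
  proof -
    have "W p \<le> norm (z p) * norm (M (fst p) *v z p)" unfolding W_def by (rule norm_cauchy_schwarz)
    also have "\<dots> \<le> norm (z p) * (m * norm (z p))" by (intro mult_left_mono m) auto
    finally show ?thesis by (simp add: power2_eq_square algebra_simps)
  qed
  define S where "S = m * (L2 + L3)"
  have S: "S > 0" using m(1) L2(1) L3(1) by (simp add: S_def)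
  define \<rho> where "\<rho> = min 1 (1 / (8 * S))"
  have \<rho>: "\<rho> > 0" "\<rho> \<le> 1" "8 * (S * \<rho>) \<le> 1"
  proof -
    have "S * \<rho> \<le> S * (1 / (8 * S))" using S by (intro mult_left_mono) (auto simp: \<rho>_def)
    then show "8 * (S * \<rho>) \<le> 1" using S by simp
  qed (use S in \<open>auto simp: \<rho>_def\<close>)
  define r where "r = \<mu> * \<rho>\<^sup>2"
  have r: "r > 0" using \<mu> \<rho>(1) by (simp add: r_def)
  have small: "norm (z p) \<le> \<rho>" if "W p < r" for p
  proof -
    have "\<mu> * (norm (z p))\<^sup>2 \<le> \<mu> * \<rho>\<^sup>2" using Wlow[of p] that by (simp add: r_def)
    then have "(norm (z p))\<^sup>2 \<le> \<rho>\<^sup>2" using \<mu> by simp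
    then show ?thesis using \<rho>(1) by (simp add: power2_le_iff_abs_le)
  qed
  have bdu: "norm (u (fst p)) \<le> R + 1" "norm (u (fst p) + z p) \<le> R + 1" if "W p < r" for p
    using R(2)[of "fst p"] small[OF that] \<rho>(2) norm_triangle_ineq[of "u (fst p)" "z p"] by auto
  have err: "m * (L2 * norm (z p)) \<le> 1 / 8" "m * (L3 * norm (z p)) \<le> 1 / 8" if "W p < r" for p
  proof -
    have "m * (L2 * norm (z p)) \<le> m * ((L2 + L3) * \<rho>)" "m * (L3 * norm (z p)) \<le> m * ((L2 + L3) * \<rho>)"
      using small[OF that] m(1) L2(1) L3(1) by (auto intro!: mult_left_mono mult_mono)
    then show "m * (L2 * norm (z p)) \<le> 1 / 8" "m * (L3 * norm (z p)) \<le> 1 / 8"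
      using \<rho>(3) by (auto simp: S_def mult.assoc)
  qed
  have Wdecr: "W' p (1, f p) \<le> - (1 / (4 * m)) * W p" if "W p < r" for p
  proof -
    define e where "e = f (fst p, u (fst p) + z p) - f (fst p, u (fst p)) - linearization (fst p) *v z p"
    have e: "norm e \<le> L2 * (norm (z p))\<^sup>2"
      unfolding e_def linearization_def by (rule L2(2)[OF bdu[OF that]])
    have "e \<bullet> (M (fst p) *v z p) \<le> norm e * norm (M (fst p) *v z p)" by (rule norm_cauchy_schwarz)
    also have "\<dots> \<le> (L2 * (norm (z p))\<^sup>2) * (m * norm (z p))"
      using e m L2(1) by (intro mult_mono) auto
    also have "\<dots> = (m * (L2 * norm (z p))) * (norm (z p))\<^sup>2" by (simp add: mult_ac)
    also have "\<dots> \<le> (1 / 8) * (norm (z p))\<^sup>2" by (intro mult_right_mono err that) auto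
    finally have e2: "e \<bullet> (M (fst p) *v z p) \<le> (norm (z p))\<^sup>2 / 8" by simp
    have "z' p (1, f p) = linearization (fst p) *v z p + e"
      by (simp add: e_def z'_def z_def)
    then have "W' p (1, f p) = (z p \<bullet> (M' (fst p) *v z p) + 2 * (z p \<bullet> (M (fst p) *v (linearization (fst p) *v z p))))
        + 2 * (e \<bullet> (M (fst p) *v z p))"
      using symmetric_matrix_inner[OF Msym, of "z p" "fst p" "linearization (fst p) *v z p"]
      by (simp add: W'_def inner_add_left)
    also have "\<dots> \<le> - (norm (z p))\<^sup>2 / 4" using Mlyap[of "z p" "fst p"] e2 by linarith
    also have "\<dots> \<le> - (1 / (4 * m)) * W p" using Wupp[of p] m(1) by (simp add: field_simps)
    finally show ?thesis .
  qed
  have Mnear: "v \<bullet> (M' (fst p) *v v) + 2 * (v \<bullet> (M (fst p) *v (Dx f p *v v))) \<le> - (norm v)\<^sup>2 / 4"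
    if "W p < r" for p v
  proof -
    define e where "e = (Dx f (fst p, u (fst p) + z p) - Dx f (fst p, u (fst p))) *v v"
    have e: "norm e \<le> L3 * norm (z p) * norm v"
      using L3(2)[OF bdu(2,1)[OF that], of "fst p" "fst p" v] by (simp add: e_def norm_Pair)
    have "v \<bullet> (M (fst p) *v e) \<le> norm v * norm (M (fst p) *v e)" by (rule norm_cauchy_schwarz)
    also have "\<dots> \<le> norm v * (m * (L3 * norm (z p) * norm v))"
      using m by (intro mult_left_mono order_trans[OF m(2)] e) auto
    also have "\<dots> = (m * (L3 * norm (z p))) * (norm v)\<^sup>2" by (simp add: power2_eq_square mult_ac)
    also have "\<dots> \<le> (1 / 8) * (norm v)\<^sup>2" by (intro mult_right_mono err that) auto
    finally have "v \<bullet> (M (fst p) *v e) \<le> (norm v)\<^sup>2 / 8" by simp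
    moreover have "Dx f p *v v = linearization (fst p) *v v + e"
      by (simp add: e_def linearization_def z_def matrix_vector_mult_diff_rdistrib)
    ultimately show ?thesis
      using Mlyap[of v "fst p"] by (simp add: matrix_vector_right_distrib inner_add_right)
  qed
  have k: "1 / (4 * m) > 0" using m(1) by simp
  show thesis
    by (rule that[OF \<mu> m(1) k r Mder M'c Mper Msym Mpos C1W Wper _ _ Wdecr Mnear])
      (use Wlow Wupp in \<open>auto simp: z_def\<close>)
qed

end

section \<open>Functions decreasing along a tube around a solution\<close>

subsection \<open>A continuously differentiable plateau\<close>

definition sq_pos_part :: "real \<Rightarrow> real" where
  "sq_pos_part y = (max 0 y)\<^sup>2"

text \<open>Holds because the derivative \<open>2 max 0 y\<close> has Lipschitz constant \<open>2\<close>.\<close>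

lemma sq_pos_part_quadratic_error: "\<bar>sq_pos_part (y + h) - sq_pos_part y - 2 * max 0 y * h\<bar> \<le> h\<^sup>2"
proof -
  consider "y \<ge> 0" "y + h \<ge> 0" | "y \<ge> 0" "y + h < 0" | "y < 0" "y + h \<ge> 0" | "y < 0" "y + h < 0"
    by linarith
  then show ?thesis
  proof cases
    case 2
    then have "sq_pos_part (y + h) - sq_pos_part y - 2 * max 0 y * h = h\<^sup>2 - (y + h)\<^sup>2"
      by (simp add: sq_pos_part_def max_def power2_eq_square algebra_simps)
    moreover have "(y + h)\<^sup>2 \<le> h\<^sup>2"
      using 2 power_mono[of "- (y + h)" "- h" 2] by (simp add: power2_eq_square algebra_simps)
    ultimately show ?thesis by simp
  next
    case 3
    then have "(y + h)\<^sup>2 \<le> h\<^sup>2" by (intro power_mono) auto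
    with 3 show ?thesis by (simp add: sq_pos_part_def max_def)
  qed (auto simp: sq_pos_part_def max_def power2_eq_square algebra_simps)
qed

lemma sq_pos_part_deriv: "(sq_pos_part has_real_derivative 2 * max 0 y) (at y)"
  unfolding DERIV_def
proof (rule LIM_zero_cancel, rule Lim_null_comparison[where g="\<lambda>h. \<bar>h\<bar>"])
  have "norm ((sq_pos_part (y + h) - sq_pos_part y) / h - 2 * max 0 y) \<le> \<bar>h\<bar>" if "h \<noteq> 0" for h
  proof -
    have "(sq_pos_part (y + h) - sq_pos_part y) / h - 2 * max 0 y
        = (sq_pos_part (y + h) - sq_pos_part y - 2 * max 0 y * h) / h"
      using that by (simp add: field_simps)
    also have "norm \<dots> \<le> h\<^sup>2 / \<bar>h\<bar>"
      using sq_pos_part_quadratic_error[of y h] by (simp add: divide_right_mono)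
    finally show ?thesis using that by (simp add: power2_eq_square abs_mult_self_eq field_simps)
  qed
  then show "\<forall>\<^sub>F h in at 0. norm ((sq_pos_part (y + h) - sq_pos_part y) / h - 2 * max 0 y) \<le> \<bar>h\<bar>"
    by (auto simp: eventually_at_filter)
  show "((\<lambda>h::real. \<bar>h\<bar>) \<longlongrightarrow> 0) (at 0)" by (intro tendsto_eq_intros) auto
qed

lemma sq_pos_part_simps: "0 \<le> sq_pos_part y" "y \<le> 0 \<Longrightarrow> sq_pos_part y = 0" "y \<ge> 0 \<Longrightarrow> sq_pos_part y = y\<^sup>2"
  by (auto simp: sq_pos_part_def max_def)

text \<open>Equal to \<open>1\<close> up to \<open>1\<close>, to \<open>0\<close> from \<open>2\<close> on, and decreasing in between.\<close>

definition plateau :: "real \<Rightarrow> real" where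
  "plateau r = sq_pos_part (1 - sq_pos_part (r - 1))"

definition plateau' :: "real \<Rightarrow> real" where
  "plateau' r = - (2 * max 0 (1 - sq_pos_part (r - 1))) * (2 * max 0 (r - 1))"

lemma plateau_deriv: "(plateau has_real_derivative plateau' r) (at r)"
proof -
  have "((\<lambda>r. 1 - sq_pos_part (r - 1)) has_real_derivative - (2 * max 0 (r - 1))) (at r)"
    by (rule derivative_eq_intros DERIV_chain2[where f=sq_pos_part, OF sq_pos_part_deriv] refl)+ simp
  from DERIV_chain2[where f=sq_pos_part, OF sq_pos_part_deriv this]
  show ?thesis by (simp add: plateau_def[abs_def] plateau'_def)
qed

lemma continuous_on_plateau': "continuous_on UNIV plateau'"
  unfolding plateau'_def[abs_def] sq_pos_part_def by (intro continuous_intros)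

lemma plateau_left: "r \<le> 1 \<Longrightarrow> plateau r = 1" "r \<le> 1 \<Longrightarrow> plateau' r = 0"
  by (auto simp: plateau_def plateau'_def sq_pos_part_def)

lemma plateau_right:
  assumes "r \<ge> 2"
  shows "plateau r = 0" "plateau' r = 0"
proof -
  have "1 \<le> (r - 1)\<^sup>2" using power_mono[of 1 "r - 1" 2] assms by simp
  then have "1 - sq_pos_part (r - 1) \<le> 0" using assms by (simp add: sq_pos_part_simps)
  then show "plateau r = 0" "plateau' r = 0" by (auto simp: plateau_def plateau'_def sq_pos_part_simps)
qed

lemma plateau_bounds: "0 \<le> plateau r" "plateau r \<le> 1" "plateau' r \<le> 0" "- 4 \<le> plateau' r"
proof -
  have s: "0 \<le> sq_pos_part (r - 1)" by (rule sq_pos_part_simps)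
  show "0 \<le> plateau r" unfolding plateau_def by (rule sq_pos_part_simps)
  show "plateau r \<le> 1"
    unfolding plateau_def sq_pos_part_def using s power_mono[of "max 0 (1 - sq_pos_part (r - 1))" 1 2]
    by (simp add: sq_pos_part_def)
  show "plateau' r \<le> 0" unfolding plateau'_def by (simp add: mult_nonneg_nonneg)
  show "- 4 \<le> plateau' r"
  proof (cases "r \<le> 2")
    case True
    have "max 0 (1 - sq_pos_part (r - 1)) * max 0 (r - 1) \<le> 1 * 1"
      using True s by (intro mult_mono) auto
    then show ?thesis by (simp add: plateau'_def)
  qed (simp add: plateau_right)
qed

subsection \<open>The tube function\<close>

lemma C1_snd: "C1_with_derivative (\<lambda>p::'n::finite point. snd p) (\<lambda>p q. snd q)"
  by (intro C1_with_derivativeI has_derivative_snd has_derivative_ident continuous_intros)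

lemma C1_diff:
  assumes g: "C1_with_derivative g g'" and h: "C1_with_derivative h h'"
  shows "C1_with_derivative (\<lambda>p. g p - h p) (\<lambda>p q. g' p q - h' p q)"
  by (intro C1_with_derivativeI has_derivative_diff C1_has_derivative[OF g] C1_has_derivative[OF h]
      continuous_intros C1_derivative_continuous[OF g] C1_derivative_continuous[OF h])

lemma C1_norm_squared:
  fixes g :: "'a::real_normed_vector \<Rightarrow> 'b::real_inner"
  assumes g: "C1_with_derivative g g'"
  shows "C1_with_derivative (\<lambda>p. (norm (g p))\<^sup>2) (\<lambda>p q. 2 * (g p \<bullet> g' p q))"
proof (rule C1_with_derivativeI)
  have "((\<lambda>p. g p \<bullet> g p) has_derivative (\<lambda>q. g p \<bullet> g' p q + g' p q \<bullet> g p)) (at p)" for p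
    by (intro has_derivative_inner C1_has_derivative[OF g])
  then show "((\<lambda>p. (norm (g p))\<^sup>2) has_derivative (\<lambda>q. 2 * (g p \<bullet> g' p q))) (at p)" for p
    by (simp add: power2_norm_eq_inner inner_commute)
  show "continuous_on UNIV (\<lambda>p. 2 * (g p \<bullet> g' p q))" for q
    by (intro continuous_intros C1_continuous[OF g] C1_derivative_continuous[OF g])
qed

context periodic_C2_system
begin

text \<open>Solutions are given for forward time only, while functions of a neighbourhood of the initial
  point have to be differentiable on both sides of the initial time. A straight continuation with the
  initial velocity matches the derivative there.\<close>

lemma solution_extended_backwards:
  assumes x: "solves_ivp f p x"
  obtains c where "\<And>t. (c has_vector_derivative f (max t (fst p), c (max t (fst p)))) (at t)"
    "\<And>t. fst p \<le> t \<Longrightarrow> c t = x t"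
proof -
  define t0 where "t0 = fst p"
  define c where "c t = (if t \<in> {t0..} then x t else snd p + (t - t0) *\<^sub>R f p)" for t
  have x0: "x t0 = snd p" using x by (simp add: solves_ivp_def t0_def)
  have cl: "closure {t0..} = {t0..}" "closure {..<t0} = {..t0}" by auto
  have "(c has_vector_derivative (if t \<in> {t0..} then f (t, x t) else f p)) (at t within UNIV)" for t
    unfolding c_def[abs_def]
  proof (rule has_vector_derivative_If_within_closures[where S="{t0..}" and T="{..<t0}"])
    show "UNIV = {t0..} \<union> {..<t0}" by auto
    have eq: "{t0..} \<union> (closure {t0..} \<inter> closure {..<t0}) = {t0..}" unfolding cl by auto
    show "(x has_vector_derivative f (t, x t)) (at t within {t0..} \<union> (closure {t0..} \<inter> closure {..<t0}))"
      if "t \<in> {t0..} \<union> (closure {t0..} \<inter> closure {..<t0})"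
      using that x unfolding eq by (simp add: solves_ivp_def t0_def)
    show "((\<lambda>t. snd p + (t - t0) *\<^sub>R f p) has_vector_derivative f p)
        (at t within {..<t0} \<union> (closure {t0..} \<inter> closure {..<t0}))"
      by (auto intro!: derivative_eq_intros simp: has_vector_derivative_def)
    show "x t = snd p + (t - t0) *\<^sub>R f p" if "t \<in> closure {t0..}" "t \<in> closure {..<t0}"
      using that x0 unfolding cl by auto
    show "f (t, x t) = f p" if "t \<in> closure {t0..}" "t \<in> closure {..<t0}"
    proof -
      have "t = t0" using that unfolding cl by auto
      then show ?thesis using x0 by (simp add: t0_def)
    qed
  qed auto
  moreover have "(if t \<in> {t0..} then f (t, x t) else f p) = f (max t t0, c (max t t0))" for t
    using x0 by (auto simp: c_def max_def) (simp add: t0_def)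
  ultimately have "(c has_vector_derivative f (max t t0, c (max t t0))) (at t)" for t by simp
  then show thesis by (intro that[of c]) (auto simp: c_def t0_def)
qed

text \<open>The tube around the solution widens at the rate \<open>exp (2 L t)\<close>, faster than solutions can
  separate, so no solution leaves it through its lateral boundary. On the plateau in its middle the
  function depends on time only; this absorbs the defect of the curve before the initial time, where
  it is not a solution. The function increases towards \<open>0\<close> only while it is switched off, that is,
  in the prescribed neighbourhood of the end point.\<close>

lemma tube_function:
  assumes x: "solves_ivp f p x" and t0: "fst p > 0" and te: "fst p \<le> te"
    and U: "open U" "(te, x te) \<in> U"
  obtains V V' and B H :: real where "C1_with_derivative V V'"
    "\<And>q. fst q \<le> 0 \<or> fst q \<ge> H \<Longrightarrow> V q = 0"
    "\<And>q. q \<notin> U \<Longrightarrow> V' q (1, f q) \<le> 0" "\<And>q. V' q (1, f q) \<le> B" "V' p (1, f p) < 0"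
proof -
  define t0 where "t0 = fst p"
  obtain c where cder: "\<And>t. (c has_vector_derivative f (max t t0, c (max t t0))) (at t)"
    and cx: "\<And>t. t0 \<le> t \<Longrightarrow> c t = x t"
    using solution_extended_backwards[OF x] unfolding t0_def by blast
  have cp: "(t0, c t0) = p" using cx[of t0] x by (simp add: solves_ivp_def t0_def)
  have cc: "continuous_on UNIV c"
    using cder by (intro continuous_at_imp_continuous_on ballI has_vector_derivative_continuous)
  have ccs: "continuous_on S c" for S using cc continuous_on_subset by blast
  define c' where "c' t = f (max t t0, c (max t t0))" for t
  have c'c: "continuous_on UNIV c'"
    unfolding c'_def by (intro continuous_on_compose2[OF f_continuous] continuous_on_compose2[OF cc] continuous_intros) auto
  obtain \<epsilon> where \<epsilon>: "\<epsilon> > 0" "ball (te, c te) \<epsilon> \<subseteq> U"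
  proof -
    have "(te, c te) \<in> U" using U(2) cx[of te] te by (simp add: t0_def)
    then show thesis using that U(1) openE by blast
  qed
  obtain R where R: "R > 0" "\<And>t. t \<in> {t0 - 1..te + 1} \<Longrightarrow> norm (c t) \<le> R"
    by (rule continuous_bounded_on_Icc[OF ccs]) blast
  obtain L where L: "L > 0"
    "\<And>t t' x y. norm x \<le> R + 1 \<Longrightarrow> norm y \<le> R + 1 \<Longrightarrow>
       norm (f (t, x) - f (t', y)) \<le> L * norm ((t, x) - (t', y))"
    by (rule f_lipschitz[of "R + 1"]) (rule that, assumption+)
  \<comment> \<open>The initial radius \<open>\<delta>\<close> is so small that the widened tube has radius at most \<open>d\<close> up to time
    \<open>te + 1\<close>: it stays where \<open>f\<close> has Lipschitz constant \<open>L\<close>, and it ends inside the given ball.\<close>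
  define d where "d = min 1 (\<epsilon> / 2)"
  have d: "d > 0" "d \<le> 1" "d \<le> \<epsilon> / 2" using \<epsilon>(1) by (auto simp: d_def)
  define \<delta> where "\<delta> = d / (2 * exp (2 * L * (te + 1 - t0)))"
  have \<delta>: "\<delta> > 0" using d by (simp add: \<delta>_def)
  have d_eq: "d = 2 * \<delta> * exp (2 * L * (te + 1 - t0))" by (simp add: \<delta>_def)
  \<comment> \<open>Before the initial time the curve is not a solution; the time \<open>\<tau>\<close> is so short that the defect is
    below what the widening of the tube tolerates at radius \<open>\<delta> / 2\<close>.\<close>
  obtain \<tau> where \<tau>: "\<tau> > 0" "\<tau> \<le> 1" "\<tau> < t0" "4 * L * \<tau> \<le> 1"
    "\<And>t. t0 - \<tau> \<le> t \<Longrightarrow> t \<le> t0 \<Longrightarrow> norm (f (t, c t) - f p) \<le> L * (\<delta> / 2)"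
  proof -
    have "continuous_on UNIV (\<lambda>t. f (t, c t))"
      by (intro continuous_on_compose2[OF f_continuous] continuous_intros cc) auto
    then have "isCont (\<lambda>t. f (t, c t)) t0" by (simp add: continuous_on_eq_continuous_at)
    moreover have "L * (\<delta> / 2) > 0" using L(1) \<delta> by simp
    ultimately obtain \<tau>1 where \<tau>1: "\<tau>1 > 0"
      "\<And>t. dist t t0 < \<tau>1 \<Longrightarrow> dist (f (t, c t)) (f (t0, c t0)) < L * (\<delta> / 2)"
      unfolding continuous_at_eps_delta by blast
    define \<tau> where "\<tau> = min (min 1 (t0 / 2)) (min (\<tau>1 / 2) (1 / (4 * L)))"
    have 4: "4 * L * \<tau> \<le> 4 * L * (1 / (4 * L))" using L(1) by (intro mult_left_mono) (auto simp: \<tau>_def)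
    show thesis
    proof (rule that[of \<tau>])
      show "\<tau> > 0" using t0 \<tau>1 L(1) by (auto simp: \<tau>_def t0_def)
      show "\<tau> < t0" using t0 by (auto simp: \<tau>_def t0_def min_def)
      show "4 * L * \<tau> \<le> 1" using 4 L(1) by simp
      show "\<tau> \<le> 1" by (simp add: \<tau>_def)
      fix t assume "t0 - \<tau> \<le> t" "t \<le> t0"
      then have "dist t t0 < \<tau>1" using \<tau>1(1) by (auto simp: dist_real_def \<tau>_def)
      then show "norm (f (t, c t) - f p) \<le> L * (\<delta> / 2)"
        using \<tau>1(2)[of t] by (simp add: cp dist_norm)
    qed
  qed
  obtain s where s: "s > 0" "s \<le> 1" "\<And>t. te \<le> t \<Longrightarrow> t \<le> te + s \<Longrightarrow> dist (t, c t) (te, c te) < \<epsilon> / 2"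
  proof -
    have "continuous_on UNIV (\<lambda>t. (t, c t))" by (intro continuous_intros cc)
    then have "isCont (\<lambda>t. (t, c t)) te" by (simp add: continuous_on_eq_continuous_at)
    moreover have "\<epsilon> / 2 > 0" using \<epsilon>(1) by simp
    ultimately obtain s1 where s1: "s1 > 0" "\<And>t. dist t te < s1 \<Longrightarrow> dist (t, c t) (te, c te) < \<epsilon> / 2"
      unfolding continuous_at_eps_delta by blast
    show thesis
    proof (rule that[of "min 1 (s1 / 2)"])
      fix t assume "te \<le> t" "t \<le> te + min 1 (s1 / 2)"
      then have "dist t te < s1" using s1(1) by (auto simp: dist_real_def)
      then show "dist (t, c t) (te, c te) < \<epsilon> / 2" by (rule s1(2))
    qed (use s1 in auto)
  qed

  define z where "z q = snd q - c (fst q)" for q :: "'n point"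
  have C1z: "C1_with_derivative z (\<lambda>q h. snd h - fst h *\<^sub>R c' (fst q))"
    unfolding z_def[abs_def] by (intro C1_diff C1_snd C1_of_time c'c) (use cder in \<open>simp add: c'_def\<close>)
  define w where "w t = exp (- 4 * L * (t - t0)) / \<delta>\<^sup>2" for t
  have wder: "(w has_vector_derivative - 4 * L * w t) (at t)" for t
  proof -
    have "((\<lambda>t. exp (- 4 * L * (t - t0))) has_real_derivative exp (- 4 * L * (t - t0)) * (- 4 * L)) (at t)"
      by (auto intro!: derivative_eq_intros)
    from DERIV_cdivide[OF this, of "\<delta>\<^sup>2"] show ?thesis
      unfolding has_real_derivative_iff_has_vector_derivative[symmetric] w_def[abs_def] by (simp add: mult_ac)
  qed
  have wc: "continuous_on UNIV (\<lambda>t. - 4 * L * w t)" unfolding w_def by (intro continuous_intros) (use \<delta> in auto)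
  have w: "w t > 0" for t using \<delta> by (simp add: w_def)
  define r where "r q = w (fst q) * (norm (z q))\<^sup>2" for q
  define r' where "r' q h = w (fst q) * (2 * (z q \<bullet> (snd h - fst h *\<^sub>R c' (fst q))))
      + (fst h *\<^sub>R (- 4 * L * w (fst q))) * (norm (z q))\<^sup>2" for q h
  have C1r: "C1_with_derivative r r'"
    unfolding r_def[abs_def] r'_def[abs_def] by (intro C1_mult C1_of_time C1_norm_squared wder wc C1z)
  define a where "a t = sq_pos_part (t - (t0 - \<tau>)) * plateau (1 + (t - te) / s)" for t
  define a' where "a' t = sq_pos_part (t - (t0 - \<tau>)) * (plateau' (1 + (t - te) / s) / s)
      + 2 * max 0 (t - (t0 - \<tau>)) * plateau (1 + (t - te) / s)" for t
  have ader: "(a has_vector_derivative a' t) (at t)" for t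
  proof -
    have "((\<lambda>t. t - (t0 - \<tau>)) has_real_derivative 1) (at t)" by (auto intro!: derivative_eq_intros)
    from DERIV_chain2[where f=sq_pos_part, OF sq_pos_part_deriv this]
    have 1: "((\<lambda>t. sq_pos_part (t - (t0 - \<tau>))) has_real_derivative 2 * max 0 (t - (t0 - \<tau>))) (at t)" by simp
    have "((\<lambda>t. 1 + (t - te) / s) has_real_derivative 1 / s) (at t)"
      using s(1) by (auto intro!: derivative_eq_intros simp: field_simps)
    from DERIV_chain2[where f=plateau, OF plateau_deriv this]
    have 2: "((\<lambda>t. plateau (1 + (t - te) / s)) has_real_derivative plateau' (1 + (t - te) / s) / s) (at t)" by simp
    show ?thesis
      unfolding has_real_derivative_iff_has_vector_derivative[symmetric]
      using DERIV_mult[OF 1 2] unfolding a_def[abs_def] a'_def by (simp add: algebra_simps)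
  qed
  have pc: "continuous_on UNIV plateau" using plateau_deriv by (meson DERIV_isCont continuous_at_imp_continuous_on)
  have a'c: "continuous_on UNIV a'"
    unfolding a'_def sq_pos_part_def
    by (intro continuous_intros continuous_on_compose2[OF pc] continuous_on_compose2[OF continuous_on_plateau'])
      (use s(1) in auto)
  define V where "V q = (- 1) * (a (fst q) * plateau (r q))" for q
  define V' where "V' q h = (- 1) * (a (fst q) * (plateau' (r q) * r' q h) + (fst h *\<^sub>R a' (fst q)) * plateau (r q))" for q h
  have C1V: "C1_with_derivative V V'"
    unfolding V_def[abs_def] V'_def[abs_def]
    by (intro C1_cmult C1_mult C1_of_time ader a'c C1_compose_real[OF C1r] plateau_deriv continuous_on_plateau')
  have a_nonneg: "a t \<ge> 0" for t
    unfolding a_def by (intro mult_nonneg_nonneg sq_pos_part_simps plateau_bounds)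
  have a_zero: "a t = 0" if "t \<le> t0 - \<tau> \<or> t \<ge> te + s" for t
  proof -
    have "1 + (t - te) / s \<ge> 2" if "t \<ge> te + s" using that s(1) by (simp add: field_simps)
    then show ?thesis using that by (auto simp: a_def sq_pos_part_simps plateau_right)
  qed
  have near: "norm (z q) < d" if "r q < 2" "fst q \<le> te + 1" for q
  proof -
    have "exp (- 4 * L * (fst q - t0)) * (norm (z q))\<^sup>2 < 2 * \<delta>\<^sup>2"
      using that(1) \<delta> by (simp add: r_def w_def field_simps)
    then have "exp (4 * L * (fst q - t0)) * (exp (- 4 * L * (fst q - t0)) * (norm (z q))\<^sup>2)
        < exp (4 * L * (fst q - t0)) * (2 * \<delta>\<^sup>2)" by simp
    then have "(norm (z q))\<^sup>2 < exp (4 * L * (fst q - t0)) * (2 * \<delta>\<^sup>2)"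
      by (simp add: mult.assoc[symmetric] exp_add[symmetric])
    also have "\<dots> \<le> exp (4 * L * (te + 1 - t0)) * (4 * \<delta>\<^sup>2)"
      using that(2) L(1) by (intro mult_mono) auto
    also have "\<dots> = d\<^sup>2"
      by (simp add: d_eq power_mult_distrib exp_double[symmetric] mult_ac)
    finally show ?thesis using d(1) by (simp add: power2_less_imp_less)
  qed
  \<comment> \<open>The distance to the curve grows at most at the rate \<open>2 L\<close>, so the rescaled distance \<open>r\<close> does not
    increase where \<open>plateau\<close> is not constant.\<close>
  have lateral: "a (fst q) * (plateau' (r q) * r' q (1, f q)) \<ge> 0" for q
  proof (cases "a (fst q) = 0 \<or> plateau' (r q) = 0")
    case False
    define t where "t = fst q"
    have t: "t0 - \<tau> < t" "t < te + s" using False a_zero[of t] by (auto simp: t_def not_le[symmetric])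
    have rq: "1 < r q" "r q < 2" using False plateau_left[of "r q"] plateau_right[of "r q"] by (auto simp: not_le[symmetric])
    have ct: "norm (c t) \<le> R" using R(2)[of t] t \<tau>(2) s(2) by auto
    have "norm (z q) < 1" using near[OF rq(2)] t s(2) d by (simp add: t_def)
    moreover have "snd q = c t + z q" by (simp add: z_def t_def)
    ultimately have sq: "norm (snd q) \<le> R + 1" using ct norm_triangle_ineq[of "c t" "z q"] by simp
    have lip: "norm (f q - f (t, c t)) \<le> L * norm (z q)"
      using L(2)[OF sq, of "c t" t t] ct by (cases q) (simp add: t_def z_def norm_Pair)
    have "norm (f q - c' t) \<le> 2 * L * norm (z q)"
    proof (cases "t0 \<le> t")
      case True
      then have "c' t = f (t, c t)" by (simp add: c'_def max_def)
      then show ?thesis using lip L(1) by (simp add: order_trans[OF lip])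
    next
      case False
      have "1 / 4 \<le> exp (- 1 :: real)" using exp_le by (simp add: exp_minus field_simps)
      also have "\<dots> \<le> exp (4 * L * (t - t0))"
      proof -
        have "4 * L * (t0 - t) \<le> 4 * L * \<tau>" using t L(1) by (intro mult_left_mono) auto
        then show ?thesis using \<tau>(4) by (simp add: algebra_simps)
      qed
      finally have "\<delta>\<^sup>2 * (1 / 4) \<le> \<delta>\<^sup>2 * exp (4 * L * (t - t0))" by (intro mult_left_mono) auto
      also have "\<delta>\<^sup>2 * exp (4 * L * (t - t0)) \<le> (norm (z q))\<^sup>2"
      proof -
        have "\<delta>\<^sup>2 \<le> exp (- 4 * L * (t - t0)) * (norm (z q))\<^sup>2"
          using rq(1) \<delta> by (simp add: r_def w_def t_def[symmetric] pos_less_divide_eq)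
        then have "\<delta>\<^sup>2 * exp (4 * L * (t - t0)) \<le> exp (- 4 * L * (t - t0)) * (norm (z q))\<^sup>2 * exp (4 * L * (t - t0))"
          by (rule mult_right_mono) simp
        also have "\<dots> = (exp (- 4 * L * (t - t0)) * exp (4 * L * (t - t0))) * (norm (z q))\<^sup>2"
          by (simp only: mult_ac)
        also have "\<dots> = (norm (z q))\<^sup>2" by (simp add: exp_add[symmetric])
        finally show ?thesis .
      qed
      finally have "(\<delta> / 2)\<^sup>2 \<le> (norm (z q))\<^sup>2" by (simp add: power_divide)
      then have \<delta>z: "\<delta> / 2 \<le> norm (z q)" by (rule power2_le_imp_le) simp
      have "c' t = f p" using False cp by (simp add: c'_def max_def)
      then have "norm (f q - c' t) \<le> norm (f q - f (t, c t)) + norm (f (t, c t) - f p)"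
        using norm_triangle_ineq[of "f q - f (t, c t)" "f (t, c t) - f p"] by simp
      also have "\<dots> \<le> L * norm (z q) + L * (\<delta> / 2)" using lip \<tau>(5)[of t] t False by (intro add_mono) auto
      also have "\<dots> \<le> L * norm (z q) + L * norm (z q)" using \<delta>z L(1) by (intro add_left_mono mult_left_mono) auto
      finally show ?thesis by simp
    qed
    then have "z q \<bullet> (f q - c' t) \<le> norm (z q) * (2 * L * norm (z q))"
      by (intro order_trans[OF norm_cauchy_schwarz] mult_left_mono) auto
    then have "2 * (z q \<bullet> (f q - c' t)) - 4 * L * (norm (z q))\<^sup>2 \<le> 0" by (simp add: power2_eq_square algebra_simps)
    then have "w t * (2 * (z q \<bullet> (f q - c' t)) - 4 * L * (norm (z q))\<^sup>2) \<le> 0"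
      using w[of t] by (simp add: mult_le_0_iff)
    then have "r' q (1, f q) \<le> 0" by (simp add: r'_def t_def algebra_simps)
    then show ?thesis using plateau_bounds(3)[of "r q"] a_nonneg[of "fst q"]
      by (intro mult_nonneg_nonneg mult_nonpos_nonpos)
  qed auto
  \<comment> \<open>What remains is the change in time, which is favourable until the function is switched off.\<close>
  have V'_le: "V' q (1, f q) \<le> - a' (fst q) * plateau (r q)" for q
    using lateral[of q] by (simp add: V'_def)
  have a'_early: "a' t \<ge> 0" if "t \<le> te" for t
  proof -
    have "1 + (t - te) / s \<le> 1" using that s(1) by (simp add: divide_nonpos_pos)
    then show ?thesis by (simp add: a'_def plateau_left)
  qed
  have a'_late: "a' t = 0" if "t \<ge> te + s" for t
  proof -
    have "1 + (t - te) / s \<ge> 2" using that s(1) by (simp add: field_simps)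
    then show ?thesis by (simp add: a'_def plateau_right)
  qed
  define B where "B = sq_pos_part (te + 1 - (t0 - \<tau>)) * (4 / s)"
  have B0: "B \<ge> 0" unfolding B_def using s(1) by (intro mult_nonneg_nonneg sq_pos_part_simps) auto
  have a'_bound: "- a' t \<le> B" for t
  proof (cases "t \<ge> te + s")
    case False
    have "sq_pos_part (t - (t0 - \<tau>)) * (- plateau' (1 + (t - te) / s) / s) \<le> B"
      unfolding B_def sq_pos_part_def using False s plateau_bounds[of "1 + (t - te) / s"]
      by (intro mult_mono power_mono divide_right_mono) (auto intro: divide_nonpos_pos)
    moreover have "0 \<le> 2 * max 0 (t - (t0 - \<tau>)) * plateau (1 + (t - te) / s)"
      by (intro mult_nonneg_nonneg plateau_bounds) auto
    ultimately show ?thesis by (simp add: a'_def)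
  qed (simp add: a'_late B0)
  show thesis
  proof (rule that[OF C1V, of "te + s" B])
    show "V q = 0" if "fst q \<le> 0 \<or> fst q \<ge> te + s" for q
      using that \<tau>(3) a_zero[of "fst q"] by (auto simp: V_def)
    show "V' q (1, f q) \<le> B" for q
    proof -
      have "- a' (fst q) * plateau (r q) \<le> B * plateau (r q)"
        by (intro mult_right_mono a'_bound plateau_bounds)
      also have "\<dots> \<le> B * 1" using B0 by (intro mult_left_mono plateau_bounds)
      finally show ?thesis using V'_le[of q] by simp
    qed
    show "V' q (1, f q) \<le> 0" if "q \<notin> U" for q
    proof (rule ccontr)
      assume "\<not> V' q (1, f q) \<le> 0"
      then have neg: "0 < - a' (fst q) * plateau (r q)" using V'_le[of q] by linarith
      then have "plateau (r q) \<noteq> 0" by auto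
      then have rq: "r q < 2" using plateau_right[of "r q"] by (auto simp: not_le[symmetric])
      have "\<not> a' (fst q) \<ge> 0"
        using neg plateau_bounds(1)[of "r q"] by (auto simp: zero_less_mult_iff mult_less_0_iff)
      then have t: "te \<le> fst q" "fst q \<le> te + s" using a'_early[of "fst q"] a'_late[of "fst q"] by force+
      have "dist q (te, c te) \<le> dist q (fst q, c (fst q)) + dist (fst q, c (fst q)) (te, c te)"
        by (rule dist_triangle)
      also have "dist q (fst q, c (fst q)) = norm (z q)"
        by (cases q) (simp add: z_def dist_Pair_Pair dist_norm)
      also have "norm (z q) + dist (fst q, c (fst q)) (te, c te) < \<epsilon> / 2 + \<epsilon> / 2"
        using near[OF rq] t s d by (intro add_strict_mono s(3)) auto
      finally have "q \<in> ball (te, c te) \<epsilon>" by (simp add: dist_commute)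
      then show False using \<epsilon>(2) that by blast
    qed
    have "z p = 0" using cp by (metis diff_self fst_conv snd_conv z_def)
    then have "r p = 0" by (simp add: r_def)
    moreover have "1 + (t0 - te) / s \<le> 1" using te s(1) by (simp add: t0_def divide_nonpos_pos)
    then have "a' t0 = 2 * \<tau>" using \<tau>(1) by (simp add: a'_def plateau_left)
    ultimately show "V' p (1, f p) < 0"
      using \<tau>(1) by (simp add: V'_def plateau_left t0_def[symmetric])
  qed
qed

end

section \<open>A scalar Lyapunov function on the basin of attraction\<close>

context periodic_C2_system
begin

text \<open>Summing the time translates of a tube function makes it periodic. What it gains near the end
  of the tube is compensated by a multiple of a strict Lyapunov function \<open>W\<close>, cut off outside the
  set where \<open>W\<close> is known to decrease.\<close>

lemma periodic_decreasing_function: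
  fixes W :: "'n point \<Rightarrow> real"
  assumes W: "C1_with_derivative W W'" and Wper: "\<And>t x. W (t + T, x) = W (t, x)"
    and \<kappa>: "\<kappa> > 0" and r: "r > 0" and Wdecr: "\<And>q. W q < r \<Longrightarrow> 0 \<le> W q \<and> W' q (1, f q) \<le> - \<kappa> * W q"
    and x: "solves_ivp f p x" and p: "0 \<le> fst p" "r \<le> W p"
    and t1: "fst p \<le> t1" "W (t1, x t1) < r / 2"
  obtains V :: "'n point \<Rightarrow> real" and V'
  where "C1_with_derivative V V'" "\<And>x. V (0, x) = V (T, x)"
    "\<And>q. V' q (1, f q) \<le> 0" "V' p (1, f p) < 0"
proof -
  have Wc: "continuous_on UNIV W" by (rule C1_continuous[OF W])
  obtain t0 x0 where p_eq: "p = (t0, x0)" by (cases p)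
  have xc: "continuous_on {t0..t1} (\<lambda>t. W (t, x t))"
    using continuous_on_subset[OF solves_ivp_continuous[OF x], of "{t0..t1}"]
    by (intro continuous_on_compose2[OF Wc] continuous_intros) (auto simp: p_eq)
  have "x t0 = x0" using x by (simp add: solves_ivp_def p_eq)
  \<comment> \<open>The tube ends where the solution crosses the level \<open>r / 2\<close>, in the middle of the shell \<open>U\<close> on
    which \<open>W\<close> decreases at a definite rate.\<close>
  then have "\<exists>t. t0 \<le> t \<and> t \<le> t1 \<and> W (t, x t) = r / 2"
    using p t1 xc r by (intro IVT2') (auto simp: p_eq)
  then obtain te where te: "t0 \<le> te" "W (te, x te) = r / 2" by blast
  \<comment> \<open>Starting one period later leaves room for switching the tube function on at positive times; the
    sum over the translates by \<open>0, \<dots>, m\<close> periods then telescopes to the same value at times \<open>0\<close> and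
    \<open>T\<close>.\<close>
  define q0 where "q0 = (t0 + T, x0)"
  define y where "y t = x (t - T)" for t
  have y: "solves_ivp f q0 y"
    using solves_ivp_shift[where ?t0.0="t0 + T" and m="-1" and y=x, of x0] x
    by (simp add: q0_def y_def[abs_def] p_eq)
  define U where "U = {q. r / 4 < W q \<and> W q < 3 * r / 4}"
  have oU: "open U" unfolding U_def
    by (intro open_Collect_conj open_Collect_less continuous_on_const Wc)
  have inU: "(te + T, y (te + T)) \<in> U" using te r by (simp add: U_def y_def Wper)
  have q0: "0 < fst q0" "fst q0 \<le> te + T" using T_pos p te by (auto simp: q0_def p_eq)
  obtain V0 V0' and B H :: real where V0: "C1_with_derivative V0 V0'"
    "\<And>q. fst q \<le> 0 \<or> fst q \<ge> H \<Longrightarrow> V0 q = 0"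
    "\<And>q. q \<notin> U \<Longrightarrow> V0' q (1, f q) \<le> 0" "\<And>q. V0' q (1, f q) \<le> B" "V0' q0 (1, f q0) < 0"
    by (rule tube_function[OF y q0 oU inU]) (rule that, assumption+)
  have V0': "C1_with_derivative V0 V0'" by (rule V0)
  define tr where "tr k q = q + (real k * T, 0)" for k :: nat and q :: "'n point"
  have W_tr: "W (tr k q) = W q" for k q
    using periodic_of_int[where g="\<lambda>t. W (t, snd q)" and T=T, OF Wper, of "fst q" "int k"]
    by (cases q) (simp add: tr_def)
  have f_tr: "f (tr k q) = f q" for k q
    using f_periodic_int[of "fst q" "int k" "snd q"] by (cases q) (simp add: tr_def)
  obtain m :: nat where m: "real m > max 1 (H / T)" using reals_Archimedean2 by blast
  define B' where "B' = max 0 B"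
  define S where "S q = (\<Sum>k<Suc m. V0 (tr k q))" for q
  define S' where "S' q h = (\<Sum>k<Suc m. V0' (tr k q) h)" for q h
  have C1S: "C1_with_derivative S S'"
    unfolding S_def[abs_def] S'_def[abs_def] tr_def by (intro C1_sum C1_time_shift V0(1))
  have S_per: "S (0, x) = S (T, x)" for x
  proof -
    let ?g = "\<lambda>k. V0 (tr k (0, x))"
    have "S (T, x) = (\<Sum>k<Suc m. ?g (Suc k))"
      by (simp add: S_def tr_def algebra_simps)
    also have "\<dots> = (\<Sum>k<Suc m. ?g k) + ?g (Suc m) - ?g 0"
      using sum.lessThan_Suc_shift[of ?g "Suc m"] by simp
    also have "?g 0 = 0" by (intro V0(2)) (simp add: tr_def)
    also have "?g (Suc m) = 0"
    proof (intro V0(2) disjI2)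
      have "H \<le> real m * T" using m T_pos by (simp add: field_simps)
      also have "\<dots> \<le> real (Suc m) * T" using T_pos by simp
      finally show "fst (tr (Suc m) (0, x)) \<ge> H" by (simp add: tr_def)
    qed
    finally show ?thesis by (simp add: S_def)
  qed
  have summand: "V0' (tr k q) (1, f q) \<le> (if q \<in> U then B' else 0)" for k q
  proof -
    have "tr k q \<in> U \<longleftrightarrow> q \<in> U" by (simp add: U_def W_tr)
    then show ?thesis using V0(3,4)[of "tr k q"] by (auto simp: f_tr B'_def)
  qed
  have S'_bound: "S' q (1, f q) \<le> (if q \<in> U then real (Suc m) * B' else 0)" for q
  proof -
    have "S' q (1, f q) \<le> (\<Sum>k<Suc m. if q \<in> U then B' else 0)"
      unfolding S'_def by (intro sum_mono summand)
    then show ?thesis by (cases "q \<in> U") simp_all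
  qed
  define Q where "Q = 8 * (real (Suc m) * B') / (\<kappa> * r\<^sup>2)"
  have Q: "Q \<ge> 0" "Q * (\<kappa> * r\<^sup>2 / 8) = real (Suc m) * B'" using \<kappa> r by (auto simp: Q_def B'_def)
  define P where "P q = - sq_pos_part (r - W q)" for q
  define P' where "P' q h = 2 * max 0 (r - W q) * W' q h" for q h
  have C1P: "C1_with_derivative P P'"
    unfolding P_def[abs_def] P'_def[abs_def]
  proof (rule C1_compose_real[OF W])
    show "((\<lambda>y. - sq_pos_part (r - y)) has_real_derivative 2 * max 0 (r - y)) (at y)" for y
      by (rule derivative_eq_intros DERIV_chain2[where f=sq_pos_part, OF sq_pos_part_deriv] refl)+ simp
    show "continuous_on UNIV (\<lambda>y. 2 * max 0 (r - y))" by (intro continuous_intros)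
  qed
  have P'_nonpos: "P' q (1, f q) \<le> 0" for q
  proof (cases "W q < r")
    case True
    then have "- \<kappa> * W q \<le> 0" using Wdecr[OF True] \<kappa> by (simp add: mult_nonneg_nonneg)
    then have "W' q (1, f q) \<le> 0" using Wdecr[OF True] by linarith
    then show ?thesis unfolding P'_def by (intro mult_nonneg_nonpos) auto
  qed (simp add: P'_def)
  have P'_U: "P' q (1, f q) \<le> - (\<kappa> * r\<^sup>2 / 8)" if "q \<in> U" for q
  proof -
    have w: "r / 4 < W q" "W q < 3 * r / 4" using that by (auto simp: U_def)
    then have "W' q (1, f q) \<le> - (\<kappa> * W q)" using Wdecr[of q] r by simp
    also have "\<dots> \<le> - (\<kappa> * (r / 4))" using w \<kappa> by simp
    finally have "2 * (r - W q) * W' q (1, f q) \<le> 2 * (r - W q) * - (\<kappa> * (r / 4))"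
      using w r by (intro mult_left_mono) auto
    also have "\<dots> \<le> 2 * (r / 4) * - (\<kappa> * (r / 4))"
      using w r \<kappa> by (intro mult_right_mono_neg) auto
    also have "\<dots> = - (\<kappa> * r\<^sup>2 / 8)" by (simp add: power2_eq_square)
    finally show ?thesis using w r by (simp add: P'_def max_def)
  qed
  show thesis
  proof (rule that[of "\<lambda>q. S q + Q * P q" "\<lambda>q h. S' q h + Q * P' q h"])
    show "C1_with_derivative (\<lambda>q. S q + Q * P q) (\<lambda>q h. S' q h + Q * P' q h)"
      by (intro C1_add C1_cmult C1S C1P)
    show "S (0, x) + Q * P (0, x) = S (T, x) + Q * P (T, x)" for x
      using Wper[of 0 x] by (simp add: S_per P_def)
    show "S' q (1, f q) + Q * P' q (1, f q) \<le> 0" for q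
    proof (cases "q \<in> U")
      case True
      have "Q * P' q (1, f q) \<le> Q * - (\<kappa> * r\<^sup>2 / 8)" by (intro mult_left_mono P'_U True Q)
      then show ?thesis using S'_bound[of q] True Q(2) by simp
    next
      case False
      then show ?thesis using S'_bound[of q] mult_nonneg_nonpos[OF Q(1) P'_nonpos[of q]] by simp
    qed
    show "S' p (1, f p) + Q * P' p (1, f p) < 0"
    proof -
      have pU: "p \<notin> U" using p r by (simp add: U_def)
      have "tr 1 p = q0" by (simp add: tr_def q0_def p_eq)
      then have "V0' (tr 1 p) (1, f p) < 0" using V0(5) f_tr[of 1 p] by simp
      moreover have "1 \<in> {..<Suc m}" using m by simp
      ultimately have "S' p (1, f p) < (\<Sum>k<Suc m. 0)"
        unfolding S'_def using summand[of _ p] pU by (intro sum_strict_mono_ex1) auto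
      then show ?thesis using mult_nonneg_nonpos[OF Q(1) P'_nonpos[of p]] by simp
    qed
  qed
qed

text \<open>Orbital derivatives are continuous, so each local function decreases on a neighbourhood of its
  point; the sum over a finite subcover decreases on the whole compact set since no summand increases.\<close>

lemma compact_lyapunov_function:
  assumes K: "compact K"
    and loc: "\<And>p. p \<in> K \<Longrightarrow> \<exists>V V'. C1_with_derivative V V' \<and> (\<forall>x. V (0, x) = V (T, x)) \<and>
      (\<forall>q. V' q (1, f q) \<le> 0) \<and> V' p (1, f p) < (0::real)"
  obtains V V' and \<kappa> :: real where "C1_with_derivative V V'" "\<And>x. V (0, x) = V (T, x)"
    "\<And>q. V' q (1, f q) \<le> 0" "\<kappa> > 0" "\<And>p. p \<in> K \<Longrightarrow> V' p (1, f p) \<le> - \<kappa>"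
proof -
  obtain V V' where V: "\<And>p. p \<in> K \<Longrightarrow> C1_with_derivative (V p) (V' p)"
    "\<And>p x. p \<in> K \<Longrightarrow> V p (0, x) = V p (T, x)"
    "\<And>p q. p \<in> K \<Longrightarrow> V' p q (1, f q) \<le> 0" "\<And>p. p \<in> K \<Longrightarrow> V' p p (1, f p) < (0::real)"
    using loc by metis
  define U where "U p = {q. V' p q (1, f q) < 0}" for p
  have "open (U p)" if "p \<in> K" for p
    unfolding U_def
    by (intro open_Collect_less C1_orbital_derivative_continuous[OF V(1)[OF that]] continuous_on_const)
  moreover have "K \<subseteq> (\<Union>p\<in>K. U p)" using V(4) by (auto simp: U_def)
  ultimately obtain D where D: "D \<subseteq> K" "finite D" "K \<subseteq> (\<Union>p\<in>D. U p)"
    using compactE_image[OF K, of K U] by blast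
  define S where "S q = (\<Sum>p\<in>D. V p q)" for q
  define S' where "S' q h = (\<Sum>p\<in>D. V' p q h)" for q h
  have C1S: "C1_with_derivative S S'"
    unfolding S_def[abs_def] S'_def[abs_def] using D(1) by (intro C1_sum V(1)) auto
  have S_per: "S (0, x) = S (T, x)" for x
    unfolding S_def using D(1) V(2) by (intro sum.cong) auto
  have S'_nonpos: "S' q (1, f q) \<le> 0" for q
    unfolding S'_def using D(1) by (intro sum_nonpos V(3)) auto
  have S'_neg: "S' q (1, f q) < 0" if q: "q \<in> K" for q
  proof -
    obtain p where p: "p \<in> D" "V' p q (1, f q) < 0" using D(3) q by (auto simp: U_def)
    have "S' q (1, f q) < (\<Sum>p\<in>D. 0)"
      unfolding S'_def
    proof (rule sum_strict_mono_ex1[OF D(2)])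
      show "\<forall>p\<in>D. V' p q (1, f q) \<le> 0" using D(1) by (intro ballI V(3)) auto
      show "\<exists>p\<in>D. V' p q (1, f q) < 0" using p by blast
    qed
    then show ?thesis by simp
  qed
  show thesis
  proof (cases "K = {}")
    case False
    have "continuous_on K (\<lambda>q. S' q (1, f q))"
      using C1_orbital_derivative_continuous[OF C1S] continuous_on_subset by blast
    then obtain q where q: "q \<in> K" "\<And>p. p \<in> K \<Longrightarrow> S' p (1, f p) \<le> S' q (1, f q)"
      using continuous_attains_sup[OF K False] by blast
    show thesis
      by (rule that[of S S' "- S' q (1, f q)"]) (use C1S S_per S'_nonpos S'_neg[OF q(1)] q(2) in auto)
  qed (use that[of S S' 1] C1S S_per S'_nonpos in auto)
qed

end

context stable_periodic_solution
begin

lemma basin_solution_approaches_orbit: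
  assumes "cyl T p \<in> basin T f orbit" and "e > 0"
  obtains x t1 where "solves_ivp f p x" "fst p \<le> t1" "norm (x t1 - u t1) < e"
proof -
  obtain q where q: "cyl T q = cyl T p"
    and lim: "((\<lambda>\<theta>. infdist (cyl T (flow f \<theta> q)) orbit) \<longlongrightarrow> 0) at_top"
    using assms(1) unfolding basin_def by auto
  obtain m :: int where m: "p = (fst q + of_int m * T, snd q)" by (rule cyl_eqD[OF T_pos q])
  obtain y where y: "solves_ivp f q y" using solution_exists by blast
  obtain b where b: "b > 0" "\<And>t x. norm (x - u t) \<le> b * infdist (cyl T (t, x)) orbit"
    using norm_diff_le_infdist_orbit by blast
  define x where "x t = y (t + of_int (- m) * T)" for t
  have x: "solves_ivp f p x"
    unfolding m x_def by (rule solves_ivp_shift) (use y in simp)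
  have "e / b > 0" using assms(2) b by simp
  with lim have "\<forall>\<^sub>F \<theta> in at_top. infdist (cyl T (flow f \<theta> q)) orbit < e / b"
    by (auto simp: order_tendsto_iff)
  then have "\<exists>\<theta>. 0 \<le> \<theta> \<and> infdist (cyl T (flow f \<theta> q)) orbit < e / b"
    by (intro eventually_happens'[OF trivial_limit_at_top_linorder] eventually_conj eventually_ge_at_top)
  then obtain \<theta> where \<theta>: "\<theta> \<ge> 0" "infdist (cyl T (flow f \<theta> q)) orbit < e / b" by blast
  have "norm (y (fst q + \<theta>) - u (fst q + \<theta>)) \<le> b * infdist (cyl T (fst q + \<theta>, y (fst q + \<theta>))) orbit"
    by (rule b(2))
  also have "\<dots> < b * (e / b)"
    using \<theta>(2) b(1) unfolding flow_eq[OF y \<theta>(1)] by (rule mult_strict_left_mono)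
  finally have "norm (y (fst q + \<theta>) - u (fst q + \<theta>)) < e" using b(1) by simp
  moreover have "u (fst q + \<theta>) = u (fst p + \<theta>)"
    using u_periodic_int[of "fst q + \<theta>" m] m by (metis add.assoc add.commute fst_conv)
  moreover have "y (fst q + \<theta>) = x (fst p + \<theta>)" by (subst m) (simp add: x_def)
  ultimately show thesis using that[OF x, of "fst p + \<theta>"] \<theta>(1) by simp
qed

end

section \<open>A contraction metric\<close>

lemma quadratic_form_entry_bound:
  fixes X :: "real ^ 'n::finite ^ 'n"
  assumes "\<And>i j. \<bar>X $ i $ j\<bar> \<le> b"
  shows "\<bar>v \<bullet> (X *v v)\<bar> \<le> (real CARD('n))\<^sup>2 * b * (norm v)\<^sup>2"
proof -
  have "v \<bullet> (X *v v) = (\<Sum>i\<in>UNIV. \<Sum>j\<in>UNIV. v $ i * (X $ i $ j * v $ j))"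
    by (simp add: inner_vec_def matrix_vector_mult_def sum_distrib_left)
  also have "\<bar>\<dots>\<bar> \<le> (\<Sum>i\<in>UNIV. \<bar>\<Sum>j\<in>UNIV. v $ i * (X $ i $ j * v $ j)\<bar>)" by (rule sum_abs)
  also have "\<dots> \<le> (\<Sum>i\<in>(UNIV::'n set). \<Sum>j\<in>(UNIV::'n set). norm v * (b * norm v))"
  proof (intro sum_mono order_trans[OF sum_abs])
    fix i j
    have "b \<ge> 0" using assms[of i j] by linarith
    then show "\<bar>v $ i * (X $ i $ j * v $ j)\<bar> \<le> norm v * (b * norm v)"
      unfolding abs_mult by (intro mult_mono assms component_le_norm_cart) auto
  qed
  also have "\<dots> = (real CARD('n))\<^sup>2 * b * (norm v)\<^sup>2" by (simp add: power2_eq_square)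
  finally show ?thesis .
qed

lemma compact_family_bounded:
  fixes g :: "'i::finite \<Rightarrow> 'a::topological_space \<Rightarrow> 'b::real_normed_vector"
  assumes "compact N" "\<And>i. continuous_on N (g i)"
  obtains b where "b > 0" "\<And>i p. p \<in> N \<Longrightarrow> norm (g i p) \<le> b"
proof -
  have "compact (\<Union>i. g i ` N)"
    using assms by (intro compact_UN compact_continuous_image) auto
  then obtain b where "b > 0" "\<And>y. y \<in> (\<Union>i. g i ` N) \<Longrightarrow> norm y \<le> b"
    using compact_imp_bounded bounded_pos by metis
  then show thesis using that[of b] by blast
qed

context stable_periodic_solution
begin

text \<open>The metric is \<open>exp (\<lambda> V)\<close> times the Lyapunov matrix of the orbit. Near the orbit that matrix
  already contracts, and the factor does no harm since \<open>V\<close> does not increase; elsewhere \<open>V\<close> strictly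
  decreases, and a large \<open>\<lambda>\<close> outweighs any expansion by the linearized flow.\<close>

lemma contraction_metric:
  assumes K: "compact K" "K \<subseteq> {0..T} \<times> UNIV" "\<And>p. p \<in> K \<Longrightarrow> cyl T p \<in> basin T f orbit"
    and N: "compact N" and \<epsilon>0: "\<epsilon>0 > 0"
  obtains M :: "'n point \<Rightarrow> real ^ 'n ^ 'n" and M'
  where "\<And>i j. C1_with_derivative (\<lambda>p. M p $ i $ j) (\<lambda>p q. M' p q $ i $ j)"
    "\<And>p. transpose (M p) = M p" "\<And>x. M (0, x) = M (T, x)"
    "\<And>p v. p \<in> N \<Longrightarrow> \<epsilon>0 * (norm v)\<^sup>2 \<le> v \<bullet> (M p *v v)"
    "\<And>p v. p \<in> K \<Longrightarrow> v \<bullet> (M' p (1, f p) *v v) + 2 * (v \<bullet> (M p *v (Dx f p *v v))) \<le> - 3 * (norm v)\<^sup>2"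
proof -
  obtain L L' \<mu> m \<kappa> r W W' where pos: "\<mu> > 0" "m > 0" "\<kappa> > 0" "r > 0"
    and Lder: "\<And>t. (L has_vector_derivative L' t) (at t)" and L'c: "continuous_on UNIV L'"
    and Lper: "\<And>t. L (t + T) = L t" and Lsym: "\<And>t. transpose (L t) = L t"
    and Lpos: "\<And>t v. \<mu> * (norm v)\<^sup>2 \<le> v \<bullet> (L t *v v)"
    and W: "C1_with_derivative W W'" and Wper: "\<And>t x. W (t + T, x) = W (t, x)"
    and Wlow: "\<And>t x. \<mu> * (norm (x - u t))\<^sup>2 \<le> W (t, x)"
    and Wupp: "\<And>t x. W (t, x) \<le> m * (norm (x - u t))\<^sup>2"
    and Wdecr: "\<And>p. W p < r \<Longrightarrow> W' p (1, f p) \<le> - \<kappa> * W p"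
    and Lnear: "\<And>p v. W p < r \<Longrightarrow>
       v \<bullet> (L' (fst p) *v v) + 2 * (v \<bullet> (L (fst p) *v (Dx f p *v v))) \<le> - (norm v)\<^sup>2 / 4"
    by (rule orbit_lyapunov_function) (rule that, assumption+)
  have Lc: "continuous_on UNIV L"
    using Lder by (intro continuous_at_imp_continuous_on ballI has_vector_derivative_continuous)
  have W_nonneg: "0 \<le> W p" for p
    using Wlow[of "snd p" "fst p"] pos(1) by (cases p) (auto intro: order_trans[rotated])
  define K1 where "K1 = K \<inter> {p. r \<le> W p}"
  have "closed {p. r \<le> W p}" by (intro closed_Collect_le continuous_on_const C1_continuous[OF W])
  then have "compact K1" unfolding K1_def using K(1) by blast
  then obtain V V' and \<kappa>' :: real where V: "C1_with_derivative V V'" and Vper: "\<And>x. V (0, x) = V (T, x)"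
    and Vle: "\<And>q. V' q (1, f q) \<le> 0" and \<kappa>': "\<kappa>' > 0" and Vless: "\<And>p. p \<in> K1 \<Longrightarrow> V' p (1, f p) \<le> - \<kappa>'"
  proof (rule compact_lyapunov_function)
    fix p assume "p \<in> K1"
    then have p: "p \<in> K" "r \<le> W p" by (auto simp: K1_def)
    have "0 < sqrt (r / (2 * m))" using pos by simp
    then obtain x t1 where x: "solves_ivp f p x" "fst p \<le> t1" "norm (x t1 - u t1) < sqrt (r / (2 * m))"
      by (rule basin_solution_approaches_orbit[OF K(3)[OF p(1)]])
    have "(norm (x t1 - u t1))\<^sup>2 < (sqrt (r / (2 * m)))\<^sup>2"
      using x(3) by (intro power_strict_mono) auto
    then have "m * (norm (x t1 - u t1))\<^sup>2 < r / 2" using pos by (simp add: field_simps)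
    then have W1: "W (t1, x t1) < r / 2" using Wupp[of t1 "x t1"] by linarith
    have p0: "0 \<le> fst p" using K(2) p(1) by auto
    have Wd: "0 \<le> W q \<and> W' q (1, f q) \<le> - \<kappa> * W q" if "W q < r" for q
      using W_nonneg Wdecr[OF that] by blast
    obtain V :: "'n point \<Rightarrow> real" and V' where "C1_with_derivative V V'" "\<And>x. V (0, x) = V (T, x)"
      "\<And>q. V' q (1, f q) \<le> 0" "V' p (1, f p) < 0"
      by (rule periodic_decreasing_function[OF W Wper pos(3,4) Wd x(1) p0 p(2) x(2) W1])
        (assumption, rule that, assumption+)
    then show "\<exists>V V'. C1_with_derivative V V' \<and> (\<forall>x. V (0, x) = V (T, x)) \<and>
      (\<forall>q. V' q (1, f q) \<le> 0) \<and> V' p (1, f p) < (0::real)" by blast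
  qed (rule that)

  define X where "X p = L' (fst p) + 2 *\<^sub>R (L (fst p) ** Dx f p)" for p
  have Xq: "v \<bullet> (X p *v v) = v \<bullet> (L' (fst p) *v v) + 2 * (v \<bullet> (L (fst p) *v (Dx f p *v v)))" for p v
    by (simp add: X_def matrix_vector_mult_add_rdistrib inner_add_right scaleR_matrix_vector_assoc[symmetric]
        matrix_vector_mul_assoc)
  have "continuous_on UNIV (\<lambda>p. X p $ i $ j)" for i j
    unfolding X_def matrix_matrix_mult_def
    by (simp, intro continuous_intros Dx_continuous continuous_on_compose2[OF L'c] continuous_on_compose2[OF Lc])
      auto
  then have Xc: "continuous_on K (\<lambda>p. X p $ fst ij $ snd ij)" for ij
    using continuous_on_subset by blast
  obtain b where b: "b > 0" "\<And>ij p. p \<in> K \<Longrightarrow> norm (X p $ fst ij $ snd ij) \<le> b"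
    by (rule compact_family_bounded[OF K(1) Xc]) (rule that, assumption+)
  define c1 where "c1 = (real CARD('n))\<^sup>2 * b"
  have Xbd: "v \<bullet> (X p *v v) \<le> c1 * (norm v)\<^sup>2" if "p \<in> K" for p v
    using quadratic_form_entry_bound[of "X p" b v] b(2)[OF that, of "(_, _)"] by (simp add: c1_def)
  \<comment> \<open>Away from the orbit \<open>\<lambda> V' L\<close> contributes at most \<open>- \<lambda> \<kappa>' \<mu> = - (c1 + 1)\<close>, against an
    expansion of at most \<open>c1\<close>.\<close>
  define lam where "lam = (c1 + 1) / (\<kappa>' * \<mu>)"
  have lam: "lam \<ge> 0" "lam * \<kappa>' * \<mu> = c1 + 1"
    using \<kappa>' pos(1) b(1) by (auto simp: lam_def c1_def)
  have bracket: "lam * V' p (1, f p) * (v \<bullet> (L (fst p) *v v)) + v \<bullet> (X p *v v) \<le> - (norm v)\<^sup>2 / 4"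
    if p: "p \<in> K" for p v
  proof (cases "W p < r")
    case True
    have "0 \<le> v \<bullet> (L (fst p) *v v)"
      using Lpos[of v "fst p"] pos(1) by (auto intro: order_trans[rotated])
    then have "lam * V' p (1, f p) * (v \<bullet> (L (fst p) *v v)) \<le> 0"
      using lam(1) Vle[of p] by (intro mult_nonpos_nonneg mult_nonneg_nonpos)
    then show ?thesis using Lnear[OF True, of v] Xq[of v p] by simp
  next
    case False
    then have "p \<in> K1" using p by (simp add: K1_def)
    have "lam * V' p (1, f p) * (v \<bullet> (L (fst p) *v v)) \<le> lam * - \<kappa>' * (v \<bullet> (L (fst p) *v v))"
      using lam(1) Vless[OF \<open>p \<in> K1\<close>] Lpos[of v "fst p"] pos(1)
      by (intro mult_right_mono mult_left_mono) (auto intro: order_trans[rotated])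
    also have "\<dots> \<le> lam * - \<kappa>' * (\<mu> * (norm v)\<^sup>2)"
      using lam(1) \<kappa>' by (intro mult_left_mono_neg Lpos) (simp add: mult_nonneg_nonneg)
    also have "\<dots> = - (lam * \<kappa>' * \<mu>) * (norm v)\<^sup>2" by simp
    also have "\<dots> = - (c1 + 1) * (norm v)\<^sup>2" unfolding lam(2) ..
    also have "\<dots> = - (c1 * (norm v)\<^sup>2) - (norm v)\<^sup>2" by (simp add: algebra_simps)
    finally show ?thesis using Xbd[OF p, of v] zero_le_power2[of "norm v"] by linarith
  qed

  have "compact (K \<union> N)" using K(1) N by blast
  moreover have "continuous_on (K \<union> N) V" using C1_continuous[OF V] continuous_on_subset by blast
  ultimately obtain a where a: "a > 0" "\<And>i::unit. \<And>p. p \<in> K \<union> N \<Longrightarrow> norm (V p) \<le> a"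
    by (rule compact_family_bounded[where g="\<lambda>_::unit. V"]) (rule that, assumption+)
  define e where "e = exp (- lam * a)"
  have e: "e > 0" by (simp add: e_def)
  have expV: "e \<le> exp (lam * V p)" if "p \<in> K \<union> N" for p
  proof -
    have "lam * - a \<le> lam * V p" using a(2)[OF that] lam(1) by (intro mult_left_mono) auto
    then show ?thesis by (simp add: e_def)
  qed
  \<comment> \<open>The factor \<open>12\<close> turns the margin \<open>1 / 4\<close> of the bracket into \<open>3\<close>: one unit is required by the
    problem, the others are left for the interpolation error and the error term.\<close>
  define c where "c = max (12 / e) (\<epsilon>0 / (e * \<mu>))"
  have c: "c > 0" "12 \<le> c * e" "\<epsilon>0 \<le> c * e * \<mu>"
  proof -
    have "12 / e \<le> c" "\<epsilon>0 / (e * \<mu>) \<le> c" by (auto simp: c_def)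
    then show "12 \<le> c * e" "\<epsilon>0 \<le> c * e * \<mu>" using e pos(1) by (auto simp: field_simps)
    show "c > 0" using e by (simp add: c_def less_max_iff_disj)
  qed
  define M where "M p = (c * exp (lam * V p)) *\<^sub>R L (fst p)" for p
  define M' where "M' p q = (c * exp (lam * V p)) *\<^sub>R ((lam * V' p q) *\<^sub>R L (fst p) + fst q *\<^sub>R L' (fst p))" for p q
  have C1e: "C1_with_derivative (\<lambda>p. exp (lam * V p)) (\<lambda>p q. exp (lam * V p) * (lam * V' p q))"
    by (rule C1_compose_real[OF C1_cmult[OF V]]) (auto intro!: derivative_eq_intros continuous_intros)
  have Lent: "((\<lambda>t. L t $ i $ j) has_vector_derivative L' t $ i $ j) (at t)" for t i j
    using bounded_linear.has_vector_derivative[OF bounded_linear_vec_nth[of j]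
        bounded_linear.has_vector_derivative[OF bounded_linear_vec_nth[of i] Lder[of t]]] .
  show thesis
  proof (rule that[of M M'])
    show "C1_with_derivative (\<lambda>p. M p $ i $ j) (\<lambda>p q. M' p q $ i $ j)" for i j
    proof -
      have "C1_with_derivative (\<lambda>p. (c * exp (lam * V p)) * (L (fst p) $ i $ j))
          (\<lambda>p q. (c * exp (lam * V p)) * (fst q *\<^sub>R (L' (fst p) $ i $ j))
            + (c * (exp (lam * V p) * (lam * V' p q))) * (L (fst p) $ i $ j))"
        by (intro C1_mult C1_cmult C1e C1_of_time[where h="\<lambda>t. L t $ i $ j"] Lent
            continuous_on_component L'c)
      then show ?thesis by (simp add: M_def[abs_def] M'_def[abs_def] algebra_simps)
    qed
    show "transpose (M p) = M p" for p
      using Lsym[of "fst p"] by (simp add: M_def transpose_scalar)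
    show "M (0, x) = M (T, x)" for x using Lper[of 0] by (simp add: M_def Vper)
    show "\<epsilon>0 * (norm v)\<^sup>2 \<le> v \<bullet> (M p *v v)" if "p \<in> N" for p v
    proof -
      have "\<epsilon>0 * (norm v)\<^sup>2 \<le> c * e * \<mu> * (norm v)\<^sup>2" by (intro mult_right_mono c) auto
      also have "\<dots> = (c * e) * (\<mu> * (norm v)\<^sup>2)" by simp
      also have "\<dots> \<le> (c * exp (lam * V p)) * (v \<bullet> (L (fst p) *v v))"
        using that c(1) e pos(1) by (intro mult_mono mult_left_mono expV Lpos) auto
      also have "\<dots> = v \<bullet> (M p *v v)" by (simp add: M_def scaleR_matrix_vector_assoc[symmetric])
      finally show ?thesis .
    qed
    show "v \<bullet> (M' p (1, f p) *v v) + 2 * (v \<bullet> (M p *v (Dx f p *v v))) \<le> - 3 * (norm v)\<^sup>2"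
      if p: "p \<in> K" for p v
    proof -
      have "v \<bullet> (M' p (1, f p) *v v) + 2 * (v \<bullet> (M p *v (Dx f p *v v)))
          = (c * exp (lam * V p)) * (lam * V' p (1, f p) * (v \<bullet> (L (fst p) *v v)) + v \<bullet> (X p *v v))"
        unfolding Xq
        by (simp add: M_def M'_def scaleR_matrix_vector_assoc[symmetric] matrix_vector_mult_add_rdistrib
            inner_add_right algebra_simps)
      also have "\<dots> \<le> (c * exp (lam * V p)) * (- (norm v)\<^sup>2 / 4)"
        using c(1) by (intro mult_left_mono bracket p) auto
      also have "\<dots> \<le> (c * e) * (- (norm v)\<^sup>2 / 4)"
        using c(1) expV[of p] p by (intro mult_right_mono_neg mult_left_mono) auto
      also have "\<dots> \<le> 12 * (- (norm v)\<^sup>2 / 4)" by (intro mult_right_mono_neg c) auto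
      finally show ?thesis by simp
    qed
  qed
qed

end

section \<open>Geometry of the triangulation\<close>

text \<open>The signed length, in multiples of \<open>\<rho>\<close>, of the edges parallel to the given coordinate axis in a
  simplex reflected by \<open>J\<close>.\<close>

definition edge_factor :: "real ^ 'n \<Rightarrow> 'n::finite set \<Rightarrow> 'n option \<Rightarrow> real" where
  "edge_factor s J l = (case l of None \<Rightarrow> 1 | Some i \<Rightarrow> (- 1) ^ of_bool (i \<in> J) * s $ i)"

lemma grid_vertex_Suc:
  "grid_vertex \<rho> s z J \<sigma> (Suc k)
    = grid_vertex \<rho> s z J \<sigma> k + (\<rho> * edge_factor s J (\<sigma> ! k)) *\<^sub>R unit_vec (\<sigma> ! k)"
  by (cases "\<sigma> ! k")
    (auto simp: grid_vertex_def stretch_def reflect_def unit_vec_def edge_factor_def prod_eq_iff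
      vec_eq_iff axis_def algebra_simps)

definition scale_bound :: "real ^ 'n::finite \<Rightarrow> real" where
  "scale_bound s = 1 + (\<Sum>i\<in>UNIV. \<bar>s $ i\<bar>)"

lemma edge_factor_nonzero: "\<forall>i. s $ i > 0 \<Longrightarrow> edge_factor s J l \<noteq> 0"
  by (auto simp: edge_factor_def split: option.split) (metis less_irrefl)

lemma abs_edge_factor_le: "\<bar>edge_factor s J l\<bar> \<le> scale_bound s"
proof (cases l)
  case (Some i)
  have "\<bar>s $ i\<bar> \<le> (\<Sum>i\<in>UNIV. \<bar>s $ i\<bar>)" by (intro member_le_sum) auto
  then show ?thesis using Some by (simp add: edge_factor_def scale_bound_def abs_mult)
qed (simp add: edge_factor_def scale_bound_def sum_nonneg)

lemma scale_bound_pos: "scale_bound s > 0"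
  unfolding scale_bound_def by (intro add_pos_nonneg sum_nonneg) auto

lemma grid_vertex_dist:
  assumes "\<rho> \<ge> 0"
  shows "norm (grid_vertex \<rho> s z J \<sigma> k - grid_vertex \<rho> s z J \<sigma> 0) \<le> real k * (\<rho> * scale_bound s)"
proof (induction k)
  case (Suc k)
  have "grid_vertex \<rho> s z J \<sigma> (Suc k) - grid_vertex \<rho> s z J \<sigma> 0
      = (grid_vertex \<rho> s z J \<sigma> k - grid_vertex \<rho> s z J \<sigma> 0)
        + (\<rho> * edge_factor s J (\<sigma> ! k)) *\<^sub>R unit_vec (\<sigma> ! k)"
    by (simp add: grid_vertex_Suc)
  also have "norm \<dots> \<le> real k * (\<rho> * scale_bound s) + \<rho> * \<bar>edge_factor s J (\<sigma> ! k)\<bar>"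
    using Suc assms by (intro norm_triangle_mono) (auto simp: norm_unit_vec abs_mult)
  also have "\<dots> \<le> real k * (\<rho> * scale_bound s) + \<rho> * scale_bound s"
    using assms by (intro add_left_mono mult_left_mono abs_edge_factor_le)
  finally show ?case by (simp add: algebra_simps)
qed simp

lemma row_vertex_bij:
  "bij_betw (row_vertex :: 'n::finite option \<Rightarrow> nat) UNIV {Suc 0..CARD('n) + 1}"
proof -
  have 1: "bij_betw (to_nat_on (UNIV :: 'n option set)) UNIV {..<CARD('n) + 1}"
    using to_nat_on_finite[of "UNIV :: 'n option set"] by simp
  have "bij_betw Suc {..<CARD('n) + 1} {Suc 0..CARD('n) + 1}"
  proof (rule bij_betw_imageI)
    show "Suc ` {..<CARD('n) + 1} = {Suc 0..CARD('n) + 1}"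
      using image_Suc_lessThan[of "CARD('n) + 1"] by simp
  qed simp
  from bij_betw_trans[OF 1 this] show ?thesis
    by (simp add: row_vertex_def[abs_def] o_def)
qed

lemma row_vertex_bounds: "0 < row_vertex (r :: 'n::finite option)" "row_vertex r \<le> CARD('n) + 1"
  using bij_betwE[OF row_vertex_bij[where 'n='n]] by (auto simp: Suc_le_eq)

lemma matrix_inv_mult_left:
  assumes "invertible A"
  shows "matrix_inv A ** A = mat 1"
  using someI_ex[OF assms[unfolded invertible_def]] unfolding matrix_inv_def by blast

locale grid_simplex =
  fixes \<rho> :: real and s :: "real ^ 'n::finite" and z J \<sigma> \<nu>
  assumes \<rho>: "\<rho> > 0" and s: "\<forall>i. s $ i > 0"
    and \<sigma>: "distinct \<sigma>" "set \<sigma> = (UNIV :: 'n option set)"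
    and \<nu>: "\<nu> = map (grid_vertex \<rho> s z J \<sigma>) [0..<CARD('n) + 2]"
begin

lemma length_\<sigma>: "length \<sigma> = CARD('n) + 1"
  using distinct_card[OF \<sigma>(1)] \<sigma>(2) by simp

lemma nth_\<nu>: "k \<le> CARD('n) + 1 \<Longrightarrow> \<nu> ! k = grid_vertex \<rho> s z J \<sigma> k"
  by (simp add: \<nu> del: upt_Suc)

lemma set_\<nu>: "set \<nu> = grid_vertex \<rho> s z J \<sigma> ` {..CARD('n) + 1}"
  by (auto simp: \<nu> simp del: upt_Suc)

lemma vertex_in_hull: "k \<le> CARD('n) + 1 \<Longrightarrow> grid_vertex \<rho> s z J \<sigma> k \<in> convex hull set \<nu>"
  by (intro hull_inc) (auto simp: set_\<nu>)

abbreviation diam_bound :: real where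
  "diam_bound \<equiv> \<rho> * (2 * (real CARD('n) + 1) * scale_bound s)"

lemma hull_dist:
  assumes "p \<in> convex hull set \<nu>" "q \<in> convex hull set \<nu>"
  shows "norm (p - q) \<le> diam_bound"
proof -
  let ?v = "grid_vertex \<rho> s z J \<sigma> 0" and ?d = "(real CARD('n) + 1) * (\<rho> * scale_bound s)"
  have "set \<nu> \<subseteq> cball ?v ?d"
  proof
    fix p assume "p \<in> set \<nu>"
    then obtain k where k: "k \<le> CARD('n) + 1" "p = grid_vertex \<rho> s z J \<sigma> k" by (auto simp: set_\<nu>)
    have "norm (p - ?v) \<le> real k * (\<rho> * scale_bound s)"
      unfolding k(2) using \<rho> by (intro grid_vertex_dist) simp
    also have "\<dots> \<le> ?d"
      using k(1) \<rho> scale_bound_pos[of s] by (intro mult_right_mono) auto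
    finally show "p \<in> cball ?v ?d" by (simp add: dist_norm norm_minus_commute)
  qed
  then have "convex hull set \<nu> \<subseteq> cball ?v ?d" by (intro hull_minimal) auto
  then have "p \<in> cball ?v ?d" "q \<in> cball ?v ?d" using assms by blast+
  then have "dist p ?v \<le> ?d" "dist q ?v \<le> ?d" by (simp_all add: dist_commute)
  then have "dist p q \<le> ?d + ?d" using dist_triangle2[of p q ?v] by linarith
  also have "?d + ?d = diam_bound" by simp
  finally show ?thesis by (simp add: dist_norm)
qed

lemma h_const_bounds: "0 \<le> h_const \<nu>" "h_const \<nu> \<le> diam_bound"
proof -
  have "bounded (convex hull set \<nu>)"
    by (intro bounded_convex_hull finite_imp_bounded finite_set)
  then show "0 \<le> h_const \<nu>" unfolding h_const_def by (rule diameter_ge_0)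
  show "h_const \<nu> \<le> diam_bound"
    unfolding h_const_def using \<rho> scale_bound_pos[of s]
    by (intro diameter_le hull_dist) auto
qed

text \<open>Consecutive vertices differ in exactly one coordinate, so the gradient of the affine
  interpolant of a function consists of difference quotients along the edges, which by the mean
  value theorem are partial derivatives at points of the simplex.\<close>

lemma X_mat_row_mult:
  "(X_mat \<nu> *v g) $ r = (\<Sum>k<row_vertex r. \<rho> * edge_factor s J (\<sigma> ! k) * g $ (\<sigma> ! k))"
proof -
  have tele: "coords (grid_vertex \<rho> s z J \<sigma> m - grid_vertex \<rho> s z J \<sigma> 0) \<bullet> g
      = (\<Sum>k<m. \<rho> * edge_factor s J (\<sigma> ! k) * g $ (\<sigma> ! k))" for m
  proof (induction m)
    case 0
    show ?case using coords_diff[of "0 :: 'n point" 0] by simp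
  next
    case (Suc m)
    have "coords (grid_vertex \<rho> s z J \<sigma> (Suc m) - grid_vertex \<rho> s z J \<sigma> 0)
        = coords (grid_vertex \<rho> s z J \<sigma> m - grid_vertex \<rho> s z J \<sigma> 0)
          + (\<rho> * edge_factor s J (\<sigma> ! m)) *\<^sub>R axis (\<sigma> ! m) 1"
      by (simp add: grid_vertex_Suc coords_diff coords_add coords_scaleR coords_unit_vec)
    then show ?case using Suc by (simp add: inner_add_left inner_axis')
  qed
  show ?thesis
    using tele[of "row_vertex r"] row_vertex_bounds[of r]
    by (simp add: X_mat_def matrix_vector_mult_def inner_vec_def nth_\<nu>)
qed

lemma w_vec_eq:
  assumes g: "\<And>k. k < Suc CARD('n) \<Longrightarrow> g $ (\<sigma> ! k)
    = (M (grid_vertex \<rho> s z J \<sigma> (Suc k)) - M (grid_vertex \<rho> s z J \<sigma> k)) $ i $ j / (\<rho> * edge_factor s J (\<sigma> ! k))"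
  shows "w_vec M \<nu> i j = g"
proof -
  let ?v = "grid_vertex \<rho> s z J \<sigma>"
  have nz: "\<rho> * edge_factor s J l \<noteq> 0" for l using \<rho> edge_factor_nonzero[OF s] by simp
  have rhs: "X_mat \<nu> *v g = (\<chi> r. M (\<nu> ! row_vertex r) $ i $ j - M (\<nu> ! 0) $ i $ j)"
  proof (subst vec_eq_iff, intro allI)
    fix r :: "'n option"
    have "(X_mat \<nu> *v g) $ r = (\<Sum>k<row_vertex r. M (?v (Suc k)) $ i $ j - M (?v k) $ i $ j)"
      unfolding X_mat_row_mult
    proof (intro sum.cong refl)
      fix k assume "k \<in> {..<row_vertex r}"
      then have "k < Suc CARD('n)" using row_vertex_bounds(2)[of r] by simp
      then show "\<rho> * edge_factor s J (\<sigma> ! k) * g $ (\<sigma> ! k) = M (?v (Suc k)) $ i $ j - M (?v k) $ i $ j"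
        using nz by (simp add: g)
    qed
    also have "\<dots> = M (?v (row_vertex r)) $ i $ j - M (?v 0) $ i $ j"
      by (rule sum_lessThan_telescope)
    finally show "(X_mat \<nu> *v g) $ r = (\<chi> r. M (\<nu> ! row_vertex r) $ i $ j - M (\<nu> ! 0) $ i $ j) $ r"
      using row_vertex_bounds[of r] by (simp add: nth_\<nu>)
  qed
  \<comment> \<open>The rows of \<open>X_mat\<close> are partial sums of the edges; differences of consecutive rows isolate each
    coordinate, hence \<open>X_mat\<close> is injective.\<close>
  have "g = 0" if "X_mat \<nu> *v g = 0" for g
  proof -
    have partial: "(\<Sum>k<m. \<rho> * edge_factor s J (\<sigma> ! k) * g $ (\<sigma> ! k)) = 0" if "m \<le> CARD('n) + 1" for m
    proof (cases m)
      case (Suc m')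
      then have "m \<in> row_vertex ` (UNIV :: 'n option set)"
        using that row_vertex_bij[where 'n='n] by (auto simp: bij_betw_def)
      then obtain r :: "'n option" where "row_vertex r = m" by auto
      then show ?thesis using X_mat_row_mult[of g r] \<open>X_mat \<nu> *v g = 0\<close> by simp
    qed simp
    have "g $ l = 0" for l
    proof -
      have "l \<in> set \<sigma>" using \<sigma>(2) by simp
      then obtain k where k: "k < Suc CARD('n)" "l = \<sigma> ! k" using length_\<sigma> by (auto simp: in_set_conv_nth)
      then have "\<rho> * edge_factor s J (\<sigma> ! k) * g $ (\<sigma> ! k) = 0"
        using partial[of "Suc k"] partial[of k] by simp
      then show ?thesis using nz k(2) by simp
    qed
    then show "g = 0" by (simp add: vec_eq_iff)
  qed
  then have "invertible (X_mat \<nu>)"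
    using matrix_left_invertible_ker[of "X_mat \<nu>"] invertible_left_inverse by blast
  then have "matrix_inv (X_mat \<nu>) *v (X_mat \<nu> *v g) = g"
    by (simp add: matrix_vector_mul_assoc matrix_inv_mult_left)
  then show ?thesis unfolding w_vec_def rhs .
qed

lemma w_vec_mean_value:
  assumes M: "C1_with_derivative (\<lambda>p. M p $ i $ j) (\<lambda>p q. M' p q $ i $ j)"
  obtains \<xi> where "\<xi> \<in> convex hull set \<nu>" "w_vec M \<nu> i j $ l = M' \<xi> (unit_vec l) $ i $ j"
proof -
  let ?v = "grid_vertex \<rho> s z J \<sigma>"
  define ix where "ix l = (THE k. k < Suc CARD('n) \<and> \<sigma> ! k = l)" for l
  define g :: "real ^ 'n option" where "g = (\<chi> l. (M (?v (Suc (ix l))) - M (?v (ix l))) $ i $ j / (\<rho> * edge_factor s J l))"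
  have ix: "ix (\<sigma> ! k) = k" if "k < Suc CARD('n)" for k
    unfolding ix_def using that \<sigma>(1) length_\<sigma> by (intro the_equality) (auto simp: nth_eq_iff_index_eq)
  have w: "w_vec M \<nu> i j = g"
    by (intro w_vec_eq) (simp add: g_def ix)
  have "l \<in> set \<sigma>" using \<sigma>(2) by simp
  then obtain k where k: "k < Suc CARD('n)" "l = \<sigma> ! k" using length_\<sigma> by (auto simp: in_set_conv_nth)
  let ?d = "\<rho> * edge_factor s J l"
  have d: "?d \<noteq> 0" using \<rho> edge_factor_nonzero[OF s] by simp
  define h where "h t = M (?v k + t *\<^sub>R (?d *\<^sub>R unit_vec l)) $ i $ j" for t :: real
  have hder: "(h has_real_derivative M' (?v k + t *\<^sub>R (?d *\<^sub>R unit_vec l)) (?d *\<^sub>R unit_vec l) $ i $ j) (at t)" for t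
  proof -
    have hd: "(h has_derivative (\<lambda>x. M' (?v k + t *\<^sub>R (?d *\<^sub>R unit_vec l)) (x *\<^sub>R (?d *\<^sub>R unit_vec l)) $ i $ j)) (at t)"
      unfolding h_def[abs_def]
      by (rule has_derivative_compose[where g="\<lambda>p. M p $ i $ j", OF _ C1_has_derivative[OF M]])
        (auto intro!: derivative_eq_intros)
    have sc: "M' p (x *\<^sub>R q) $ i $ j = x * M' p q $ i $ j" for p x q
      using linear_scale[OF has_derivative_linear[OF C1_has_derivative[OF M]]] by simp
    show ?thesis
      unfolding has_field_derivative_def
      by (rule has_derivative_eq_rhs[OF hd]) (simp only: fun_eq_iff sc mult.commute simp_thms)
  qed
  with hder obtain t where t: "0 < t" "t < 1" "h 1 - h 0 = (1 - 0) * (M' (?v k + t *\<^sub>R (?d *\<^sub>R unit_vec l)) (?d *\<^sub>R unit_vec l) $ i $ j)"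
    using MVT2[OF zero_less_one, of h "\<lambda>t. M' (?v k + t *\<^sub>R (?d *\<^sub>R unit_vec l)) (?d *\<^sub>R unit_vec l) $ i $ j"]
    by blast
  define \<xi> where "\<xi> = ?v k + t *\<^sub>R (?d *\<^sub>R unit_vec l)"
  have step: "?v (Suc k) = ?v k + ?d *\<^sub>R unit_vec l" by (simp add: grid_vertex_Suc k(2))
  have "\<xi> = (1 - t) *\<^sub>R ?v k + t *\<^sub>R ?v (Suc k)" by (simp add: \<xi>_def step algebra_simps)
  then have "\<xi> \<in> convex hull set \<nu>"
    using t k(1) convexD[OF convex_convex_hull, of "?v k" "set \<nu>" "?v (Suc k)" "1 - t" t]
      vertex_in_hull[of k] vertex_in_hull[of "Suc k"] by simp
  moreover have "w_vec M \<nu> i j $ l = M' \<xi> (unit_vec l) $ i $ j"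
  proof -
    have "w_vec M \<nu> i j $ l = (M (?v (Suc k)) - M (?v k)) $ i $ j / ?d"
      unfolding w g_def using k by (simp add: ix)
    also have "\<dots> = (h 1 - h 0) / ?d" by (simp add: h_def step)
    also have "h 1 - h 0 = M' \<xi> (?d *\<^sub>R unit_vec l) $ i $ j" using t(3) by (simp add: \<xi>_def)
    also have "\<dots> = ?d * M' \<xi> (unit_vec l) $ i $ j"
      using linear_scale[OF has_derivative_linear[OF C1_has_derivative[OF M]]] by simp
    finally show ?thesis using d by simp
  qed
  ultimately show thesis by (rule that)
qed

end

lemma basic_triangulationE:
  fixes s :: "real ^ 'n::finite"
  assumes "\<nu> \<in> basic_triangulation T s K" "T > 0" "\<forall>i. s $ i > 0"
  obtains z J \<sigma> where "grid_simplex (T / 2 ^ K) s z J \<sigma> \<nu>"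
proof -
  obtain z J \<sigma> where "\<nu> = map (grid_vertex (T / 2 ^ K) s z J \<sigma>) [0..<CARD('n) + 2]"
    "distinct \<sigma>" "set \<sigma> = UNIV"
    using assms(1) unfolding basic_triangulation_def by blast
  then show thesis using assms(2,3) by (intro that[of z J \<sigma>]) (simp add: grid_simplex_def)
qed

section \<open>Feasibility on fine triangulations\<close>

lemma eventually_small_mesh:
  fixes T \<epsilon> :: real
  assumes "\<epsilon> > 0"
  obtains K0 where "\<And>K. K \<ge> K0 \<Longrightarrow> T / 2 ^ K < \<epsilon>"
proof -
  have "(\<lambda>K. T * (1 / 2) ^ K) \<longlonglongrightarrow> T * 0"
    by (intro tendsto_intros LIMSEQ_power_zero) simp
  then have "\<forall>\<^sub>F K in sequentially. T * (1 / 2) ^ K < \<epsilon>"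
    using assms by (simp add: order_tendsto_iff)
  then show thesis using that by (auto simp: eventually_sequentially power_one_over)
qed

lemma finite_family_uniformly_continuous:
  fixes g :: "'i::finite \<Rightarrow> 'a::metric_space \<Rightarrow> 'b::metric_space"
  assumes "compact N" "\<And>i. continuous_on N (g i)" "e > 0"
  obtains d where "d > 0" "\<And>i p q. p \<in> N \<Longrightarrow> q \<in> N \<Longrightarrow> dist p q < d \<Longrightarrow> dist (g i p) (g i q) < e"
proof -
  have "\<exists>d>0. \<forall>p\<in>N. \<forall>q\<in>N. dist p q < d \<longrightarrow> dist (g i p) (g i q) < e" for i
    using compact_uniformly_continuous[OF assms(2,1)] \<open>e > 0\<close> unfolding uniformly_continuous_on_def
    by (metis dist_commute)
  then obtain d where d: "\<And>i. d i > 0"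
    "\<And>i p q. p \<in> N \<Longrightarrow> q \<in> N \<Longrightarrow> dist p q < d i \<Longrightarrow> dist (g i p) (g i q) < e" by metis
  have fin: "finite (range d)" by simp
  show thesis
  proof (rule that[of "Min (range d)"])
    show "Min (range d) > 0" using d(1) fin by (subst Min_gr_iff) auto
    fix i p q assume pq: "p \<in> N" "q \<in> N" "dist p q < Min (range d)"
    have "Min (range d) \<le> d i" using fin by (intro Min_le) auto
    then show "dist (g i p) (g i q) < e" using pq by (intro d(2)) auto
  qed
qed

lemma Sup_between:
  fixes S :: "real set"
  assumes "S \<noteq> {}" "\<And>x. x \<in> S \<Longrightarrow> 0 \<le> x \<and> x \<le> b"
  shows "0 \<le> Sup S" "Sup S \<le> b"
proof -
  obtain x where x: "x \<in> S" using assms(1) by blast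
  have "bdd_above S" using assms(2) by (intro bdd_aboveI[of _ b]) blast
  then have "x \<le> Sup S" by (rule cSup_upper[OF x])
  then show "0 \<le> Sup S" using assms(2)[OF x] by linarith
  show "Sup S \<le> b" using assms by (intro cSup_least) auto
qed

lemma mat_mult_vector: "mat c *v v = c *\<^sub>R v" for v :: "real ^ 'n::finite"
  by (simp add: vec_eq_iff matrix_vector_mult_def mat_def if_distrib[of "\<lambda>x. x * _"] sum.delta cong: if_cong)

lemma transpose_mat: "transpose (mat c) = (mat c :: real ^ 'n::finite ^ 'n)"
  by (simp add: vec_eq_iff transpose_def mat_def)

lemma transpose_add: "transpose (A + B) = transpose A + transpose (B :: real ^ 'n::finite ^ 'n)"
  by (simp add: vec_eq_iff transpose_def)

lemma matrix_leI:
  fixes A B :: "real ^ 'n::finite ^ 'n"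
  assumes "transpose A = A" "transpose B = B" "\<And>v. v \<bullet> (A *v v) \<le> v \<bullet> (B *v v)"
  shows "A \<preceq> B"
proof -
  have "transpose (B - A) = B - A"
    using assms(1,2) by (simp add: vec_eq_iff transpose_def)
  then show ?thesis
    using assms(3) by (simp add: matrix_le_def psd_def matrix_vector_mult_diff_rdistrib inner_diff_right)
qed

context stable_periodic_solution
begin

text \<open>Both end points of the period are kept: the lift of a compact set is then compact, and a simplex with
  times in \<open>[0, T]\<close> meets the lift whenever its image in the cylinder meets the set.\<close>

definition lifted :: "(complex \<times> (real ^ 'n)) set \<Rightarrow> 'n point set" where
  "lifted \<C> = {p. fst p \<in> {0..T} \<and> cyl T p \<in> \<C>}"

lemma compact_lifted:
  assumes "compact \<C>"
  shows "compact (lifted \<C>)"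
proof -
  have "compact ({0..T} \<times> snd ` \<C>)"
    by (intro compact_Times compact_Icc compact_continuous_image continuous_intros assms)
  moreover have "closed (cyl T -` \<C>)"
    by (intro closed_vimage compact_imp_closed assms continuous_on_cyl)
  ultimately have "compact (({0..T} \<times> snd ` \<C>) \<inter> cyl T -` \<C>)" by (rule compact_Int_closed)
  moreover have "lifted \<C> = ({0..T} \<times> snd ` \<C>) \<inter> cyl T -` \<C>"
    by (force simp: lifted_def cyl_def)
  ultimately show ?thesis by simp
qed

text \<open>The interpolated gradients are close to the true ones by uniform continuity, and the metric
  contracts with room to spare. The error term enters only through its smallness on fine meshes, so
  that the cases of two and of three derivatives are treated at once.\<close>

lemma sdp_solution_fine_mesh:
  fixes s :: "real ^ 'n" and E :: "'n point list \<Rightarrow> real \<Rightarrow> real \<Rightarrow> real"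
  assumes s: "\<forall>i. s $ i > 0" and \<C>: "\<C> \<in> set_class_N T" "\<C> \<subseteq> basin T f orbit" and \<epsilon>0: "\<epsilon>0 > 0"
    and E_small: "\<And>N C D. compact N \<Longrightarrow> 0 \<le> C \<Longrightarrow> 0 \<le> D \<Longrightarrow>
      \<exists>\<rho>0>0. \<forall>\<rho> z J \<sigma> \<nu>. \<rho> < \<rho>0 \<longrightarrow> grid_simplex \<rho> s z J \<sigma> \<nu> \<longrightarrow> convex hull set \<nu> \<subseteq> N \<longrightarrow> E \<nu> C D \<le> 1"
  obtains Kstar where "\<And>K. K \<ge> Kstar \<Longrightarrow> \<exists>M C D. sdp_solution T s f \<C> \<epsilon>0 E K M (\<lambda>_. C) (\<lambda>_. D)"
proof -
  have cC: "compact \<C>" using \<C>(1) by (simp add: set_class_N_def)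
  define K where "K = lifted \<C>"
  have K: "compact K" unfolding K_def by (rule compact_lifted[OF cC])
  \<comment> \<open>Simplices that meet \<open>\<C>\<close> may leave it, but for fine meshes they stay in this neighbourhood.\<close>
  define N where "N = {p + q | p q. p \<in> K \<and> q \<in> cball (0 :: 'n point) 1}"
  have N: "compact N" unfolding N_def by (intro compact_sums K compact_cball)
  have near_N: "p \<in> N" if "q \<in> K" "norm (p - q) \<le> 1" for p q
  proof -
    have "p = q + (p - q)" by simp
    moreover have "p - q \<in> cball 0 1" using that(2) by simp
    ultimately show ?thesis using that(1) unfolding N_def by blast
  qed
  have K_N: "K \<subseteq> N" using near_N[of _ _] by auto
  obtain M :: "'n point \<Rightarrow> real ^ 'n ^ 'n" and M'
    where C1M: "\<And>i j. C1_with_derivative (\<lambda>p. M p $ i $ j) (\<lambda>p q. M' p q $ i $ j)"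
    and Msym: "\<And>p. transpose (M p) = M p" and Mper: "\<And>x. M (0, x) = M (T, x)"
    and Mpos: "\<And>p v. p \<in> N \<Longrightarrow> \<epsilon>0 * (norm v)\<^sup>2 \<le> v \<bullet> (M p *v v)"
    and Mcontr: "\<And>p v. p \<in> K \<Longrightarrow> v \<bullet> (M' p (1, f p) *v v) + 2 * (v \<bullet> (M p *v (Dx f p *v v))) \<le> - 3 * (norm v)\<^sup>2"
  proof (rule contraction_metric[OF K _ _ N \<epsilon>0])
    show "K \<subseteq> {0..T} \<times> UNIV" by (auto simp: K_def lifted_def)
    show "cyl T p \<in> basin T f orbit" if "p \<in> K" for p
      using that \<C>(2) by (auto simp: K_def lifted_def)
  qed (rule that, assumption+)
  define n where "n = real CARD('n)"
  have n: "n \<ge> 1" by (simp add: n_def)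

  define \<Lambda> where "\<Lambda> p = M p ** Dx f p + transpose (Dx f p) ** M p + M' p (1, f p)" for p
  have \<Lambda>q: "v \<bullet> (\<Lambda> p *v v) = v \<bullet> (M' p (1, f p) *v v) + 2 * (v \<bullet> (M p *v (Dx f p *v v)))" for p v
  proof -
    have "v \<bullet> ((transpose (Dx f p) ** M p) *v v) = v \<bullet> ((M p *v v) v* Dx f p)"
      by (simp only: matrix_vector_mul_assoc[symmetric] transpose_matrix_vector)
    also have "\<dots> = ((M p *v v) v* Dx f p) \<bullet> v" by (rule inner_commute)
    also have "\<dots> = (M p *v v) \<bullet> (Dx f p *v v)" by (rule dot_lmul_matrix)
    also have "\<dots> = (Dx f p *v v) \<bullet> (M p *v v)" by (rule inner_commute)
    also have "\<dots> = v \<bullet> (M p *v (Dx f p *v v))" by (rule symmetric_matrix_inner[OF Msym])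
    finally show ?thesis
      by (simp add: \<Lambda>_def matrix_vector_mult_add_rdistrib inner_add_right matrix_vector_mul_assoc)
  qed
  have on_N: "continuous_on UNIV g \<Longrightarrow> continuous_on N g" for g :: "'n point \<Rightarrow> real"
    using continuous_on_subset by blast
  have M'c: "continuous_on UNIV (\<lambda>p. M' p (1, f p) $ i $ j)" for i j
    by (rule C1_orbital_derivative_continuous[OF C1M])
  have \<Lambda>c: "continuous_on N (\<lambda>p. \<Lambda> p $ fst ij $ snd ij)" for ij :: "'n \<times> 'n"
    unfolding \<Lambda>_def matrix_matrix_mult_def transpose_def
    by (rule on_N, simp, intro continuous_intros Dx_continuous C1_continuous[OF C1M] M'c)
  define g where "g l ij p = M' p (unit_vec l) $ fst ij $ snd ij" for l :: "'n option" and ij :: "'n \<times> 'n" and p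
  have gc: "continuous_on N (\<lambda>p. g (fst a) (snd a) p)" for a
    unfolding g_def by (rule on_N, rule C1_derivative_continuous[OF C1M])
  have Mc: "continuous_on N (\<lambda>p. M p $ fst ij $ snd ij)" for ij :: "'n \<times> 'n"
    by (rule on_N, rule C1_continuous[OF C1M])
  have fc: "continuous_on N (\<lambda>p. coords (1, f p) $ l)" for l
    by (rule on_N, rule continuous_on_coords[OF f_continuous])
  obtain bM where bM: "bM > 0" "\<And>ij p. p \<in> N \<Longrightarrow> norm (M p $ fst ij $ snd ij) \<le> bM"
    by (rule compact_family_bounded[OF N Mc]) (rule that, assumption+)
  obtain bg where bg: "bg > 0" "\<And>a p. p \<in> N \<Longrightarrow> norm (g (fst a) (snd a) p) \<le> bg"
    by (rule compact_family_bounded[OF N gc]) (rule that, assumption+)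
  obtain F where F: "F > 0" "\<And>l p. p \<in> N \<Longrightarrow> norm (coords (1, f p) $ l) \<le> F"
    by (rule compact_family_bounded[OF N fc]) (rule that, assumption+)
  define C where "C = n\<^sup>2 * bM"
  define D where "D = (n + 1) * bg"
  have CD: "0 \<le> C" "0 \<le> D" using bM(1) bg(1) n by (auto simp: C_def D_def)
  \<comment> \<open>Entrywise tolerance \<open>e\<close> for the contraction matrix and for the gradients; it makes the total
    interpolation error of the quadratic form at most \<open>\<parallel>v\<parallel>\<^sup>2\<close>.\<close>
  define e where "e = 1 / (n\<^sup>2 * (1 + (n + 1) * F))"
  have e: "e > 0" "n\<^sup>2 * (e + (n + 1) * (e * F)) = 1"
  proof -
    have d: "n\<^sup>2 * (1 + (n + 1) * F) > 0" using n F(1) by (intro mult_pos_pos add_pos_pos) auto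
    then show "e > 0" by (simp add: e_def)
    have "n\<^sup>2 * (e + (n + 1) * (e * F)) = e * (n\<^sup>2 * (1 + (n + 1) * F))" by (simp add: algebra_simps)
    also have "\<dots> = 1" unfolding e_def using less_imp_neq[OF d] by (metis nonzero_divide_eq_eq)
    finally show "n\<^sup>2 * (e + (n + 1) * (e * F)) = 1" .
  qed
  obtain d1 where d1: "d1 > 0" "\<And>ij p q. p \<in> N \<Longrightarrow> q \<in> N \<Longrightarrow> dist p q < d1 \<Longrightarrow>
      dist (\<Lambda> p $ fst ij $ snd ij) (\<Lambda> q $ fst ij $ snd ij) < e"
    by (rule finite_family_uniformly_continuous[OF N \<Lambda>c e(1)]) (rule that, assumption+)
  obtain d2 where d2: "d2 > 0" "\<And>a p q. p \<in> N \<Longrightarrow> q \<in> N \<Longrightarrow> dist p q < d2 \<Longrightarrow>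
      dist (g (fst a) (snd a) p) (g (fst a) (snd a) q) < e"
    by (rule finite_family_uniformly_continuous[OF N gc e(1)]) (rule that, assumption+)
  obtain \<rho>0 where \<rho>0: "\<rho>0 > 0" "\<And>\<rho> z J \<sigma> \<nu>. \<rho> < \<rho>0 \<Longrightarrow> grid_simplex \<rho> s z J \<sigma> \<nu> \<Longrightarrow> convex hull set \<nu> \<subseteq> N \<Longrightarrow> E \<nu> C D \<le> 1"
    using E_small[OF N CD] by blast
  define G where "G = 2 * (n + 1) * scale_bound s"
  have G: "G > 0" using n scale_bound_pos[of s] by (simp add: G_def)
  define \<rho>1 where "\<rho>1 = min \<rho>0 (min 1 (min d1 d2) / G)"
  have "\<rho>1 > 0" using \<rho>0(1) d1(1) d2(1) G by (simp add: \<rho>1_def)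
  then obtain Kstar where Kstar: "\<And>K. K \<ge> Kstar \<Longrightarrow> T / 2 ^ K < \<rho>1"
    using eventually_small_mesh[of \<rho>1 T] by blast

  have "sdp_solution T s f \<C> \<epsilon>0 E k M (\<lambda>_. C) (\<lambda>_. D)" if k: "k \<ge> Kstar" for k
  proof -
    define \<rho> where "\<rho> = T / 2 ^ k"
    have \<rho>: "\<rho> > 0" "\<rho> < \<rho>0" "\<rho> * G < 1" "\<rho> * G < d1" "\<rho> * G < d2"
    proof -
      show "\<rho> > 0" using T_pos by (simp add: \<rho>_def)
      have "\<rho> < \<rho>0" "\<rho> < min 1 (min d1 d2) / G" using Kstar[OF k] by (auto simp: \<rho>_def \<rho>1_def)
      then show "\<rho> < \<rho>0" "\<rho> * G < 1" "\<rho> * G < d1" "\<rho> * G < d2" using G by (auto simp: pos_less_divide_eq)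
    qed
    have simplex: "\<exists>z J \<sigma>. grid_simplex \<rho> s z J \<sigma> \<nu>" "\<exists>q\<in>K. q \<in> convex hull set \<nu>" "convex hull set \<nu> \<subseteq> N"
      if \<nu>: "\<nu> \<in> triangulation T s \<C> k" for \<nu>
    proof -
      have \<nu>1: "\<nu> \<in> basic_triangulation T s k" "convex hull set \<nu> \<subseteq> {0..T} \<times> UNIV"
        "cyl T ` (convex hull set \<nu>) \<inter> cyl_interior T \<C> \<noteq> {}"
        using \<nu> by (auto simp: triangulation_def)
      obtain z J \<sigma> where gs: "grid_simplex \<rho> s z J \<sigma> \<nu>"
        using basic_triangulationE[OF \<nu>1(1) T_pos s] unfolding \<rho>_def by blast
      then show "\<exists>z J \<sigma>. grid_simplex \<rho> s z J \<sigma> \<nu>" by blast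
      obtain q where q: "q \<in> convex hull set \<nu>" "cyl T q \<in> \<C>"
        using \<nu>1(3) interior_of_subset[of "top_of_set (cylinder T)" \<C>] by blast
      then have qK: "q \<in> K" using \<nu>1(2) by (auto simp: K_def lifted_def)
      then show "\<exists>q\<in>K. q \<in> convex hull set \<nu>" using q by blast
      show "convex hull set \<nu> \<subseteq> N"
      proof
        fix p assume "p \<in> convex hull set \<nu>"
        then have "norm (p - q) \<le> \<rho> * G"
          using grid_simplex.hull_dist[OF gs _ q(1)] by (simp add: G_def n_def)
        then show "p \<in> N" using \<rho>(3) by (intro near_N[OF qK]) simp
      qed
    qed
    have vert_N: "p \<in> N" if "\<nu> \<in> triangulation T s \<C> k" "p \<in> set \<nu>" for \<nu> p
      using simplex(3)[OF that(1)] hull_inc[OF that(2)] by blast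
    have close: "dist p q < d1" "dist p q < d2"
      if \<nu>: "\<nu> \<in> triangulation T s \<C> k" and pq: "p \<in> convex hull set \<nu>" "q \<in> convex hull set \<nu>" for \<nu> p q
    proof -
      obtain z J \<sigma> where gs: "grid_simplex \<rho> s z J \<sigma> \<nu>" using simplex(1)[OF \<nu>] by blast
      have "dist p q \<le> \<rho> * G"
        using grid_simplex.hull_dist[OF gs pq] by (simp add: G_def n_def dist_norm)
      then show "dist p q < d1" "dist p q < d2" using \<rho> by auto
    qed
    have w_mean: "\<exists>\<xi>\<in>convex hull set \<nu>. w_vec M \<nu> i j $ l = g l (i, j) \<xi>"
      if \<nu>: "\<nu> \<in> triangulation T s \<C> k" for \<nu> i j l
    proof -
      obtain z J \<sigma> where gs: "grid_simplex \<rho> s z J \<sigma> \<nu>" using simplex(1)[OF \<nu>] by blast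
      show ?thesis
        using grid_simplex.w_vec_mean_value[OF gs C1M, of i j l] unfolding g_def by (metis fst_conv snd_conv)
    qed
    have M_entry_sym: "M p $ i $ j = M p $ j $ i" for p i j
      using Msym[of p] by (metis (no_types, lifting) transpose_def vec_lambda_beta)
    have w_sym: "w_vec M \<nu> i j = w_vec M \<nu> j i" for \<nu> i j
      by (simp add: w_vec_def M_entry_sym[of _ i j])

    have contr: "M p ** Dx f p + transpose (Dx f p) ** M p + (\<chi> i j. w_vec M \<nu> i j \<bullet> coords (1, f p)) +
        mat (E \<nu> C D + 1) \<preceq> 0" if \<nu>: "\<nu> \<in> triangulation T s \<C> k" and p: "p \<in> set \<nu>" for \<nu> p
    proof (rule matrix_leI)
      let ?X = "M p ** Dx f p + transpose (Dx f p) ** M p + (\<chi> i j. w_vec M \<nu> i j \<bullet> coords (1, f p))"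
      have "transpose (M p ** Dx f p + transpose (Dx f p) ** M p) = M p ** Dx f p + transpose (Dx f p) ** M p"
        by (simp add: transpose_add matrix_transpose_mul Msym add.commute)
      moreover have "transpose (\<chi> i j. w_vec M \<nu> i j \<bullet> coords (1, f p)) = (\<chi> i j. w_vec M \<nu> i j \<bullet> coords (1, f p))"
        by (simp add: vec_eq_iff transpose_def w_sym[of \<nu>])
      ultimately show "transpose (?X + mat (E \<nu> C D + 1)) = ?X + mat (E \<nu> C D + 1)"
        by (simp add: transpose_add transpose_mat)
      show "transpose 0 = (0 :: real ^ 'n ^ 'n)" by (simp add: vec_eq_iff transpose_def)
      fix v :: "real ^ 'n"
      obtain q where q: "q \<in> K" "q \<in> convex hull set \<nu>" using simplex(2)[OF \<nu>] by blast
      have pN: "p \<in> N" and qN: "q \<in> N" and ph: "p \<in> convex hull set \<nu>"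
        using vert_N[OF \<nu> p] K_N q(1) hull_inc[OF p] by auto
      have entry: "\<bar>(?X - \<Lambda> q) $ i $ j\<bar> \<le> e + (n + 1) * (e * F)" for i j
      proof -
        have "M' p (1, f p) $ i $ j = (\<Sum>l\<in>UNIV. coords (1, f p) $ l * g l (i, j) p)"
          using C1_derivative_eq_sum_coords[OF C1M, of p "(1, f p)" i j] by (simp add: g_def)
        then have eq: "(?X - \<Lambda> q) $ i $ j = (\<Lambda> p $ i $ j - \<Lambda> q $ i $ j)
            + (\<Sum>l\<in>UNIV. (w_vec M \<nu> i j $ l - g l (i, j) p) * coords (1, f p) $ l)"
          by (simp add: \<Lambda>_def inner_vec_def left_diff_distrib right_diff_distrib sum_subtractf mult.commute)
        have "\<bar>\<Sum>l\<in>UNIV. (w_vec M \<nu> i j $ l - g l (i, j) p) * coords (1, f p) $ l\<bar>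
            \<le> (\<Sum>l\<in>(UNIV :: 'n option set). e * F)"
        proof (intro order_trans[OF sum_abs] sum_mono)
          fix l :: "'n option"
          obtain \<xi> where \<xi>: "\<xi> \<in> convex hull set \<nu>" "w_vec M \<nu> i j $ l = g l (i, j) \<xi>"
            using w_mean[OF \<nu>] by blast
          have "\<xi> \<in> N" using simplex(3)[OF \<nu>] \<xi>(1) by blast
          then have "\<bar>w_vec M \<nu> i j $ l - g l (i, j) p\<bar> \<le> e"
            using d2(2)[OF _ pN close(2)[OF \<nu> \<xi>(1) ph], of "(l, (i, j))"] \<xi>(2) by (simp add: dist_real_def)
          then show "\<bar>(w_vec M \<nu> i j $ l - g l (i, j) p) * coords (1, f p) $ l\<bar> \<le> e * F"
            unfolding abs_mult using F(2)[OF pN, of l] e(1) by (intro mult_mono) auto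
        qed
        also have "\<dots> = (n + 1) * (e * F)" by (simp add: n_def algebra_simps)
        finally have s2: "\<bar>\<Sum>l\<in>UNIV. (w_vec M \<nu> i j $ l - g l (i, j) p) * coords (1, f p) $ l\<bar> \<le> (n + 1) * (e * F)" .
        have s1: "\<bar>\<Lambda> p $ i $ j - \<Lambda> q $ i $ j\<bar> \<le> e"
          using d1(2)[OF pN qN close(1)[OF \<nu> ph q(2)], of "(i, j)"] by (simp add: dist_real_def)
        show ?thesis unfolding eq using s1 s2 by linarith
      qed
      have "v \<bullet> ((?X - \<Lambda> q) *v v) \<le> n\<^sup>2 * (e + (n + 1) * (e * F)) * (norm v)\<^sup>2"
        by (rule abs_le_D1[OF quadratic_form_entry_bound[OF entry, of v, folded n_def]])
      then have 1: "v \<bullet> (?X *v v) - v \<bullet> (\<Lambda> q *v v) \<le> (norm v)\<^sup>2"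
        unfolding e(2) by (simp add: matrix_vector_mult_diff_rdistrib inner_diff_right)
      have 2: "v \<bullet> (\<Lambda> q *v v) \<le> - 3 * (norm v)\<^sup>2" unfolding \<Lambda>q by (rule Mcontr[OF q(1)])
      obtain z J \<sigma> where gs: "grid_simplex \<rho> s z J \<sigma> \<nu>" using simplex(1)[OF \<nu>] by blast
      have "(E \<nu> C D + 1) * (norm v)\<^sup>2 \<le> 2 * (norm v)\<^sup>2"
        using \<rho>0(2)[OF \<rho>(2) gs simplex(3)[OF \<nu>]] by (intro mult_right_mono) auto
      then have 3: "v \<bullet> (mat (E \<nu> C D + 1) *v v) \<le> 2 * (norm v)\<^sup>2"
        by (simp add: mat_mult_vector power2_norm_eq_inner)
      have "v \<bullet> ((?X + mat (E \<nu> C D + 1)) *v v) = v \<bullet> (?X *v v) + v \<bullet> (mat (E \<nu> C D + 1) *v v)"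
        by (simp only: matrix_vector_mult_add_rdistrib inner_add_right)
      also have "\<dots> \<le> 0" using 1 2 3 by linarith
      finally show "v \<bullet> ((?X + mat (E \<nu> C D + 1)) *v v) \<le> v \<bullet> (0 *v v)" by simp
    qed
    show ?thesis
      unfolding sdp_solution_def
    proof (intro conjI ballI allI impI)
      show "transpose (M p) = M p" for p by (rule Msym)
      show "0 \<le> C" "0 \<le> D" by (fact CD)+
      show "M (0, x) = M (T, x)" for x by (rule Mper)
      show "M p \<preceq> mat C" if \<nu>: "\<nu> \<in> triangulation T s \<C> k" and p: "p \<in> set \<nu>" for \<nu> p
      proof (rule matrix_leI[OF Msym transpose_mat])
        fix v :: "real ^ 'n"
        have "v \<bullet> (M p *v v) \<le> C * (norm v)\<^sup>2"
          using quadratic_form_entry_bound[of "M p" bM v] bM(2)[OF vert_N[OF \<nu> p], of "(_, _)"]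
          by (simp add: C_def n_def)
        then show "v \<bullet> (M p *v v) \<le> v \<bullet> (mat C *v v)" by (simp add: mat_mult_vector power2_norm_eq_inner)
      qed
      show "\<bar>w_vec M \<nu> i j $ l\<bar> \<le> D / (real CARD('n) + 1)" if \<nu>: "\<nu> \<in> triangulation T s \<C> k" for \<nu> i j l
      proof -
        obtain \<xi> where \<xi>: "\<xi> \<in> convex hull set \<nu>" "w_vec M \<nu> i j $ l = g l (i, j) \<xi>"
          using w_mean[OF \<nu>] by blast
        then have "\<bar>w_vec M \<nu> i j $ l\<bar> \<le> bg" using bg(2)[of \<xi> "(l, (i, j))"] simplex(3)[OF \<nu>] by auto
        also have "bg = D / (real CARD('n) + 1)" using n by (simp add: D_def n_def)
        finally show ?thesis .
      qed
      show "mat \<epsilon>0 \<preceq> M p" if "p \<in> vertices T s \<C> k" for p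
      proof (rule matrix_leI[OF transpose_mat Msym])
        fix v :: "real ^ 'n"
        have "p \<in> N" using that vert_N unfolding vertices_def by blast
        then show "v \<bullet> (mat \<epsilon>0 *v v) \<le> v \<bullet> (M p *v v)"
          using Mpos[of p v] by (simp add: mat_mult_vector power2_norm_eq_inner)
      qed
    qed (use contr in auto)
  qed
  then show thesis using that by blast
qed

end

section \<open>The error terms\<close>

lemma Sup_infnorm_bounded:
  fixes g :: "'i::finite \<Rightarrow> 'n::finite point \<Rightarrow> real ^ 'n"
  assumes "compact N" "\<And>i. continuous_on UNIV (g i)"
  obtains b where "b > 0"
    "\<And>S. S \<noteq> {} \<Longrightarrow> S \<subseteq> {infnorm (g i p) | i p. p \<in> N} \<Longrightarrow> 0 \<le> Sup S \<and> Sup S \<le> b"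
proof -
  obtain b where b: "b > 0" "\<And>i p. p \<in> N \<Longrightarrow> norm (g i p) \<le> b"
    by (rule compact_family_bounded[OF assms(1) continuous_on_subset[OF assms(2) subset_UNIV]])
      (rule that, assumption+)
  show thesis
  proof (rule that[OF b(1)])
    fix S :: "real set" assume S: "S \<noteq> {}" "S \<subseteq> {infnorm (g i p) | i p. p \<in> N}"
    have "0 \<le> x \<and> x \<le> b" if x: "x \<in> S" for x
    proof -
      obtain i p where "x = infnorm (g i p)" "p \<in> N" using x S(2) by blast
      then show ?thesis using infnorm_le_norm[of "g i p"] b(2)[of p i] infnorm_pos_le[of "g i p"] by simp
    qed
    then show "0 \<le> Sup S \<and> Sup S \<le> b" using Sup_between[OF S(1), of b] by blast
  qed
qed

lemma hull_nonempty_simplex: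
  assumes "grid_simplex \<rho> s z J \<sigma> \<nu>"
  shows "convex hull set \<nu> \<noteq> {}"
  using grid_simplex.vertex_in_hull[OF assms, of 0] by auto

text \<open>Both error terms contain the diameter of the simplex as a factor, and the other factors are
  bounded on compact sets.\<close>

lemma small_of_linear_bound:
  fixes s :: "real ^ 'n::finite" and Q :: real
  assumes Q: "Q \<ge> 0"
    and bound: "\<And>\<rho> z J \<sigma> \<nu>. grid_simplex \<rho> s z J \<sigma> \<nu> \<Longrightarrow> convex hull set \<nu> \<subseteq> N \<Longrightarrow>
      h_const \<nu> \<le> 1 \<Longrightarrow> E \<nu> C D \<le> h_const \<nu> * Q"
  shows "\<exists>\<rho>0>0. \<forall>\<rho> z J \<sigma> \<nu>. \<rho> < \<rho>0 \<longrightarrow> grid_simplex \<rho> s z J \<sigma> \<nu> \<longrightarrow> convex hull set \<nu> \<subseteq> N \<longrightarrow> E \<nu> C D \<le> (1::real)"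
proof -
  define G where "G = 2 * (real CARD('n) + 1) * scale_bound s"
  have G: "G > 0" using scale_bound_pos[of s] by (simp add: G_def)
  define \<rho>0 where "\<rho>0 = 1 / (G * (1 + Q))"
  have "E \<nu> C D \<le> 1" if "\<rho> < \<rho>0" and gs: "grid_simplex \<rho> s z J \<sigma> \<nu>" and N: "convex hull set \<nu> \<subseteq> N" for \<rho> z J \<sigma> \<nu>
  proof -
    have "\<rho> * G * (1 + Q) < 1"
      using that(1) G Q by (simp add: \<rho>0_def pos_less_divide_eq mult.assoc)
    moreover have "h_const \<nu> * (1 + Q) \<le> \<rho> * G * (1 + Q)"
      using grid_simplex.h_const_bounds(2)[OF gs] Q by (intro mult_right_mono) (auto simp: G_def)
    ultimately have 1: "h_const \<nu> + h_const \<nu> * Q \<le> 1" by (simp add: algebra_simps)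
    have h: "0 \<le> h_const \<nu>" by (rule grid_simplex.h_const_bounds(1)[OF gs])
    then have "0 \<le> h_const \<nu> * Q" using Q by simp
    with 1 have "h_const \<nu> \<le> 1" by linarith
    from bound[OF gs N this] 1 h show ?thesis by linarith
  qed
  then show ?thesis using G Q by (intro exI[of _ \<rho>0]) (auto simp: \<rho>0_def)
qed

context periodic_C2_system
begin

lemma B_const_bounded:
  fixes s :: "real ^ 'n"
  assumes "compact N"
  obtains b where "b > 0" "\<And>\<rho> z J \<sigma> \<nu>. grid_simplex \<rho> s z J \<sigma> \<nu> \<Longrightarrow> convex hull set \<nu> \<subseteq> N \<Longrightarrow>
    0 \<le> B_const f \<nu> \<and> B_const f \<nu> \<le> b"
proof -
  obtain b where b: "b > 0" "\<And>S. S \<noteq> {} \<Longrightarrow>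
      S \<subseteq> {infnorm (partial_deriv (fst a) (partial_deriv (snd a) f) p) | a p. p \<in> N} \<Longrightarrow> 0 \<le> Sup S \<and> Sup S \<le> b"
    by (rule Sup_infnorm_bounded[OF assms second_partial_continuous]) (rule that, assumption+)
  have "0 \<le> B_const f \<nu> \<and> B_const f \<nu> \<le> b"
    if gs: "grid_simplex \<rho> s z J \<sigma> \<nu>" and N: "convex hull set \<nu> \<subseteq> N" for \<rho> z J \<sigma> \<nu>
    unfolding B_const_def
  proof (rule b(2))
    show "{infnorm (partial_deriv i (partial_deriv j f) p) |p i j. p \<in> convex hull set \<nu>} \<noteq> {}"
      using hull_nonempty_simplex[OF gs] by blast
    show "{infnorm (partial_deriv i (partial_deriv j f) p) |p i j. p \<in> convex hull set \<nu>}
        \<subseteq> {infnorm (partial_deriv (fst a) (partial_deriv (snd a) f) p) |a p. p \<in> N}"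
      using N by fastforce
  qed
  with b(1) show thesis using that by blast
qed

lemma B3_const_bounded:
  fixes s :: "real ^ 'n"
  assumes "compact N" "C_k 3 f"
  obtains b where "b > 0" "\<And>\<rho> z J \<sigma> \<nu>. grid_simplex \<rho> s z J \<sigma> \<nu> \<Longrightarrow> convex hull set \<nu> \<subseteq> N \<Longrightarrow>
    0 \<le> B3_const f \<nu> \<and> B3_const f \<nu> \<le> b"
proof -
  have c3: "continuous_on UNIV (partial_deriv i (partial_deriv j (partial_deriv k f)))" for i j k
    using assms(2) by (simp add: numeral_3_eq_3)
  obtain b where b: "b > 0" "\<And>S. S \<noteq> {} \<Longrightarrow>
      S \<subseteq> {infnorm (partial_deriv (fst a) (partial_deriv (fst (snd a)) (partial_deriv (snd (snd a)) f)) p) | a p. p \<in> N} \<Longrightarrow>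
      0 \<le> Sup S \<and> Sup S \<le> b"
    by (rule Sup_infnorm_bounded[OF assms(1) c3]) (rule that, assumption+)
  have "0 \<le> B3_const f \<nu> \<and> B3_const f \<nu> \<le> b"
    if gs: "grid_simplex \<rho> s z J \<sigma> \<nu>" and N: "convex hull set \<nu> \<subseteq> N" for \<rho> z J \<sigma> \<nu>
    unfolding B3_const_def
  proof (rule b(2))
    show "{infnorm (partial_deriv i (partial_deriv j (partial_deriv k f)) p) |p i j k. p \<in> convex hull set \<nu>} \<noteq> {}"
      using hull_nonempty_simplex[OF gs] by blast
    show "{infnorm (partial_deriv i (partial_deriv j (partial_deriv k f)) p) |p i j k. p \<in> convex hull set \<nu>}
        \<subseteq> {infnorm (partial_deriv (fst a) (partial_deriv (fst (snd a)) (partial_deriv (snd (snd a)) f)) p) |a p. p \<in> N}"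
      using N by fastforce
  qed
  with b(1) show thesis using that by blast
qed

lemma E_C2_small:
  fixes s :: "real ^ 'n"
  assumes N: "compact N" and CD: "0 \<le> C" "0 \<le> D"
  shows "\<exists>\<rho>0>0. \<forall>\<rho> z J \<sigma> \<nu>. \<rho> < \<rho>0 \<longrightarrow> grid_simplex \<rho> s z J \<sigma> \<nu> \<longrightarrow> convex hull set \<nu> \<subseteq> N \<longrightarrow> E_C2 f \<nu> C D \<le> 1"
proof -
  obtain b where b: "b > 0" "\<And>\<rho> z J \<sigma> \<nu>. grid_simplex \<rho> s z J \<sigma> \<nu> \<Longrightarrow> convex hull set \<nu> \<subseteq> N \<Longrightarrow>
    0 \<le> B_const f \<nu> \<and> B_const f \<nu> \<le> b"
    by (rule B_const_bounded[OF N]) (rule that, assumption+)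
  define n where "n = real CARD('n)"
  have n: "n \<ge> 0" by (simp add: n_def)
  show ?thesis
  proof (rule small_of_linear_bound)
    let ?Q = "n * (b * (sqrt (n + 1) * (1 * D) + 2 * n * (n + 1) * C))"
    show "0 \<le> ?Q" using n b(1) CD by (intro mult_nonneg_nonneg add_nonneg_nonneg) auto
    fix \<rho> z J \<sigma> \<nu> assume gs: "grid_simplex \<rho> s z J \<sigma> \<nu>" "convex hull set \<nu> \<subseteq> N" and h: "h_const \<nu> \<le> 1"
    have h0: "0 \<le> h_const \<nu>" by (rule grid_simplex.h_const_bounds(1)[OF gs(1)])
    have "E_C2 f \<nu> C D = h_const \<nu> * (n * (B_const f \<nu> * (sqrt (n + 1) * (h_const \<nu> * D) + 2 * n * (n + 1) * C)))"
      by (simp add: E_C2_def n_def Let_def mult.assoc)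
    also have "\<dots> \<le> h_const \<nu> * ?Q"
      using h h0 n CD b(1) b(2)[OF gs]
      by (intro mult_left_mono mult_mono add_mono mult_right_mono) auto
    finally show "E_C2 f \<nu> C D \<le> h_const \<nu> * ?Q" .
  qed
qed

lemma E_C3_small:
  fixes s :: "real ^ 'n"
  assumes C3: "C_k 3 f" and N: "compact N" and CD: "0 \<le> C" "0 \<le> D"
  shows "\<exists>\<rho>0>0. \<forall>\<rho> z J \<sigma> \<nu>. \<rho> < \<rho>0 \<longrightarrow> grid_simplex \<rho> s z J \<sigma> \<nu> \<longrightarrow> convex hull set \<nu> \<subseteq> N \<longrightarrow> E_C3 f \<nu> C D \<le> 1"
proof -
  obtain b where b: "b > 0" "\<And>\<rho> z J \<sigma> \<nu>. grid_simplex \<rho> s z J \<sigma> \<nu> \<Longrightarrow> convex hull set \<nu> \<subseteq> N \<Longrightarrow>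
    0 \<le> B_const f \<nu> \<and> B_const f \<nu> \<le> b"
    by (rule B_const_bounded[OF N]) (rule that, assumption+)
  obtain b3 where b3: "b3 > 0" "\<And>\<rho> z J \<sigma> \<nu>. grid_simplex \<rho> s z J \<sigma> \<nu> \<Longrightarrow> convex hull set \<nu> \<subseteq> N \<Longrightarrow>
    0 \<le> B3_const f \<nu> \<and> B3_const f \<nu> \<le> b3"
    by (rule B3_const_bounded[OF N C3]) (rule that, assumption+)
  define n where "n = real CARD('n)"
  have n: "n \<ge> 0" by (simp add: n_def)
  show ?thesis
  proof (rule small_of_linear_bound)
    let ?Q = "1 * (n * (sqrt (n + 1) * (1 + 4 * n) * (b * D) + 2 * n * (n + 1) * (b3 * C)))"
    show "0 \<le> ?Q" using n b(1) b3(1) CD by (intro mult_nonneg_nonneg add_nonneg_nonneg) auto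
    fix \<rho> z J \<sigma> \<nu> assume gs: "grid_simplex \<rho> s z J \<sigma> \<nu>" "convex hull set \<nu> \<subseteq> N" and h: "h_const \<nu> \<le> 1"
    have h0: "0 \<le> h_const \<nu>" by (rule grid_simplex.h_const_bounds(1)[OF gs(1)])
    have "E_C3 f \<nu> C D = h_const \<nu> * (h_const \<nu> * (n * (sqrt (n + 1) * (1 + 4 * n) * (B_const f \<nu> * D)
        + 2 * n * (n + 1) * (B3_const f \<nu> * C))))"
      by (simp add: E_C3_def n_def Let_def power2_eq_square mult.assoc)
    also have "\<dots> \<le> h_const \<nu> * ?Q"
      using h h0 n CD b(1) b(2)[OF gs] b3(2)[OF gs]
      by (intro mult_left_mono mult_mono add_mono mult_right_mono) auto
    finally show "E_C3 f \<nu> C D \<le> h_const \<nu> * ?Q" .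
  qed
qed

end

theorem theorem5p1:
  fixes T \<epsilon>\<^sub>0 :: real
    and s :: "real ^ 'n"
    and f :: "real \<times> (real ^ 'n) \<Rightarrow> real ^ 'n"
    and \<Omega> \<C> :: "(complex \<times> (real ^ 'n)) set"
  assumes "T > 0"
    and "\<forall>i. s $ i > 0"
    and "\<forall>t x. f (t + T, x) = f (t, x)"
    and "C_k 2 f"
    and "\<forall>p. \<exists>x. solves_ivp f p x"
    and "periodic_orbit T f \<Omega>"
    and "exponentially_stable T f \<Omega>"
    and "\<C> \<in> set_class_N T"
    and "\<Omega> \<subseteq> \<C>"
    and "\<C> \<subseteq> basin T f \<Omega>"
    and "\<epsilon>\<^sub>0 > 0"
  shows "(\<exists>Kstar. \<forall>K\<ge>Kstar. sdp_feasible T s f \<C> \<epsilon>\<^sub>0 (E_C2 f) K \<and>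
            (\<exists>M C D. sdp_solution T s f \<C> \<epsilon>\<^sub>0 (E_C2 f) K M (\<lambda>_. C) (\<lambda>_. D))) \<and>
         (C_k 3 f \<longrightarrow>
           (\<exists>Kstar. \<forall>K\<ge>Kstar. sdp_feasible T s f \<C> \<epsilon>\<^sub>0 (E_C3 f) K \<and>
              (\<exists>M C D. sdp_solution T s f \<C> \<epsilon>\<^sub>0 (E_C3 f) K M (\<lambda>_. C) (\<lambda>_. D))))"
proof -
  interpret sys: periodic_C2_system T f
    using assms(1,3,4) by unfold_locales auto
  obtain u where u: "\<And>t. (u has_vector_derivative f (t, u t)) (at t)" "\<And>t. u (t + T) = u t"
    "\<Omega> = range (\<lambda>t. cyl T (t, u t))"
    using assms(6) unfolding periodic_orbit_def by blast
  interpret sol: periodic_solution T f u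
    by unfold_locales (use u in auto)
  have \<Omega>: "\<Omega> = sol.orbit" by (simp add: sol.orbit_def u(3))
  interpret stable_periodic_solution T f u
    by unfold_locales (use assms(5,7) \<Omega> in auto)
  have \<C>: "\<C> \<subseteq> basin T f sol.orbit" using assms(10) \<Omega> by simp
  obtain K2 where K2: "\<And>K. K \<ge> K2 \<Longrightarrow> \<exists>M C D. sdp_solution T s f \<C> \<epsilon>\<^sub>0 (E_C2 f) K M (\<lambda>_. C) (\<lambda>_. D)"
    by (rule sdp_solution_fine_mesh[OF assms(2,8) \<C> assms(11) sys.E_C2_small]) (assumption+, rule that)
  have K3: "\<exists>K3. \<forall>K\<ge>K3. \<exists>M C D. sdp_solution T s f \<C> \<epsilon>\<^sub>0 (E_C3 f) K M (\<lambda>_. C) (\<lambda>_. D)" if C3: "C_k 3 f"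
    by (rule sdp_solution_fine_mesh[OF assms(2,8) \<C> assms(11) sys.E_C3_small[OF C3]]) (assumption+, blast)
  show ?thesis
    unfolding sdp_feasible_def using K2 K3 by blast
qed

end
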